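(* Let $0\le\alpha<1$, let $\beta_1,\beta_2,\delta_1,\delta_2\ge 0$ and $\alpha_1,\alpha_2,\gamma_1,\gamma_2>0$ be real, and let $|\sigma|<1$. Let $f=h+\overline{g}\in K_{\hat H^o}$. Write $W_i=W_{(\alpha_i,\beta_i),(\gamma_i,\delta_i)}$ for $i=1,2$. If $$W_1'''(1)+(4-\alpha)W_1''(1)+2(1-\alpha)\big(W_1'(1)-1\big)+|\sigma|\Big(W_2'''(1)+(2+\alpha)W_2''(1)\Big)\le 2(1-\alpha),$$ then $L(f)=H+\overline{\sigma G}\in HK(\alpha)$.
   Context: $D=\{z\in\mathbb C:|z|<1\}$. $\hat H$ is the class of complex-valued harmonic functions $f=h+\overline g$ on $D$ with $h,g$ analytic in $D$, $h(z)=z+\sum_{n=2}^\infty A_nz^n$, $g(z)=\sum_{n=1}^\infty B_nz^n$, $|B_1|<1$. $S_{\hat H}$ is the class of sense-preserving univalent functions in $\hat H$, and $S_{\hat H^o}$ is the subclass with $g'(0)=B_1=0$. $K_{\hat H^o}$ is the class of $f\in S_{\hat H^o}$ such that $f(D)$ is convex. For $0\le\alpha<1$, $HK(\alpha)$ (harmonic convex functions of order $\alpha$) is the class of $f\in\hat H$ with $\frac{\partial}{\partial\theta}\arg\left(\frac{\partial}{\partial\theta}f(re^{i\theta})\right)>\alpha$ for all $0<r<1$, $0\le\theta\le2\pi$. Normalized four-parameter Wright function: for real $a,c>0$ and $b,d\ge0$, $$W_{(a,b),(c,d)}(z)=z+\sum_{n=2}^\infty\frac{\Gamma(a)\Gamma(c)}{\Gamma(a+(n-1)b)\,\Gamma(c+(n-1)d)}z^n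 .$$ $W'(1),W''(1),W'''(1)$ denote the sums at $z=1$ of the termwise derivatives of this series; a hypothesis involving them is understood to include that they are finite (automatic if $b+d>0$). The operator $L$ (depending on $\alpha_i,\beta_i,\gamma_i,\delta_i$, $i=1,2$, and $\sigma$) is $L(f)=H+\overline{\sigma G}$, where $H=h*W_{(\alpha_1,\beta_1),(\gamma_1,\delta_1)}$ and $G=g*W_{(\alpha_2,\beta_2),(\gamma_2,\delta_2)}$; here $*$ is the Hadamard product $\left(\sum a_nz^n\right)*\left(\sum b_nz^n\right)=\sum a_nb_nz^n$. *)

theory Defs
  imports "HOL-Complex_Analysis.Complex_Analysis"
begin

abbreviation unit_disc :: "complex set" where
  "unit_disc \<equiv> ball 0 1"

text \<open>
  Functions on the disc are total functions of which only the values on the disc matter.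
  Since \<open>g 0 = 0\<close>, the pair \<open>(h, g)\<close> is determined on the disc by \<open>f\<close>.
\<close>

definition harmonic_rep ::
    "(complex \<Rightarrow> complex) \<Rightarrow> (complex \<Rightarrow> complex) \<Rightarrow> (complex \<Rightarrow> complex) \<Rightarrow> bool" where
  "harmonic_rep f h g \<longleftrightarrow>
     h holomorphic_on unit_disc \<and> g holomorphic_on unit_disc \<and>
     h 0 = 0 \<and> deriv h 0 = 1 \<and> g 0 = 0 \<and> norm (deriv g 0) < 1 \<and>
     (\<forall>z\<in>unit_disc. f z = h z + cnj (g z))"

definition H_hat :: "(complex \<Rightarrow> complex) set" where
  "H_hat = {f. \<exists>h g. harmonic_rep f h g}"

text \<open>
  Determinant of the real derivative of \<open>f\<close> with respect to the basis \<open>1, \<i>\<close>: with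
  \<open>f = u + \<i> v\<close> the expression below is \<open>u\<^sub>x v\<^sub>y - v\<^sub>x u\<^sub>y\<close>.
\<close>

definition jacobian :: "(complex \<Rightarrow> complex) \<Rightarrow> complex \<Rightarrow> real" where
  "jacobian f z =
     (let T = frechet_derivative f (at z) in Re (T 1) * Im (T \<i>) - Im (T 1) * Re (T \<i>))"

definition sense_preserving :: "(complex \<Rightarrow> complex) \<Rightarrow> bool" where
  "sense_preserving f \<longleftrightarrow> (\<forall>z\<in>unit_disc. jacobian f z > 0)"

lemma jacobian_harmonic_rep:
  assumes "harmonic_rep f h g" "z \<in> unit_disc"
  shows "jacobian f z = (norm (deriv h z))\<^sup>2 - (norm (deriv g z))\<^sup>2"
proof -
  have "(h has_derivative (\<lambda>w. deriv h z * w)) (at z)"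
    and "(g has_derivative (\<lambda>w. deriv g z * w)) (at z)"
    using assms holomorphic_derivI[of _ unit_disc z]
    by (auto simp: harmonic_rep_def has_field_derivative_def)
  then have "((\<lambda>w. h w + cnj (g w)) has_derivative
               (\<lambda>w. deriv h z * w + cnj (deriv g z * w))) (at z)"
    by (intro derivative_intros)
  then have "(f has_derivative (\<lambda>w. deriv h z * w + cnj (deriv g z * w))) (at z)"
    by (rule has_derivative_transform_within_open[OF _ open_ball[of 0 1]])
       (use assms in \<open>auto simp: harmonic_rep_def\<close>)
  then have "frechet_derivative f (at z) = (\<lambda>w. deriv h z * w + cnj (deriv g z * w))"
    by (metis frechet_derivative_at)
  then show ?thesis
    by (simp add: jacobian_def cmod_power2) (simp add: power2_eq_square algebra_simps)
qed

definition S_H_hat :: "(complex \<Rightarrow> complex) set" where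
  "S_H_hat = {f \<in> H_hat. inj_on f unit_disc \<and> sense_preserving f}"

definition S_H_hat_o :: "(complex \<Rightarrow> complex) set" where
  "S_H_hat_o = {f \<in> S_H_hat. \<exists>h g. harmonic_rep f h g \<and> deriv g 0 = 0}"

definition K_H_hat_o :: "(complex \<Rightarrow> complex) set" where
  "K_H_hat_o = {f \<in> S_H_hat_o. convex (f ` unit_disc)}"

text \<open>
  A continuous branch of the argument along a curve that avoids 0; such a branch is unique up to an
  additive constant, so its derivative does not depend on the choice.
\<close>

definition arg_branch :: "(real \<Rightarrow> complex) \<Rightarrow> (real \<Rightarrow> real) \<Rightarrow> bool" where
  "arg_branch w \<phi> \<longleftrightarrow> continuous_on UNIV \<phi> \<and> (\<forall>t. w t \<noteq> 0 \<and> is_Arg (w t) (\<phi> t))"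

definition theta_deriv :: "(complex \<Rightarrow> complex) \<Rightarrow> real \<Rightarrow> real \<Rightarrow> complex" where
  "theta_deriv f r t = vector_derivative (\<lambda>s. f (rcis r s)) (at t)"

definition HK :: "real \<Rightarrow> (complex \<Rightarrow> complex) set" where
  "HK \<alpha> = {f \<in> H_hat. \<forall>r. 0 < r \<and> r < 1 \<longrightarrow>
     (\<exists>\<phi>. arg_branch (theta_deriv f r) \<phi> \<and>
        (\<forall>t\<in>{0..2 * pi}. \<exists>m. (\<phi> has_real_derivative m) (at t) \<and> m > \<alpha>))}"

text \<open>The value at \<open>n = 1\<close> is 1 for positive \<open>a\<close> and \<open>c\<close>.\<close>

definition wright_coeff :: "real \<Rightarrow> real \<Rightarrow> real \<Rightarrow> real \<Rightarrow> nat \<Rightarrow> real" where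
  "wright_coeff a b c d n =
     (if n = 0 then 0
      else Gamma a * Gamma c / (Gamma (a + (real n - 1) * b) * Gamma (c + (real n - 1) * d)))"

definition wright_fps :: "real \<Rightarrow> real \<Rightarrow> real \<Rightarrow> real \<Rightarrow> complex fps" where
  "wright_fps a b c d = Abs_fps (\<lambda>n. complex_of_real (wright_coeff a b c d n))"

text \<open>
  The iterate \<open>(diffs ^^ k) w\<close> is the coefficient sequence of the \<open>k\<close>-th termwise derivative of the
  power series with coefficients \<open>w\<close>. The sum at \<open>z = 1\<close> is meaningful only together with
  \<open>wright_deriv_finite\<close>.
\<close>

definition wright_deriv_finite :: "nat \<Rightarrow> real \<Rightarrow> real \<Rightarrow> real \<Rightarrow> real \<Rightarrow> bool" where
  "wright_deriv_finite k a b c d \<longleftrightarrow> summable ((diffs ^^ k) (wright_coeff a b c d))"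

definition wright_deriv_at_1 :: "nat \<Rightarrow> real \<Rightarrow> real \<Rightarrow> real \<Rightarrow> real \<Rightarrow> real" where
  "wright_deriv_at_1 k a b c d = suminf ((diffs ^^ k) (wright_coeff a b c d))"

definition hadamard :: "complex fps \<Rightarrow> complex fps \<Rightarrow> complex fps" where
  "hadamard A B = Abs_fps (\<lambda>n. fps_nth A n * fps_nth B n)"

definition wright_conv ::
    "real \<Rightarrow> real \<Rightarrow> real \<Rightarrow> real \<Rightarrow> (complex \<Rightarrow> complex) \<Rightarrow> complex \<Rightarrow> complex" where
  "wright_conv a b c d F = eval_fps (hadamard (fps_expansion F 0) (wright_fps a b c d))"

text \<open>The operator is given on the pair \<open>(h, g)\<close> representing \<open>f = h + cnj g\<close>.\<close>

definition L_op ::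
    "real \<Rightarrow> real \<Rightarrow> real \<Rightarrow> real \<Rightarrow> real \<Rightarrow> real \<Rightarrow> real \<Rightarrow> real \<Rightarrow> complex \<Rightarrow>
     (complex \<Rightarrow> complex) \<Rightarrow> (complex \<Rightarrow> complex) \<Rightarrow> complex \<Rightarrow> complex" where
  "L_op \<alpha>1 \<beta>1 \<gamma>1 \<delta>1 \<alpha>2 \<beta>2 \<gamma>2 \<delta>2 \<sigma> h g z =
     wright_conv \<alpha>1 \<beta>1 \<gamma>1 \<delta>1 h z + cnj (\<sigma> * wright_conv \<alpha>2 \<beta>2 \<gamma>2 \<delta>2 g z)"

end

theory Submission
  imports Defs "HOL-Real_Asymp.Real_Asymp"
begin

text \<open>
  The Taylor coefficients of \<open>h\<close> and \<open>g\<close> satisfy the bounds \<open>(n + 1) / 2\<close> and \<open>(n - 1) / 2\<close> of Clunie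
  and Sheil-Small. Multiplied by the Wright coefficients they turn the hypothesis into
  \<open>\<Sum> n (n - \<alpha>) |a\<^sub>n| + \<Sum> n (n + \<alpha>) |b\<^sub>n| \<le> 1 - \<alpha>\<close> (sums over \<open>n \<ge> 2\<close>) for the coefficients of \<open>L(f)\<close>,
  and this implies convexity of order \<open>\<alpha>\<close>.

  The coefficient bounds follow from the existence of unimodular \<open>a\<close>, \<open>P\<close> such that
  \<open>p(z) = P (a h'(P z) + cnj a g'(P z)) (1 - z\<^sup>2)\<close> has nonnegative real part: with \<open>g' = \<omega> h'\<close>, the
  function \<open>h'(P z)\<close> is up to a unimodular factor the product of \<open>p\<close>, \<open>1 / (1 - z\<^sup>2)\<close> and a function of
  real part at least \<open>1/2\<close>. The positivity says that \<open>Re (a f)\<close> increases along the hyperbolic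
  flow from \<open>-P\<close> to \<open>P\<close>. By the maximum principle this needs to be checked only on the unit circle, where it
  means that \<open>Re (a f)\<close> is monotone on both arcs between the antipodal points \<open>\<plusminus>P\<close>.

  For every \<open>a\<close> the sets \<open>Re (a f) > c\<close> and \<open>Re (a f) < c\<close> are connected, because \<open>f(D)\<close> is
  convex; as two crossing crosscuts of the disc meet, the boundary values of \<open>Re (a f)\<close> are unimodal.
  That \<open>a\<close> can be chosen so that maximum and minimum are antipodal is a connectedness argument in \<open>a\<close>.
  Boundary values exist after replacing \<open>f\<close> by \<open>f \<circ> \<phi>\<close>, where \<open>\<phi>\<close> is a Riemann map onto the
  preimage of a convex set compactly contained in \<open>f(D)\<close>: unimodality gives one-sided limits at
  every boundary point, and a Lindeloef argument shows that the two limits of \<open>\<phi>\<close> agree.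
\<close>

section \<open>Maximum principles\<close>

text \<open>The function \<open>Re (a f)\<close> is also the real part of the holomorphic function
  \<open>a h + cnj a g\<close>, so holomorphic tools apply for each \<open>a\<close>. The disc
  automorphisms \<open>(z + s) / (1 + s z)\<close> fix 1 and -1 and have velocity
  \<open>1 - z^2\<close> at \<open>s = 0\<close>. This is the origin of the factor in
  \<open>p\<close>, and the reason why the extremes must be antipodal; the argument of
  \<open>a\<close> is the one free parameter that can arrange this.

  The obstacle is the boundary: \<open>f(D)\<close> may be unbounded, and preimages of convex sets
  come with no regularity. Hence the crossing argument is stated for closures of level sets in the
  open disc, and boundary values are derived from it.

  The weights in the hypothesis stem from \<open>(n - \<alpha>) (n + 1) = (n - 1) (n - 2) + (4 -
  \<alpha>) (n - 1) + 2 (1 - \<alpha>)\<close> and \<open>(n + \<alpha>) (n - 1) = (n - 1) (n - 2) +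
  (2 + \<alpha>) (n - 1)\<close>; the 2 on its right-hand side matches the halves in the coefficient
  bounds.\<close>

lemma maximum_modulus_limsup:
  fixes G :: "complex \<Rightarrow> complex"
  assumes "open S" "bounded S" and hol: "G holomorphic_on S"
    and lim: "\<And>x e. x \<in> frontier S \<Longrightarrow> e > 0 \<Longrightarrow> \<exists>d>0. \<forall>z\<in>S \<inter> ball x d. norm (G z) < m + e"
    and "z \<in> S"
  shows "norm (G z) \<le> m"
proof (rule ccontr)
  assume "\<not> norm (G z) \<le> m"
  then have zm: "norm (G z) > m" by simp
  \<comment> \<open>The set \<open>S\<close> need be neither closed nor connected. A value above
    \<open>m\<close> keeps this superlevel set away from the frontier, so it is compact and the
    maximum is attained.\<close>
  define K where "K = {w \<in> S. norm (G w) \<ge> norm (G z)}"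
  have cont: "continuous_on S G"
    using hol holomorphic_on_imp_continuous_on by blast
  have "closed K"
    unfolding closed_limpt
  proof (intro allI impI)
    fix x assume lx: "x islimpt K"
    have xcl: "x \<in> closure S"
      using lx islimpt_subset[of x K S] by (auto simp: K_def closure_def)
    have "x \<in> S"
    proof (rule ccontr)
      assume "x \<notin> S"
      then have "x \<in> frontier S"
        using xcl \<open>open S\<close> by (simp add: frontier_def interior_open)
      then obtain d where "d > 0" and d: "\<forall>w\<in>S \<inter> ball x d. norm (G w) < m + (norm (G z) - m)"
        using lim[of x "norm (G z) - m"] zm by auto
      obtain y where "y \<in> K" "dist y x < d"
        using lx \<open>d > 0\<close> islimpt_approachable by blast
      then have "norm (G y) < norm (G z)"
        using bspec[OF d, of y] by (simp add: K_def dist_commute)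
      then show False
        using \<open>y \<in> K\<close> by (simp add: K_def)
    qed
    moreover have "closedin (top_of_set S) K"
    proof -
      have "K = S \<inter> (\<lambda>w. norm (G w)) -` {norm (G z)..}"
        by (auto simp: K_def)
      then show ?thesis
        by (simp only:) (intro continuous_closedin_preimage continuous_intros cont closed_atLeast)
    qed
    ultimately show "x \<in> K"
      using lx by (metis closedin_limpt)
  qed
  moreover have "bounded K"
    by (rule bounded_subset[OF \<open>bounded S\<close>]) (auto simp: K_def)
  ultimately have "compact K" by (simp add: compact_eq_bounded_closed)
  moreover have "z \<in> K" using \<open>z \<in> S\<close> by (simp add: K_def)
  moreover have "continuous_on K (\<lambda>w. norm (G w))"
    by (intro continuous_intros continuous_on_subset[OF cont]) (auto simp: K_def)
  ultimately obtain \<xi> where \<xi>: "\<xi> \<in> K" and max: "\<And>w. w \<in> K \<Longrightarrow> norm (G w) \<le> norm (G \<xi>)"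
    using continuous_attains_sup[of K "\<lambda>w. norm (G w)"] by blast
  have "\<xi> \<in> S" using \<xi> by (simp add: K_def)
  have max': "norm (G w) \<le> norm (G \<xi>)" if "w \<in> S" for w
  proof (cases "w \<in> K")
    case False
    then show ?thesis using that max[OF \<open>z \<in> K\<close>] by (auto simp: K_def)
  qed (use max in auto)
  \<comment> \<open>The maximum modulus principle needs a connected set. Constancy puts the
    component into the compact set \<open>K\<close>, so it is closed as well as open in the
    plane.\<close>
  define C where "C = connected_component_set S \<xi>"
  have CS: "C \<subseteq> S" and "\<xi> \<in> C" and "open C"
    using \<open>\<xi> \<in> S\<close> \<open>open S\<close> by (auto simp: C_def connected_component_subset open_connected_component)
  have "G constant_on C"
  proof (rule maximum_modulus_principle)
    show "G holomorphic_on C" using hol CS holomorphic_on_subset by blast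
    show "connected C" by (simp add: C_def)
  qed (use \<open>open C\<close> \<open>\<xi> \<in> C\<close> max' CS in auto)
  then have "C \<subseteq> K"
    using \<open>\<xi> \<in> C\<close> \<xi> CS unfolding constant_on_def K_def by force
  have "closed C"
    unfolding closed_limpt
  proof (intro allI impI)
    fix x assume lx: "x islimpt C"
    then have "x \<in> K"
      using \<open>closed K\<close> \<open>C \<subseteq> K\<close> closed_limpt islimpt_subset by blast
    then have "x \<in> S" by (simp add: K_def)
    moreover have "closedin (top_of_set S) C"
      by (simp add: C_def closedin_connected_component)
    ultimately show "x \<in> C"
      using lx by (metis closedin_limpt)
  qed
  then have "C = UNIV"
    using \<open>open C\<close> \<open>\<xi> \<in> C\<close> clopen by auto
  then show False
    using \<open>bounded S\<close> CS bounded_subset not_bounded_UNIV by metis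
qed

text \<open>The identity \<open>norm (exp (F z)) = exp (Re (F z))\<close> reduces this to the
  modulus.\<close>

lemma maximum_principle_Re:
  fixes F :: "complex \<Rightarrow> complex"
  assumes "open S" "bounded S" and hol: "F holomorphic_on S"
    and lim: "\<And>x e. x \<in> frontier S \<Longrightarrow> e > 0 \<Longrightarrow> \<exists>d>0. \<forall>z\<in>S \<inter> ball x d. Re (F z) < m + e"
    and "z \<in> S"
  shows "Re (F z) \<le> m"
proof -
  have "norm (exp (F z)) \<le> exp m"
  proof (rule maximum_modulus_limsup[OF assms(1,2) _ _ \<open>z \<in> S\<close>])
    show "(\<lambda>z. exp (F z)) holomorphic_on S"
      by (intro holomorphic_intros hol)
    fix x e :: complex and e' :: real assume x: "x \<in> frontier S" and e': "e' > 0"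
    have "ln (exp m + e') - m > 0"
      using e' ln_less_cancel_iff[of "exp m" "exp m + e'"] by (simp add: add_pos_pos)
    from lim[OF x this] show "\<exists>d>0. \<forall>z\<in>S \<inter> ball x d. norm (exp (F z)) < exp m + e'"
      by (smt (verit) e' exp_gt_zero exp_ln exp_less_cancel_iff norm_exp_eq_Re)
  qed
  then show ?thesis by simp
qed

text \<open>The squared distance to \<zeta> is \<open>1 + |x|^2 - 2 Re (cnj \<zeta> x)\<close>, and
  \<open>|x| \<le> 1\<close>.\<close>

lemma barrier_on_sphere:
  fixes x :: complex
  assumes "norm \<zeta> = 1" "norm x \<le> 1" "dist \<zeta> x = \<delta>" "\<delta> > 0"
  shows "1 \<le> 2 / \<delta>\<^sup>2 * (1 - Re (cnj \<zeta> * x))"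
proof -
  have "\<delta>\<^sup>2 = (norm (\<zeta> - x))\<^sup>2" using assms(3) by (simp add: dist_norm)
  also have "\<dots> = (norm \<zeta>)\<^sup>2 + (norm x)\<^sup>2 - 2 * Re (cnj \<zeta> * x)"
    by (simp only: cmod_power2) (simp add: power2_eq_square algebra_simps)
  also have "\<dots> \<le> 2 * (1 - Re (cnj \<zeta> * x))"
    using assms(1,2) power_le_one[of "norm x" 2] by simp
  finally show ?thesis
    using \<open>\<delta> > 0\<close> by (simp add: field_simps)
qed

text \<open>
  The barrier \<open>C (2 / \<delta>\<^sup>2) (1 - Re (cnj \<zeta> z))\<close> is at least \<open>C\<close> on \<open>|z - \<zeta>| = \<delta>\<close> and vanishes at \<open>\<zeta>\<close>;
  a component staying away from the unit circle would violate the maximum principle for \<open>Re F\<close>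
  minus the barrier.
\<close>

lemma reach_circle:
  fixes F :: "complex \<Rightarrow> complex"
  assumes hol: "F holomorphic_on ball 0 1" and "norm \<zeta> = 1" "\<delta> > 0"
    and z0: "z0 \<in> ball 0 1 \<inter> ball \<zeta> \<delta>" and "C \<ge> 0"
    and up: "\<And>z. z \<in> ball 0 1 \<Longrightarrow> Re (F z) \<le> c + C"
    and big: "Re (F z0) - c > C * (2 / \<delta>\<^sup>2 * (1 - Re (cnj \<zeta> * z0)))"
    and "\<eta> > 0"
  shows "\<exists>y\<in>connected_component_set {z \<in> ball 0 1 \<inter> ball \<zeta> \<delta>. Re (F z) > c} z0. norm y > 1 - \<eta>"
proof (rule ccontr)
  define A where "A = {z \<in> ball 0 1 \<inter> ball \<zeta> \<delta>. Re (F z) > c}"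
  define V where "V = connected_component_set A z0"
  assume "\<not> ?thesis"
  then have V1: "norm y \<le> 1 - \<eta>" if "y \<in> V" for y
    using that by (force simp: V_def A_def)
  have cont: "continuous_on (ball 0 1) (\<lambda>z. Re (F z))"
    using hol by (intro continuous_intros holomorphic_on_imp_continuous_on)
  have "open A"
  proof -
    have "continuous_on (ball 0 1 \<inter> ball \<zeta> \<delta>) (\<lambda>z. Re (F z))"
      using cont continuous_on_subset by blast
    then have "open ((ball 0 1 \<inter> ball \<zeta> \<delta>) \<inter> (\<lambda>z. Re (F z)) -` {c<..})"
      by (intro continuous_open_preimage) auto
    moreover have "(ball 0 1 \<inter> ball \<zeta> \<delta>) \<inter> (\<lambda>z. Re (F z)) -` {c<..} = A"
      by (auto simp: A_def)
    ultimately show ?thesis by simp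
  qed
  have le1: "Re (cnj \<zeta> * z) < 1" if "norm z < 1" for z
    using complex_Re_le_cmod[of "cnj \<zeta> * z"] that \<open>norm \<zeta> = 1\<close> by (simp add: norm_mult)
  have "z0 \<in> A"
  proof -
    have "C * (2 / \<delta>\<^sup>2 * (1 - Re (cnj \<zeta> * z0))) \<ge> 0"
      using le1[of z0] z0 \<open>C \<ge> 0\<close> by (intro mult_nonneg_nonneg) auto
    then show ?thesis using z0 big by (auto simp: A_def)
  qed
  have "open V" "V \<subseteq> A" "z0 \<in> V" "connected V"
    using \<open>open A\<close> \<open>z0 \<in> A\<close> by (auto simp: V_def connected_component_subset open_connected_component)
  define q where "q = (\<lambda>z. of_real (C * 2 / \<delta>\<^sup>2) * (1 - cnj \<zeta> * z))"
  have "Re (F z0 - q z0) \<le> c"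
  proof (rule maximum_principle_Re[OF \<open>open V\<close> _ _ _ \<open>z0 \<in> V\<close>])
    show "bounded V"
      using \<open>V \<subseteq> A\<close> by (rule bounded_subset[rotated]) (auto simp: A_def intro: bounded_subset[OF bounded_ball[of 0 1]])
    have "V \<subseteq> ball 0 1" using \<open>V \<subseteq> A\<close> by (auto simp: A_def)
    then show "(\<lambda>z. F z - q z) holomorphic_on V"
      unfolding q_def by (intro holomorphic_intros holomorphic_on_subset[OF hol])
    fix x :: complex and e :: real assume x: "x \<in> frontier V" and "e > 0"
    have xcl: "x \<in> closure V" and xV: "x \<notin> V"
      using x \<open>open V\<close> by (auto simp: frontier_def interior_open)
    have "closure V \<subseteq> cball 0 (1-\<eta>)"
      by (rule closure_minimal) (use V1 in auto)
    then have xD: "x \<in> ball 0 1" using xcl \<open>\<eta> > 0\<close> by force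
    have "closure V \<subseteq> cball \<zeta> \<delta>"
      by (rule closure_minimal) (use \<open>V \<subseteq> A\<close> in \<open>auto simp: A_def\<close>)
    then have xd: "dist \<zeta> x \<le> \<delta>" using xcl by auto
    have "Re (F x - q x) \<le> c"
    proof (cases "dist \<zeta> x = \<delta>")
      case True
      have "1 \<le> 2 / \<delta>\<^sup>2 * (1 - Re (cnj \<zeta> * x))"
        using barrier_on_sphere[OF \<open>norm \<zeta> = 1\<close> _ True \<open>\<delta> > 0\<close>] xD by simp
      then have "C * 1 \<le> C * (2 / \<delta>\<^sup>2 * (1 - Re (cnj \<zeta> * x)))"
        using \<open>C \<ge> 0\<close> by (intro mult_left_mono)
      moreover have "Re (q x) = C * (2 / \<delta>\<^sup>2 * (1 - Re (cnj \<zeta> * x)))"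
        by (simp add: q_def Re_complex_of_real)
      ultimately show ?thesis using up[OF xD] by simp
    next
      case False
      then have xb: "x \<in> ball \<zeta> \<delta>" using xd by auto
      have "Re (F x) \<le> c"
      proof (rule ccontr)
        assume "\<not> ?thesis"
        then have "x \<in> A" using xb xD by (auto simp: A_def)
        \<comment> \<open>A limit point of a component that lies in \<open>A\<close> belongs to the
          component. So frontier points of \<open>V\<close> inside both balls have
          \<open>Re F \<le> c\<close>.\<close>
        have "connected (insert x V)"
          by (rule connected_intermediate_closure[OF \<open>connected V\<close>]) (use xcl closure_subset in auto)
        then have "insert x V \<subseteq> V"
          unfolding V_def using \<open>z0 \<in> V\<close> \<open>V \<subseteq> A\<close> \<open>x \<in> A\<close>
          by (intro connected_component_maximal) (auto simp: V_def)
        then show False using xV by auto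
      qed
      moreover have "Re (q x) \<ge> 0"
        using le1[of x] xD \<open>C \<ge> 0\<close> by (simp add: q_def Re_complex_of_real mult_nonneg_nonneg)
      ultimately show ?thesis by simp
    qed
    have "isCont (\<lambda>z. Re (F z - q z)) x"
    proof -
      have "continuous_on (ball 0 1) (\<lambda>z. Re (F z - q z))"
        unfolding q_def using hol by (intro continuous_intros holomorphic_on_imp_continuous_on)
      then show ?thesis using xD by (simp add: continuous_on_eq_continuous_at)
    qed
    then obtain d where "d > 0" and "\<And>z. dist z x < d \<Longrightarrow> dist (Re (F z - q z)) (Re (F x - q x)) < e"
      using \<open>e > 0\<close> unfolding continuous_at_eps_delta by (metis dist_commute dist_norm)
    then show "\<exists>d>0. \<forall>z\<in>V \<inter> ball x d. Re (F z - q z) < c + e"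
      using \<open>Re (F x - q x) \<le> c\<close>
      by (intro exI[of _ d]) (force simp: dist_real_def dist_commute abs_less_iff)
  qed
  moreover have "Re (q z0) = C * (2 / \<delta>\<^sup>2 * (1 - Re (cnj \<zeta> * z0)))"
    by (simp add: q_def Re_complex_of_real)
  ultimately show False
    using big by simp
qed

section \<open>Crossing level sets\<close>

text \<open>The disc becomes the upper half-plane and the circle without -1 the real line, traversed
  in the direction of increasing angle: \<open>cis t\<close> goes to \<open>tan (t / 2)\<close>.
  Cyclic order thus becomes the order of real numbers.\<close>

definition cayley :: "complex \<Rightarrow> complex" where
  "cayley z = \<i> * (1 - z) / (1 + z)"

lemma cayley_inj: "cayley z = cayley w \<Longrightarrow> z \<noteq> - 1 \<Longrightarrow> w \<noteq> - 1 \<Longrightarrow> z = w"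
proof -
  assume *: "cayley z = cayley w" "z \<noteq> - 1" "w \<noteq> - 1"
  then have "1 + z \<noteq> 0" "1 + w \<noteq> 0" by (auto simp: add_eq_0_iff)
  with *(1) have "(1 - z) * (1 + w) = (1 - w) * (1 + z)"
    by (simp add: cayley_def field_simps)
  then show "z = w" by (simp add: algebra_simps)
qed

lemma Im_cayley: "z \<noteq> - 1 \<Longrightarrow> Im (cayley z) = (1 - (norm z)\<^sup>2) / (norm (1 + z))\<^sup>2"
proof -
  assume "z \<noteq> - 1"
  have "cayley z = \<i> * (1 - z) * cnj (1 + z) / (of_real (norm (1 + z)))\<^sup>2"
    unfolding cayley_def by (subst complex_div_cnj) (simp only: of_real_power)
  then have "Im (cayley z) = Im (\<i> * (1 - z) * cnj (1 + z)) / (norm (1 + z))\<^sup>2"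
    by (simp only: of_real_power[symmetric] Im_divide_of_real)
  also have "Im (\<i> * (1 - z) * cnj (1 + z)) = 1 - (norm z)\<^sup>2"
    by (simp only: cmod_power2) (simp add: power2_eq_square algebra_simps)
  finally show ?thesis .
qed

lemma continuous_on_cayley: "- 1 \<notin> S \<Longrightarrow> continuous_on S cayley"
  unfolding cayley_def by (intro continuous_intros) (auto simp: add_eq_0_iff)

text \<open>In the half-plane model the four endpoints alternate on the real line. This is the
  Fashoda situation for two paths in a box that start and end on the same edge.\<close>

lemma disc_paths_cross:
  fixes p q :: "real \<Rightarrow> complex"
  assumes "path p" "path q"
    and pD: "path_image p \<subseteq> cball 0 1 - {- 1}" and qD: "path_image q \<subseteq> cball 0 1 - {- 1}"
    and n: "norm (pathstart p) = 1" "norm (pathfinish p) = 1"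
      "norm (pathstart q) = 1" "norm (pathfinish q) = 1"
    and lt: "Re (cayley (pathstart p)) < Re (cayley (pathstart q))"
      "Re (cayley (pathstart q)) < Re (cayley (pathfinish p))"
      "Re (cayley (pathfinish p)) < Re (cayley (pathfinish q))"
  obtains z where "z \<in> path_image p" "z \<in> path_image q"
proof -
  define J :: "complex \<Rightarrow> real^2" where "J = (\<lambda>w. \<chi> i. if i = 1 then Re w else Im w)"
  have J1: "J w $ 1 = Re w" and J2: "J w $ 2 = Im w" for w by (simp_all add: J_def)
  have Jinj: "w = w'" if "J w = J w'" for w w'
    using that J1 J2 by (metis complex_eqI)
  have contJ: "continuous_on S (\<lambda>x. J (f x))" if "continuous_on S f" for S f
    unfolding J_def
  proof (intro continuous_on_vec_lambda)
    fix i :: 2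
    show "continuous_on S (\<lambda>x. if i = 1 then Re (f x) else Im (f x))"
      by (cases "i = 1") (simp_all add: continuous_on_Re continuous_on_Im that)
  qed
  have cp: "path (\<lambda>t. J (cayley (r t)))" if "path r" "path_image r \<subseteq> cball 0 1 - {- 1}" for r
    unfolding path_def
    by (intro contJ continuous_on_compose2[OF continuous_on_cayley[of "path_image r"]])
       (use that in \<open>auto simp: path_def path_image_def\<close>)
  define p' q' where "p' = (\<lambda>t. J (cayley (p t)))" and "q' = (\<lambda>t. J (cayley (q t)))"
  have im': "path_image p' = (\<lambda>z. J (cayley z)) ` path_image p" "path_image q' = (\<lambda>z. J (cayley z)) ` path_image q"
    by (simp_all add: path_image_def p'_def q'_def image_image)
  have "path p'" "path q'"
    using cp assms(1-4) by (auto simp: p'_def q'_def)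
  then have "bounded (path_image p' \<union> path_image q')"
    by (simp add: bounded_path_image)
  then obtain R where R: "\<And>x. x \<in> path_image p' \<union> path_image q' \<Longrightarrow> norm x \<le> R"
    by (meson bounded_iff)
  \<comment> \<open>The lower edge of the box lies on the real axis, where the endpoints are; the
    paths stay above it because \<open>Im (cayley z) \<ge> 0\<close> on the closed disc without
    -1.\<close>
  define a b :: "real^2" where "a = (\<chi> i. if i = 1 then - R else 0)" and "b = (\<chi> i. R)"
  have Im0: "Im (cayley z) = 0" if "norm z = 1" "z \<noteq> - 1" for z
    using that by (simp add: Im_cayley)
  have Imp: "Im (cayley z) \<ge> 0" if "z \<in> cball 0 1 - {- 1}" for z
    using that by (auto simp: Im_cayley intro!: divide_nonneg_nonneg power_le_one)
  have box: "x \<in> cbox a b" if "norm x \<le> R" "vec_nth x 2 \<ge> 0" for x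
    using that component_le_norm_cart[of x 1] component_le_norm_cart[of x 2]
    by (auto simp: mem_box_cart a_def b_def forall_2 abs_le_iff)
  have end_p: "pathstart p \<in> path_image p" "pathfinish p \<in> path_image p"
    and end_q: "pathstart q \<in> path_image q" "pathfinish q \<in> path_image q"
    by auto
  obtain x where "x \<in> path_image p'" "x \<in> path_image q'"
  proof (rule fashoda_interlace[OF \<open>path p'\<close> \<open>path q'\<close>, of a b])
    have "vec_nth x 2 \<ge> 0" if "x \<in> path_image p' \<union> path_image q'" for x
    proof -
      obtain z where z: "z \<in> path_image p \<union> path_image q" "x = J (cayley z)"
        using \<open>x \<in> _\<close> unfolding im' by blast
      then have "z \<in> cball 0 1 - {- 1}" using pD qD by blast
      then show ?thesis using Imp z(2) J2 by metis
    qed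
    then show "path_image p' \<subseteq> cbox a b" "path_image q' \<subseteq> cbox a b"
      using R box by auto
    show "pathstart p' $ 2 = a $ 2" "pathfinish p' $ 2 = a $ 2"
      "pathstart q' $ 2 = a $ 2" "pathfinish q' $ 2 = a $ 2"
      using Im0 n pD qD end_p end_q
      by (auto simp: p'_def q'_def a_def pathstart_def pathfinish_def J2)
    show "pathstart p' $ 1 < pathstart q' $ 1" "pathstart q' $ 1 < pathfinish p' $ 1"
      "pathfinish p' $ 1 < pathfinish q' $ 1"
      using lt by (auto simp: p'_def q'_def pathstart_def pathfinish_def J1)
  qed
  then obtain z w where zw: "z \<in> path_image p" "w \<in> path_image q" "J (cayley z) = J (cayley w)"
    unfolding im' by (elim imageE) simp
  have "cayley z = cayley w" using Jinj zw(3) .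
  moreover have "z \<noteq> - 1" "w \<noteq> - 1" using pD qD zw(1,2) by blast+
  ultimately have "z = w" by (rule cayley_inj)
  with zw show ?thesis using that by blast
qed

section \<open>Holomorphic functions whose real part has connected level sets\<close>

abbreviation above :: "(complex \<Rightarrow> complex) \<Rightarrow> real \<Rightarrow> complex set" where
  "above F c \<equiv> {z \<in> ball 0 1. Re (F z) > c}"

abbreviation below :: "(complex \<Rightarrow> complex) \<Rightarrow> real \<Rightarrow> complex set" where
  "below F c \<equiv> {z \<in> ball 0 1. Re (F z) < c}"

text \<open>All that the boundary analysis retains of convexity: half-planes cut a convex set in
  connected pieces. \<open>F\<close> is holomorphic but enters through its real part, so
  \<open>Re (a f)\<close> of a harmonic \<open>f\<close> is covered by \<open>a h + cnj a g\<close>.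
  Boundedness serves the barrier argument.\<close>

definition level_connected :: "(complex \<Rightarrow> complex) \<Rightarrow> bool" where
  "level_connected F \<longleftrightarrow> F holomorphic_on ball 0 1 \<and> (\<exists>B. \<forall>z\<in>ball 0 1. \<bar>Re (F z)\<bar> \<le> B) \<and>
     (\<forall>c. connected (above F c) \<and> connected (below F c))"

lemma level_connected_uminus:
  assumes "level_connected F"
  shows "level_connected (\<lambda>z. - F z)"
proof -
  have "{z \<in> ball 0 1. - Re (F z) > c} = below F (- c)"
    "{z \<in> ball 0 1. - Re (F z) < c} = above F (- c)" for c
    by auto
  then show ?thesis
    using assms by (auto simp: level_connected_def intro!: holomorphic_intros)
qed

lemma level_connected_rotate:
  assumes "level_connected F" "norm e = 1"
  shows "level_connected (\<lambda>z. F (e * z))"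
proof -
  have "{z \<in> ball 0 1. P (e * z)} = (\<lambda>z. cnj e * z) ` {z \<in> ball 0 1. P z}" for P
  proof -
    have "cnj e * (e * z) = z" and ee: "e * (cnj e * z) = z" for z
      using assms(2) complex_norm_square[of e] by (simp_all add: mult.assoc[symmetric] mult.commute)
    then have "z \<in> (\<lambda>z. cnj e * z) ` {z \<in> ball 0 1. P z}" if "z \<in> ball 0 1" "P (e * z)" for z
      using that assms(2) by (intro image_eqI[of _ _ "e * z"]) (auto simp: norm_mult)
    then show ?thesis
      using assms(2) ee by (fastforce simp only: norm_mult complex_mod_cnj mem_ball_0 mult_1_left)
  qed
  note im = this[of "\<lambda>z. Re (F z) > _"] this[of "\<lambda>z. Re (F z) < _"]
  have "connected ((\<lambda>z. cnj e * z) ` S)" if "connected S" for S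
    using that by (intro connected_continuous_image continuous_intros)
  moreover have "(\<lambda>z. F (e * z)) holomorphic_on ball 0 1"
    using assms by (intro holomorphic_on_compose_gen[of "\<lambda>z. e * z" _ F "ball 0 1", unfolded o_def] holomorphic_intros)
       (auto simp: level_connected_def norm_mult)
  moreover have "\<exists>B. \<forall>z\<in>ball 0 1. \<bar>Re (F (e * z))\<bar> \<le> B"
  proof -
    obtain B where B: "\<forall>z\<in>ball 0 1. \<bar>Re (F z)\<bar> \<le> B"
      using assms(1) unfolding level_connected_def by blast
    then have "\<forall>z\<in>ball 0 1. \<bar>Re (F (e * z))\<bar> \<le> B"
      using assms(2) by (simp add: norm_mult)
    then show ?thesis by blast
  qed
  ultimately show ?thesis
    using assms(1) unfolding level_connected_def im by blast
qed

text \<open>Membership in a closure only provides points near \<zeta> with values above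
  \<open>c'\<close>. Passing to the lower level \<open>c\<close> leaves a margin
  \<open>c' - c\<close> that pays for the barrier at such a point; the component around it then
  comes arbitrarily close to the circle without leaving the small ball.\<close>

lemma level_connected_reach:
  assumes lc: "level_connected F" and "norm \<zeta> = 1"
    and cl: "\<zeta> \<in> closure (above F c')" and "c < c'" "\<delta> > 0"
  obtains V where "open V" "connected V" "V \<noteq> {}" "V \<subseteq> {z \<in> ball 0 1 \<inter> ball \<zeta> \<delta>. Re (F z) > c}"
    "\<And>\<eta>. \<eta> > 0 \<Longrightarrow> \<exists>y\<in>V. norm y > 1 - \<eta>"
proof -
  obtain B where B: "\<And>z. z \<in> ball 0 1 \<Longrightarrow> \<bar>Re (F z)\<bar> \<le> B" and hol: "F holomorphic_on ball 0 1"
    using lc unfolding level_connected_def by blast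
  define C where "C = \<bar>B\<bar> + \<bar>c\<bar> + 1"
  have "C > 0" by (simp add: C_def add_nonneg_pos)
  \<comment> \<open>Since \<open>1 - Re (cnj \<zeta> z) \<le> |\<zeta> - z|\<close>, the barrier is
    smaller than \<open>c' - c\<close> within this distance of \<zeta>.\<close>
  define r where "r = min \<delta> ((c' - c) / (C * (2 / \<delta>\<^sup>2)))"
  have "r > 0" using \<open>C > 0\<close> \<open>c < c'\<close> \<open>\<delta> > 0\<close> by (simp add: r_def)
  then obtain z0 where z0: "z0 \<in> ball 0 1" "Re (F z0) > c'" "dist z0 \<zeta> < r"
    using cl by (auto simp: closure_approachable)
  have "1 - Re (cnj \<zeta> * z0) = Re (cnj \<zeta> * (\<zeta> - z0))"
    using \<open>norm \<zeta> = 1\<close> complex_norm_square[of \<zeta>] by (simp add: right_diff_distrib mult.commute)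
  also have "\<dots> \<le> norm (cnj \<zeta> * (\<zeta> - z0))" by (rule complex_Re_le_cmod)
  also have "\<dots> < r" using z0 \<open>norm \<zeta> = 1\<close> by (simp add: norm_mult dist_norm norm_minus_commute)
  finally have "1 - Re (cnj \<zeta> * z0) < (c' - c) / (C * (2 / \<delta>\<^sup>2))"
    by (simp add: r_def)
  then have "C * (2 / \<delta>\<^sup>2 * (1 - Re (cnj \<zeta> * z0))) < c' - c"
    using \<open>C > 0\<close> \<open>\<delta> > 0\<close> by (simp add: field_simps)
  then have big: "C * (2 / \<delta>\<^sup>2 * (1 - Re (cnj \<zeta> * z0))) < Re (F z0) - c"
    using z0 by simp
  define A where "A = {z \<in> ball 0 1 \<inter> ball \<zeta> \<delta>. Re (F z) > c}"
  have "open A"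
  proof -
    have "open ((ball 0 1 \<inter> ball \<zeta> \<delta>) \<inter> (\<lambda>z. Re (F z)) -` {c<..})"
      by (intro continuous_open_preimage continuous_intros
          continuous_on_subset[OF holomorphic_on_imp_continuous_on[OF hol]]) auto
    moreover have "(ball 0 1 \<inter> ball \<zeta> \<delta>) \<inter> (\<lambda>z. Re (F z)) -` {c<..} = A"
      by (auto simp: A_def)
    ultimately show ?thesis by simp
  qed
  have "z0 \<in> A" using z0 \<open>c < c'\<close> by (auto simp: A_def r_def dist_commute)
  show ?thesis
  proof (rule that[of "connected_component_set A z0"])
    show "open (connected_component_set A z0)" using \<open>open A\<close> open_connected_component by blast
    show "connected_component_set A z0 \<noteq> {}" using \<open>z0 \<in> A\<close> connected_component_refl[of z0 A] by blast
    show "connected_component_set A z0 \<subseteq> {z \<in> ball 0 1 \<inter> ball \<zeta> \<delta>. Re (F z) > c}"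
      using connected_component_subset[of A z0] by (auto simp: A_def)
    show "\<exists>y\<in>connected_component_set A z0. norm y > 1 - \<eta>" if "\<eta> > 0" for \<eta>
      unfolding A_def
    proof (rule reach_circle[OF hol \<open>norm \<zeta> = 1\<close> \<open>\<delta> > 0\<close> _ _ _ big that])
      show "Re (F z) \<le> c + C" if "z \<in> ball 0 1" for z
        using B[OF that] by (simp add: C_def)
    qed (use z0 \<open>C > 0\<close> in \<open>auto simp: r_def dist_commute\<close>)
  qed auto
qed

text \<open>Ends of crosscuts: \<open>y\<close> is joined to its radial projection
  \<open>sgn y\<close>. The segment has length \<open>1 - |y| < \<delta> / 2\<close>, and moduli on
  it do not fall below \<open>|y|\<close>, so it avoids all points of smaller modulus.\<close>

lemma radial_segment:
  fixes y \<zeta> :: complex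
  assumes "y \<noteq> 0" "norm y < 1" "w \<in> closed_segment (sgn y) y"
    and "norm (\<zeta> - y) < \<delta> / 2" "norm y > 1 - \<delta> / 2"
  shows "norm w \<ge> norm y" "norm w \<le> 1" "w \<in> ball \<zeta> \<delta>"
proof -
  obtain t where t: "0 \<le> t" "t \<le> 1" "w = (1 - t) *\<^sub>R sgn y + t *\<^sub>R y"
    using assms(3) by (auto simp: closed_segment_def)
  have w: "w = ((1 - t) / norm y + t) *\<^sub>R y"
    by (simp add: t sgn_div_norm scaleR_left_distrib divide_inverse)
  then have "norm w = ((1 - t) / norm y + t) * norm y"
    using t by simp
  also have "\<dots> = (1 - t) + t * norm y" using assms(1) by (simp add: distrib_right)
  finally have nw: "norm w = (1 - t) + t * norm y" .
  have "t * (1 - norm y) \<le> 1 * (1 - norm y)" "0 \<le> t * (1 - norm y)"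
    using t assms(2) by (intro mult_right_mono mult_nonneg_nonneg; simp)+
  then show "norm w \<ge> norm y" "norm w \<le> 1" by (auto simp: nw algebra_simps)
  have "w - y = ((1 - t) / norm y * (1 - norm y)) *\<^sub>R y"
    using assms(1) by (simp add: w scaleR_left_diff_distrib[symmetric] field_simps)
      (simp add: scaleR_left_diff_distrib algebra_simps add_divide_distrib diff_divide_distrib)
  then have "norm (w - y) = (1 - t) * (1 - norm y)"
    using assms(1,2) t by simp
  also have "\<dots> \<le> 1 * (1 - norm y)" using t assms(2) by (intro mult_right_mono) auto
  finally have "norm (w - y) < \<delta> / 2" using assms(5) by simp
  then show "w \<in> ball \<zeta> \<delta>"
    using assms(4) norm_triangle_lt[of "\<zeta> - y" "y - w" \<delta>] by (simp add: dist_norm norm_minus_commute)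
qed

lemma compact_subset_disc:
  fixes K :: "complex set"
  assumes "compact K" "K \<subseteq> ball 0 1"
  obtains \<eta> where "\<eta> > 0" "\<And>z. z \<in> K \<Longrightarrow> norm z < 1 - \<eta>"
proof (cases "K = {}")
  case False
  obtain x where "x \<in> K" "\<And>z. z \<in> K \<Longrightarrow> norm z \<le> norm x"
    using continuous_attains_sup[OF assms(1) False, of norm] by (auto intro: continuous_intros)
  moreover have "norm x < 1" using \<open>x \<in> K\<close> assms(2) by auto
  ultimately show ?thesis
    using that[of "(1 - norm x) / 2"] by (force simp: field_simps)
qed (use that[of 1] in auto)

text \<open>
  The order of choices matters: the path in the lower set is fixed before the radial ends of the
  upper crosscut, and only then are the radial ends of the lower crosscut chosen. Components that
  reach the circle provide endpoints close enough to the circle at each stage.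
\<close>

lemma level_connected_interlace:
  assumes lc: "level_connected F"
    and n: "norm \<zeta>1 = 1" "norm \<zeta>2 = 1" "norm \<zeta>3 = 1" "norm \<zeta>4 = 1"
    and m1: "\<zeta>1 \<noteq> - 1" "\<zeta>2 \<noteq> - 1" "\<zeta>3 \<noteq> - 1" "\<zeta>4 \<noteq> - 1"
    and lt: "Re (cayley \<zeta>1) < Re (cayley \<zeta>2)" "Re (cayley \<zeta>2) < Re (cayley \<zeta>3)"
       "Re (cayley \<zeta>3) < Re (cayley \<zeta>4)"
    and hi: "\<zeta>1 \<in> closure (above F c')" "\<zeta>3 \<in> closure (above F c')"
    and lo: "\<zeta>2 \<in> closure (below F c'')" "\<zeta>4 \<in> closure (below F c'')"
    and "c'' < c'"
  shows False
proof -
  define c where "c = (c' + c'') / 2"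
  have c: "c < c'" "- c < - c''" using \<open>c'' < c'\<close> by (auto simp: c_def)
  have hol: "F holomorphic_on ball 0 1" using lc by (simp add: level_connected_def)
  define X where "X = (\<lambda>z. Re (cayley z))"
  \<comment> \<open>Half of the smallest gap: neighbourhoods in which the Cayley coordinate varies
    by less than \<epsilon> are disjoint and stay in order.\<close>
  define \<epsilon> where "\<epsilon> = min (X \<zeta>2 - X \<zeta>1) (min (X \<zeta>3 - X \<zeta>2) (X \<zeta>4 - X \<zeta>3)) / 2"
  have "\<epsilon> > 0" and gap: "X \<zeta>1 + \<epsilon> \<le> X \<zeta>2 - \<epsilon>" "X \<zeta>2 + \<epsilon> \<le> X \<zeta>3 - \<epsilon>" "X \<zeta>3 + \<epsilon> \<le> X \<zeta>4 - \<epsilon>"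
    using lt by (auto simp: \<epsilon>_def X_def min_def field_simps)
  have nbh: "\<exists>\<delta>>0. \<forall>z\<in>ball \<zeta> \<delta>. z \<noteq> - 1 \<and> \<bar>X z - X \<zeta>\<bar> < \<epsilon>" if "\<zeta> \<noteq> - 1" for \<zeta>
  proof -
    have "open (- {- 1 :: complex})" by (simp add: open_Compl)
    moreover have "continuous_on (- {- 1}) X"
      unfolding X_def by (intro continuous_intros continuous_on_cayley) auto
    ultimately have "isCont X \<zeta>"
      using that by (simp add: continuous_on_eq_continuous_at)
    then obtain d where "d > 0" "\<And>z. dist z \<zeta> < d \<Longrightarrow> dist (X z) (X \<zeta>) < \<epsilon>"
      using \<open>\<epsilon> > 0\<close> unfolding continuous_at_eps_delta by (metis dist_norm)
    then show ?thesis
      using that by (intro exI[of _ "min d (dist \<zeta> (- 1))"]) (auto simp: dist_real_def dist_commute)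
  qed
  obtain \<delta>1 where \<delta>1: "\<delta>1 > 0" "\<forall>z\<in>ball \<zeta>1 \<delta>1. z \<noteq> - 1 \<and> \<bar>X z - X \<zeta>1\<bar> < \<epsilon>" using nbh m1 by blast
  obtain \<delta>2 where \<delta>2: "\<delta>2 > 0" "\<forall>z\<in>ball \<zeta>2 \<delta>2. z \<noteq> - 1 \<and> \<bar>X z - X \<zeta>2\<bar> < \<epsilon>" using nbh m1 by blast
  obtain \<delta>3 where \<delta>3: "\<delta>3 > 0" "\<forall>z\<in>ball \<zeta>3 \<delta>3. z \<noteq> - 1 \<and> \<bar>X z - X \<zeta>3\<bar> < \<epsilon>" using nbh m1 by blast
  obtain \<delta>4 where \<delta>4: "\<delta>4 > 0" "\<forall>z\<in>ball \<zeta>4 \<delta>4. z \<noteq> - 1 \<and> \<bar>X z - X \<zeta>4\<bar> < \<epsilon>" using nbh m1 by blast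
  \<comment> \<open>The bound 1 forces the later endpoints \<open>y1\<close> to \<open>y4\<close> to
    have modulus above 1/2, so that \<open>sgn\<close> projects them to the circle.\<close>
  define \<delta> where "\<delta> = min 1 (min (min \<delta>1 \<delta>2) (min \<delta>3 \<delta>4))"
  have "\<delta> > 0" "\<delta> \<le> 1" using \<delta>1 \<delta>2 \<delta>3 \<delta>4 by (auto simp: \<delta>_def)
  have ballX: "z \<noteq> - 1 \<and> \<bar>X z - X \<zeta>\<bar> < \<epsilon>" if "z \<in> ball \<zeta> \<delta>" "\<zeta> \<in> {\<zeta>1, \<zeta>2, \<zeta>3, \<zeta>4}" for z \<zeta>
  proof -
    have "\<delta> \<le> \<delta>1" "\<delta> \<le> \<delta>2" "\<delta> \<le> \<delta>3" "\<delta> \<le> \<delta>4" by (simp_all add: \<delta>_def)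
    then have "ball \<zeta>1 \<delta> \<subseteq> ball \<zeta>1 \<delta>1" "ball \<zeta>2 \<delta> \<subseteq> ball \<zeta>2 \<delta>2" "ball \<zeta>3 \<delta> \<subseteq> ball \<zeta>3 \<delta>3"
      "ball \<zeta>4 \<delta> \<subseteq> ball \<zeta>4 \<delta>4"
      by (simp_all only: subset_ball)
    then show ?thesis
      using that \<delta>1(2) \<delta>2(2) \<delta>3(2) \<delta>4(2) by blast
  qed
  have disj: "z \<notin> ball \<zeta>2 \<delta> \<union> ball \<zeta>4 \<delta>" if "z \<in> ball \<zeta>1 \<delta> \<union> ball \<zeta>3 \<delta>" for z
  proof -
    have "z \<in> ball \<zeta>1 \<delta> \<Longrightarrow> \<bar>X z - X \<zeta>1\<bar> < \<epsilon>" "z \<in> ball \<zeta>2 \<delta> \<Longrightarrow> \<bar>X z - X \<zeta>2\<bar> < \<epsilon>"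
      "z \<in> ball \<zeta>3 \<delta> \<Longrightarrow> \<bar>X z - X \<zeta>3\<bar> < \<epsilon>" "z \<in> ball \<zeta>4 \<delta> \<Longrightarrow> \<bar>X z - X \<zeta>4\<bar> < \<epsilon>"
      using ballX by blast+
    then show ?thesis
      using that gap unfolding Un_iff by linarith
  qed
  have "\<delta> / 2 > 0" using \<open>\<delta> > 0\<close> by simp
  obtain V1 where V1: "open V1" "connected V1" "V1 \<noteq> {}"
      "V1 \<subseteq> {z \<in> ball 0 1 \<inter> ball \<zeta>1 (\<delta> / 2). Re (F z) > c}" "\<And>\<eta>. \<eta> > 0 \<Longrightarrow> \<exists>y\<in>V1. norm y > 1 - \<eta>"
    using level_connected_reach[OF lc n(1) hi(1) c(1) \<open>\<delta> / 2 > 0\<close>] by blast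
  obtain V3 where V3: "open V3" "connected V3" "V3 \<noteq> {}"
      "V3 \<subseteq> {z \<in> ball 0 1 \<inter> ball \<zeta>3 (\<delta> / 2). Re (F z) > c}" "\<And>\<eta>. \<eta> > 0 \<Longrightarrow> \<exists>y\<in>V3. norm y > 1 - \<eta>"
    using level_connected_reach[OF lc n(3) hi(2) c(1) \<open>\<delta> / 2 > 0\<close>] by blast
  have lo': "\<zeta>2 \<in> closure (above (\<lambda>z. - F z) (- c''))" "\<zeta>4 \<in> closure (above (\<lambda>z. - F z) (- c''))"
    using lo by simp_all
  obtain V2 where V2: "open V2" "connected V2" "V2 \<noteq> {}"
      "V2 \<subseteq> {z \<in> ball 0 1 \<inter> ball \<zeta>2 (\<delta> / 2). Re (- F z) > - c}" "\<And>\<eta>. \<eta> > 0 \<Longrightarrow> \<exists>y\<in>V2. norm y > 1 - \<eta>"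
    using level_connected_reach[OF level_connected_uminus[OF lc] n(2) lo'(1) c(2) \<open>\<delta> / 2 > 0\<close>] by blast
  obtain V4 where V4: "open V4" "connected V4" "V4 \<noteq> {}"
      "V4 \<subseteq> {z \<in> ball 0 1 \<inter> ball \<zeta>4 (\<delta> / 2). Re (- F z) > - c}" "\<And>\<eta>. \<eta> > 0 \<Longrightarrow> \<exists>y\<in>V4. norm y > 1 - \<eta>"
    using level_connected_reach[OF level_connected_uminus[OF lc] n(4) lo'(2) c(2) \<open>\<delta> / 2 > 0\<close>] by blast
  define U W where "U = above F c" and "W = below F c"
  have contF: "continuous_on (ball 0 1) (\<lambda>z. Re (F z))"
    using hol by (intro continuous_intros holomorphic_on_imp_continuous_on)
  have "U = ball 0 1 \<inter> (\<lambda>z. Re (F z)) -` {c<..}" "W = ball 0 1 \<inter> (\<lambda>z. Re (F z)) -` {..<c}"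
    by (auto simp: U_def W_def)
  then have "open U" "open W"
    using continuous_open_preimage[OF contF] by simp_all
  then have pcU: "path_connected U" and pcW: "path_connected W"
    using lc by (auto simp: connected_open_path_connected level_connected_def U_def W_def)
  have VU: "V1 \<subseteq> U" "V3 \<subseteq> U" and VW: "V2 \<subseteq> W" "V4 \<subseteq> W"
    using V1(4) V3(4) V2(4) V4(4) by (auto simp: U_def W_def)
  obtain z2 z4 where z24: "z2 \<in> V2" "z4 \<in> V4" using V2(3) V4(3) by blast
  then obtain P24 where P24: "path P24" "path_image P24 \<subseteq> W" "pathstart P24 = z2" "pathfinish P24 = z4"
    using pcW VW unfolding path_connected_def by (meson subsetD)
  obtain \<eta>1 where \<eta>1: "\<eta>1 > 0" "\<And>z. z \<in> path_image P24 \<Longrightarrow> norm z < 1 - \<eta>1"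
    by (rule compact_subset_disc[OF compact_path_image[OF P24(1)]]) (use P24(2) in \<open>auto simp: W_def\<close>)
  obtain y1 y3 where y13: "y1 \<in> V1" "norm y1 > 1 - min \<eta>1 (\<delta> / 2)" "y3 \<in> V3" "norm y3 > 1 - min \<eta>1 (\<delta> / 2)"
    using V1(5) V3(5) \<open>\<eta>1 > 0\<close> \<open>\<delta> > 0\<close> by (metis half_gt_zero min_less_iff_conj)
  then obtain P13 where P13: "path P13" "path_image P13 \<subseteq> U" "pathstart P13 = y1" "pathfinish P13 = y3"
    using pcU VU unfolding path_connected_def by (meson subsetD)
  obtain \<eta>2 where \<eta>2: "\<eta>2 > 0" "\<And>z. z \<in> path_image P13 \<Longrightarrow> norm z < 1 - \<eta>2"
    by (rule compact_subset_disc[OF compact_path_image[OF P13(1)]]) (use P13(2) in \<open>auto simp: U_def\<close>)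
  obtain y2 y4 where y24: "y2 \<in> V2" "norm y2 > 1 - min \<eta>2 (\<delta> / 2)" "y4 \<in> V4" "norm y4 > 1 - min \<eta>2 (\<delta> / 2)"
    using V2(5) V4(5) \<open>\<eta>2 > 0\<close> \<open>\<delta> > 0\<close> by (metis half_gt_zero min_less_iff_conj)
  have "path_connected V2" "path_connected V4"
    using V2 V4 by (simp_all add: connected_open_path_connected)
  then obtain Q2 Q4 where Q2: "path Q2" "path_image Q2 \<subseteq> V2" "pathstart Q2 = y2" "pathfinish Q2 = z2"
      and Q4: "path Q4" "path_image Q4 \<subseteq> V4" "pathstart Q4 = z4" "pathfinish Q4 = y4"
    using y24 z24 unfolding path_connected_def by meson
  have y0: "y1 \<noteq> 0" "y2 \<noteq> 0" "y3 \<noteq> 0" "y4 \<noteq> 0"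
    using y13 y24 \<open>\<delta> \<le> 1\<close> by auto
  define p where "p = linepath (sgn y1) y1 +++ P13 +++ linepath y3 (sgn y3)"
  define q where "q = linepath (sgn y2) y2 +++ Q2 +++ P24 +++ Q4 +++ linepath y4 (sgn y4)"
  have "path p" "path q"
    using P13 P24 Q2 Q4 by (simp_all add: p_def q_def)
  have imp: "path_image p = closed_segment (sgn y1) y1 \<union> path_image P13 \<union> closed_segment (sgn y3) y3"
    using P13 by (auto simp: p_def path_image_join closed_segment_commute)
  have imq: "path_image q = closed_segment (sgn y2) y2 \<union> path_image Q2 \<union> path_image P24 \<union> path_image Q4
      \<union> closed_segment (sgn y4) y4"
    using P24 Q2 Q4 by (auto simp: q_def path_image_join closed_segment_commute)
  have yD: "y1 \<in> ball 0 1 \<inter> ball \<zeta>1 (\<delta>/2)" "y2 \<in> ball 0 1 \<inter> ball \<zeta>2 (\<delta>/2)"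
     "y3 \<in> ball 0 1 \<inter> ball \<zeta>3 (\<delta>/2)" "y4 \<in> ball 0 1 \<inter> ball \<zeta>4 (\<delta>/2)"
    using y13 y24 V1(4) V2(4) V3(4) V4(4) by auto
  have seg: "norm y \<le> norm w \<and> norm w \<le> 1 \<and> w \<in> ball \<zeta> \<delta>"
    if "w \<in> closed_segment (sgn y) y" "y \<in> ball 0 1 \<inter> ball \<zeta> (\<delta>/2)" "y \<noteq> 0" "1 - min \<eta> (\<delta> / 2) < norm y" for w y \<zeta> :: complex and \<eta>
    using radial_segment[of y w \<zeta> \<delta>] that by (simp add: dist_norm)
  note seg1 = seg[OF _ yD(1) y0(1) y13(2)] and seg2 = seg[OF _ yD(2) y0(2) y24(2)]
    and seg3 = seg[OF _ yD(3) y0(3) y13(4)] and seg4 = seg[OF _ yD(4) y0(4) y24(4)]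
  have yn: "norm y1 > 1 - \<eta>1" "norm y3 > 1 - \<eta>1" "norm y2 > 1 - \<eta>2" "norm y4 > 1 - \<eta>2"
    using y13 y24 by auto
  have UD: "U \<subseteq> cball 0 1 - {- 1}" "W \<subseteq> cball 0 1 - {- 1}"
    by (auto simp: U_def W_def)
  obtain z where zp: "z \<in> path_image p" and zq: "z \<in> path_image q"
  proof (rule disc_paths_cross[OF \<open>path p\<close> \<open>path q\<close>])
    show "path_image p \<subseteq> cball 0 1 - {- 1}"
    proof -
      have "closed_segment (sgn y1) y1 \<subseteq> cball 0 1 - {- 1}" "closed_segment (sgn y3) y3 \<subseteq> cball 0 1 - {- 1}"
        using seg1 seg3 ballX by auto
      then show ?thesis using P13(2) UD unfolding imp by blast
    qed
    show "path_image q \<subseteq> cball 0 1 - {- 1}"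
    proof -
      have "closed_segment (sgn y2) y2 \<subseteq> cball 0 1 - {- 1}" "closed_segment (sgn y4) y4 \<subseteq> cball 0 1 - {- 1}"
        using seg2 seg4 ballX by auto
      then show ?thesis using P24(2) Q2(2) Q4(2) VW UD unfolding imq by blast
    qed
    show "norm (pathstart p) = 1" "norm (pathfinish p) = 1" "norm (pathstart q) = 1" "norm (pathfinish q) = 1"
      using y0 by (simp_all add: p_def q_def norm_sgn)
    have "sgn y1 \<in> ball \<zeta>1 \<delta>" "sgn y2 \<in> ball \<zeta>2 \<delta>" "sgn y3 \<in> ball \<zeta>3 \<delta>" "sgn y4 \<in> ball \<zeta>4 \<delta>"
      using seg1 seg2 seg3 seg4 ends_in_segment(1) by blast+
    then have "\<bar>X (sgn y1) - X \<zeta>1\<bar> < \<epsilon>" "\<bar>X (sgn y2) - X \<zeta>2\<bar> < \<epsilon>" "\<bar>X (sgn y3) - X \<zeta>3\<bar> < \<epsilon>" "\<bar>X (sgn y4) - X \<zeta>4\<bar> < \<epsilon>"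
      using ballX by blast+
    then show "Re (cayley (pathstart p)) < Re (cayley (pathstart q))"
      "Re (cayley (pathstart q)) < Re (cayley (pathfinish p))"
      "Re (cayley (pathfinish p)) < Re (cayley (pathfinish q))"
      using gap by (auto simp: p_def q_def X_def abs_less_iff)
  qed
  \<comment> \<open>A piece of \<open>p\<close> and a piece of \<open>q\<close> are kept apart in
    one of three ways: by disjoint neighbourhoods, by the distance from the circle, or by the sign
    of \<open>Re F - c\<close>.\<close>
  have "(z \<in> ball \<zeta>1 \<delta> \<union> ball \<zeta>3 \<delta> \<and> norm z > 1 - \<eta>1) \<or> (Re (F z) > c \<and> norm z < 1 - \<eta>2)"
  proof -
    have "z \<in> ball \<zeta>1 \<delta> \<and> norm z > 1 - \<eta>1" if "z \<in> closed_segment (sgn y1) y1"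
      using seg1[OF that] yn(1) by linarith
    moreover have "z \<in> ball \<zeta>3 \<delta> \<and> norm z > 1 - \<eta>1" if "z \<in> closed_segment (sgn y3) y3"
      using seg3[OF that] yn(2) by linarith
    moreover have "Re (F z) > c \<and> norm z < 1 - \<eta>2" if "z \<in> path_image P13"
      using that P13(2) \<eta>2(2) by (auto simp: U_def)
    ultimately show ?thesis using zp unfolding imp by blast
  qed
  moreover have "(z \<in> ball \<zeta>2 \<delta> \<union> ball \<zeta>4 \<delta> \<and> (norm z > 1 - \<eta>2 \<or> Re (F z) < c)) \<or> (Re (F z) < c \<and> norm z < 1 - \<eta>1)"
  proof -
    have "z \<in> ball \<zeta>2 \<delta> \<and> norm z > 1 - \<eta>2" if "z \<in> closed_segment (sgn y2) y2"
      using seg2[OF that] yn(3) by linarith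
    moreover have "z \<in> ball \<zeta>4 \<delta> \<and> norm z > 1 - \<eta>2" if "z \<in> closed_segment (sgn y4) y4"
      using seg4[OF that] yn(4) by linarith
    moreover have "z \<in> ball \<zeta>2 \<delta> \<union> ball \<zeta>4 \<delta> \<and> Re (F z) < c" if "z \<in> path_image Q2 \<union> path_image Q4"
      using that Q2(2) Q4(2) V2(4) V4(4) \<open>\<delta> > 0\<close> by fastforce
    moreover have "Re (F z) < c \<and> norm z < 1 - \<eta>1" if "z \<in> path_image P24"
      using that P24(2) \<eta>1(2) by (auto simp: W_def)
    ultimately show ?thesis using zq unfolding imq by blast
  qed
  ultimately show False using disj by (metis less_irrefl less_trans)
qed

section \<open>Boundary values\<close>

lemma cis_neq_minus_one: "- pi < t \<Longrightarrow> t < pi \<Longrightarrow> cis t \<noteq> - 1"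
proof
  assume t: "- pi < t" "t < pi" and "cis t = - 1"
  then have "Arg (cis t) = pi" by (simp add: Arg_eq_pi)
  then show False using t by (simp add: Arg_cis)
qed

lemma cayley_cis:
  assumes "- pi < t" "t < pi"
  shows "cayley (cis t) = of_real (tan (t / 2))"
proof -
  have c0: "cos (t / 2) > 0" using assms by (intro cos_gt_zero_pi) auto
  have ct: "cos t = 2 * (cos (t/2))\<^sup>2 - 1" "sin t = 2 * sin (t/2) * cos (t/2)"
    using cos_double_cos[of "t/2"] sin_double[of "t/2"] by simp_all
  have s2: "(sin (t/2))\<^sup>2 = 1 - (cos (t/2))\<^sup>2"
    by (rule sin_squared_eq)
  have ne: "1 + cis t \<noteq> 0"
    using cis_neq_minus_one[OF assms] by (simp add: add_eq_0_iff)
  have "\<i> * (1 - cis t) * of_real (cos (t/2)) = of_real (sin (t/2)) * (1 + cis t)"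
  proof (rule complex_eqI)
    show "Re (\<i> * (1 - cis t) * of_real (cos (t/2))) = Re (of_real (sin (t/2)) * (1 + cis t))"
      by (simp add: ct power2_eq_square)
    have "(2 - 2 * (cos (t/2))\<^sup>2) * cos (t/2) = 2 * (sin (t/2))\<^sup>2 * cos (t/2)"
      by (simp add: s2 algebra_simps)
    then show "Im (\<i> * (1 - cis t) * of_real (cos (t/2))) = Im (of_real (sin (t/2)) * (1 + cis t))"
      by (simp add: ct power2_eq_square algebra_simps)
  qed
  then show ?thesis
    using c0 ne by (simp add: cayley_def tan_def field_simps)
qed

lemma closure_rotate:
  assumes "z \<in> closure {w \<in> ball 0 1. P w}" "norm e = 1"
  shows "cnj e * z \<in> closure {w \<in> ball 0 1. P (e * w)}"
  unfolding closure_approachable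
proof (intro allI impI)
  fix r :: real assume "r > 0"
  then obtain y where y: "norm y < 1" "P y" "dist y z < r"
    using assms(1) by (auto simp: closure_approachable)
  have "e * cnj e = 1" using assms(2) complex_norm_square[of e] by simp
  then have "e * (cnj e * y) = y" by (simp add: mult.assoc[symmetric])
  then have "P (e * (cnj e * y))" using y(2) by (simp only:)
  moreover have "dist (cnj e * y) (cnj e * z) < r"
    using y(3) assms(2) by (simp add: dist_norm norm_mult right_diff_distrib[symmetric])
  ultimately show "\<exists>y\<in>{w \<in> ball 0 1. P (e * w)}. dist y (cnj e * z) < r"
    using y assms(2) by (intro bexI[of _ "cnj e * y"]) (simp_all add: norm_mult)
qed

lemma level_connected_interlace_cis:
  assumes lc: "level_connected F"
    and lt: "\<theta>1 < \<theta>2" "\<theta>2 < \<theta>3" "\<theta>3 < \<theta>4" "\<theta>4 < \<theta>1 + 2 * pi" and "c'' < c'"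
    and hi: "cis \<theta>1 \<in> closure (above F c')" "cis \<theta>3 \<in> closure (above F c')"
    and lo: "cis \<theta>2 \<in> closure (below F c'')" "cis \<theta>4 \<in> closure (below F c'')"
  shows False
proof -
  \<comment> \<open>Rotating by the midpoint of the outer angles brings all four into the open
    interval from \<open>- pi\<close> to \<open>pi\<close>, away from the exceptional point -1,
    because \<open>\<theta>4 - \<theta>1 < 2 * pi\<close>.\<close>
  define \<mu> where "\<mu> = (\<theta>1 + \<theta>4) / 2"
  have rng: "- pi < \<theta> - \<mu> \<and> \<theta> - \<mu> < pi" if "\<theta>1 \<le> \<theta>" "\<theta> \<le> \<theta>4" for \<theta>
  proof -
    have "2 * \<mu> = \<theta>1 + \<theta>4" by (simp add: \<mu>_def)
    then show ?thesis using that lt by linarith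
  qed
  have ci: "cayley (cis (\<theta> - \<mu>)) = of_real (tan ((\<theta> - \<mu>) / 2))" "cis (\<theta> - \<mu>) \<noteq> - 1"
    if "\<theta>1 \<le> \<theta>" "\<theta> \<le> \<theta>4" for \<theta>
    using rng[OF that] cayley_cis cis_neq_minus_one by blast+
  have tan: "tan ((\<theta> - \<mu>) / 2) < tan ((\<theta>' - \<mu>) / 2)" if "\<theta>1 \<le> \<theta>" "\<theta> < \<theta>'" "\<theta>' \<le> \<theta>4" for \<theta> \<theta>'
    using that rng[of \<theta>] rng[of \<theta>'] by (intro tan_monotone) auto
  have rot: "cis (\<theta> - \<mu>) = cnj (cis \<mu>) * cis \<theta>" for \<theta>
    by (simp add: cis_cnj cis_mult)
  show False
  proof (rule level_connected_interlace[OF level_connected_rotate[OF lc norm_cis[of \<mu>]],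
        of "cis (\<theta>1 - \<mu>)" "cis (\<theta>2 - \<mu>)" "cis (\<theta>3 - \<mu>)" "cis (\<theta>4 - \<mu>)" c' c''])
    show "cis (\<theta>1 - \<mu>) \<in> closure {z \<in> ball 0 1. c' < Re (F (cis \<mu> * z))}"
      "cis (\<theta>3 - \<mu>) \<in> closure {z \<in> ball 0 1. c' < Re (F (cis \<mu> * z))}"
      "cis (\<theta>2 - \<mu>) \<in> closure {z \<in> ball 0 1. Re (F (cis \<mu> * z)) < c''}"
      "cis (\<theta>4 - \<mu>) \<in> closure {z \<in> ball 0 1. Re (F (cis \<mu> * z)) < c''}"
      unfolding rot using hi lo by (intro closure_rotate; simp)+
  qed (use lt ci tan \<open>c'' < c'\<close> in auto)
qed

text \<open>\<open>L\<close> is the upper limit of the boundary cluster values of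
  \<open>Re F\<close> along the arc on the side \<open>s\<close>. If values below
  \<open>L - \<epsilon>\<close> recurred arbitrarily close to \<theta>, they would alternate with
  values above \<open>L - \<epsilon> / 2\<close>, and four successive points would contradict the
  interlacing lemma.\<close>

lemma level_connected_side_limit:
  assumes lc: "level_connected F" and s: "s = 1 \<or> s = (-1 :: real)"
  obtains L where "\<And>\<epsilon>. \<epsilon> > 0 \<Longrightarrow> \<exists>d>0. \<forall>x\<in>{0<..<d}. cis (\<theta> + s * x) \<notin> closure (above F (L + \<epsilon>))
      \<and> cis (\<theta> + s * x) \<notin> closure (below F (L - \<epsilon>))"
proof -
  define H where "H = (\<lambda>c x. cis (\<theta> + s * x) \<in> closure (above F c))"
  define K where "K = (\<lambda>c x. cis (\<theta> + s * x) \<in> closure (below F c))"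
  obtain B where B: "\<And>z. z \<in> ball 0 1 \<Longrightarrow> \<bar>Re (F z)\<bar> \<le> B"
    using lc unfolding level_connected_def by blast
  define S where "S = {c. \<exists>d>0. \<forall>x\<in>{0<..<d}. \<not> H c x}"
  define L where "L = Inf S"
  have "above F B = {}" using B by force
  then have "\<not> H B x" for x
    unfolding H_def by (simp only: closure_empty empty_iff not_False_eq_True)
  then have "B \<in> S" unfolding S_def by (auto intro!: exI[of _ 1])
  have "- B - 1 \<le> c" if "c \<in> S" for c
  proof (rule ccontr)
    assume "\<not> - B - 1 \<le> c"
    then have "above F c = ball 0 1" using B by fastforce
    then have "H c x" for x unfolding H_def by simp
    moreover obtain d where "d > 0" "\<forall>x\<in>{0<..<d}. \<not> H c x" using \<open>c \<in> S\<close> by (auto simp: S_def)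
    moreover from this have "d / 2 \<in> {0<..<d}" by simp
    ultimately show False by blast
  qed
  then have bdd: "bdd_below S" by (meson bdd_belowI)
  have upper: "\<exists>d>0. \<forall>x\<in>{0<..<d}. \<not> H (L + \<epsilon>) x" if "\<epsilon> > 0" for \<epsilon>
  proof -
    have "\<exists>c\<in>S. c < L + \<epsilon>"
      using cInf_lessD[of S "L + \<epsilon>"] \<open>B \<in> S\<close> that by (auto simp: L_def)
    then obtain c where "c \<in> S" "c < L + \<epsilon>" by blast
    then obtain d where d: "d > 0" "\<forall>x\<in>{0<..<d}. \<not> H c x" by (auto simp: S_def)
    have "H c x" if "H (L + \<epsilon>) x" for x
    proof -
      have "above F (L + \<epsilon>) \<subseteq> above F c"
        using \<open>c < L + \<epsilon>\<close> by auto
      from closure_mono[OF this] show ?thesis using that unfolding H_def by blast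
    qed
    then show ?thesis using d by blast
  qed
  have lower: "\<exists>d>0. \<forall>x\<in>{0<..<d}. \<not> K (L - \<epsilon>) x" if "\<epsilon> > 0" for \<epsilon>
  proof (rule ccontr)
    assume "\<not> ?thesis"
    then have k: "\<exists>x\<in>{0<..<d}. K (L - \<epsilon>) x" if "d > 0" for d using that by auto
    have "L - \<epsilon> / 2 \<notin> S"
      using cInf_lower[OF _ bdd, of "L - \<epsilon>/2"] that unfolding L_def by auto
    then have h: "\<exists>x\<in>{0<..<d}. H (L - \<epsilon>/2) x" if "d > 0" for d using that by (auto simp: S_def)
    have lt: "L - \<epsilon> < L - \<epsilon>/2" using that by simp
    from s show False
    proof
      assume "s = 1"
      obtain x4 where x4: "0 < x4" "x4 < 1" "K (L - \<epsilon>) x4" using k[of 1] by auto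
      obtain x3 where x3: "0 < x3" "x3 < x4" "H (L - \<epsilon>/2) x3" using h[OF x4(1)] by auto
      obtain x2 where x2: "0 < x2" "x2 < x3" "K (L - \<epsilon>) x2" using k[OF x3(1)] by auto
      obtain x1 where x1: "0 < x1" "x1 < x2" "H (L - \<epsilon>/2) x1" using h[OF x2(1)] by auto
      show False
        by (rule level_connected_interlace_cis[OF lc _ _ _ _ lt,
              of "\<theta> + s * x1" "\<theta> + s * x2" "\<theta> + s * x3" "\<theta> + s * x4"])
           (use x1 x2 x3 x4 \<open>s = 1\<close> pi_gt3 in \<open>auto simp: H_def K_def\<close>)
    next
      \<comment> \<open>The points are again picked ever closer to \<theta>, but now the angle
        decreases with \<open>x\<close>, so the choice starts with the smallest angle.\<close>
      assume "s = - 1"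
      obtain x1 where x1: "0 < x1" "x1 < 1" "H (L - \<epsilon>/2) x1" using h[of 1] by auto
      obtain x2 where x2: "0 < x2" "x2 < x1" "K (L - \<epsilon>) x2" using k[OF x1(1)] by auto
      obtain x3 where x3: "0 < x3" "x3 < x2" "H (L - \<epsilon>/2) x3" using h[OF x2(1)] by auto
      obtain x4 where x4: "0 < x4" "x4 < x3" "K (L - \<epsilon>) x4" using k[OF x3(1)] by auto
      show False
        by (rule level_connected_interlace_cis[OF lc _ _ _ _ lt,
              of "\<theta> + s * x1" "\<theta> + s * x2" "\<theta> + s * x3" "\<theta> + s * x4"])
           (use x1 x2 x3 x4 \<open>s = - 1\<close> pi_gt3 in \<open>auto simp: H_def K_def\<close>)
    qed
  qed
  show ?thesis
  proof (rule that[of L])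
    fix \<epsilon> :: real assume "\<epsilon> > 0"
    obtain d1 where d1: "d1 > 0" "\<forall>x\<in>{0<..<d1}. \<not> H (L + \<epsilon>) x" using upper[OF \<open>\<epsilon> > 0\<close>] by blast
    obtain d2 where d2: "d2 > 0" "\<forall>x\<in>{0<..<d2}. \<not> K (L - \<epsilon>) x" using lower[OF \<open>\<epsilon> > 0\<close>] by blast
    show "\<exists>d>0. \<forall>x\<in>{0<..<d}. cis (\<theta> + s * x) \<notin> closure (above F (L + \<epsilon>))
      \<and> cis (\<theta> + s * x) \<notin> closure (below F (L - \<epsilon>))"
      using d1 d2 by (intro exI[of _ "min d1 d2"]) (auto simp: H_def K_def)
  qed
qed

abbreviation near :: "(complex \<Rightarrow> complex) \<Rightarrow> complex \<Rightarrow> real \<Rightarrow> complex \<Rightarrow> bool" where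
  "near k w e \<zeta> \<equiv> (\<exists>\<rho>>0. \<forall>z\<in>ball 0 1 \<inter> ball \<zeta> \<rho>. dist (k z) w < e)"

text \<open>The condition concerns disc neighbourhoods of the boundary points beside
  \<open>cis \<theta>\<close>. It does not control the approach to \<open>cis \<theta>\<close>
  itself from inside the disc, which is settled only when both sides are combined.\<close>

definition side_limit :: "(complex \<Rightarrow> complex) \<Rightarrow> real \<Rightarrow> real \<Rightarrow> complex \<Rightarrow> bool" where
  "side_limit k \<theta> s w \<longleftrightarrow> (\<forall>\<epsilon>>0. \<exists>d>0. \<forall>x\<in>{0<..<d}. near k w \<epsilon> (cis (\<theta> + s * x)))"

lemma side_limit_exists:
  assumes "level_connected F1" "level_connected F2" "s = 1 \<or> s = -1"
    and re: "\<And>z. z \<in> ball 0 1 \<Longrightarrow> Re (F1 z) = Re (k z)" and im: "\<And>z. z \<in> ball 0 1 \<Longrightarrow> Re (F2 z) = Im (k z)"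
  obtains w where "side_limit k \<theta> s w"
proof -
  obtain L1 where L1: "\<And>\<epsilon>. \<epsilon> > 0 \<Longrightarrow> \<exists>d>0. \<forall>x\<in>{0<..<d}. cis (\<theta> + s * x) \<notin> closure (above F1 (L1 + \<epsilon>))
      \<and> cis (\<theta> + s * x) \<notin> closure (below F1 (L1 - \<epsilon>))"
    using level_connected_side_limit[OF assms(1,3)] by blast
  obtain L2 where L2: "\<And>\<epsilon>. \<epsilon> > 0 \<Longrightarrow> \<exists>d>0. \<forall>x\<in>{0<..<d}. cis (\<theta> + s * x) \<notin> closure (above F2 (L2 + \<epsilon>))
      \<and> cis (\<theta> + s * x) \<notin> closure (below F2 (L2 - \<epsilon>))"
    using level_connected_side_limit[OF assms(2,3)] by blast
  have "side_limit k \<theta> s (Complex L1 L2)"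
    unfolding side_limit_def
  proof (intro allI impI)
    fix \<epsilon> :: real assume "\<epsilon> > 0"
    then have e3: "\<epsilon> / 3 > 0" by simp
    obtain d1 where d1: "d1 > 0" "\<And>x. x \<in> {0<..<d1} \<Longrightarrow> cis (\<theta> + s * x) \<notin> closure (above F1 (L1 + \<epsilon> / 3))
      \<and> cis (\<theta> + s * x) \<notin> closure (below F1 (L1 - \<epsilon> / 3))" using L1[OF e3] by blast
    obtain d2 where d2: "d2 > 0" "\<And>x. x \<in> {0<..<d2} \<Longrightarrow> cis (\<theta> + s * x) \<notin> closure (above F2 (L2 + \<epsilon> / 3))
      \<and> cis (\<theta> + s * x) \<notin> closure (below F2 (L2 - \<epsilon> / 3))" using L2[OF e3] by blast
    have "near k (Complex L1 L2) \<epsilon> (cis (\<theta> + s * x))"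
      if "x \<in> {0<..<min d1 d2}" for x
    proof -
      define A where "A = closure (above F1 (L1 + \<epsilon> / 3)) \<union> closure (below F1 (L1 - \<epsilon> / 3))
         \<union> closure (above F2 (L2 + \<epsilon> / 3)) \<union> closure (below F2 (L2 - \<epsilon> / 3))"
      have "open (- A)" unfolding A_def by (intro open_Compl closed_Un closed_closure)
      moreover have "cis (\<theta> + s * x) \<in> - A"
        using d1(2)[of x] d2(2)[of x] that by (simp add: A_def)
      ultimately obtain \<rho> where "\<rho> > 0" and \<rho>: "ball (cis (\<theta> + s * x)) \<rho> \<subseteq> - A"
        by (meson open_contains_ball)
      have "dist (k z) (Complex L1 L2) < \<epsilon>" if z: "z \<in> ball 0 1" "z \<in> ball (cis (\<theta> + s * x)) \<rho>" for z
      proof -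
        have "z \<notin> A" using \<rho> z by blast
        have cs: "z \<notin> S" if "closure S \<subseteq> A" for S
          using \<open>z \<notin> A\<close> closure_subset[of S] that by blast
        have "z \<notin> above F1 (L1 + \<epsilon> / 3)" "z \<notin> below F1 (L1 - \<epsilon> / 3)"
          "z \<notin> above F2 (L2 + \<epsilon> / 3)" "z \<notin> below F2 (L2 - \<epsilon> / 3)"
          by (rule cs; unfold A_def; blast)+
        then have "\<bar>Re (k z) - L1\<bar> \<le> \<epsilon> / 3" "\<bar>Im (k z) - L2\<bar> \<le> \<epsilon> / 3"
          using z(1) re[OF z(1)] im[OF z(1)] unfolding abs_le_iff mem_Collect_eq by linarith+
        then show ?thesis
          using cmod_le[of "k z - Complex L1 L2"] \<open>\<epsilon> > 0\<close> by (simp add: dist_norm)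
      qed
      then show ?thesis using \<open>\<rho> > 0\<close> by blast
    qed
    then show "\<exists>d>0. \<forall>x\<in>{0<..<d}. near k (Complex L1 L2) \<epsilon> (cis (\<theta> + s * x))"
      using d1(1) d2(1) by (intro exI[of _ "min d1 d2"]) auto
  qed
  then show ?thesis using that by blast
qed

lemma side_limit_point:
  assumes "side_limit k \<theta> s w" "s = 1 \<or> s = -1" "\<epsilon> > 0" "\<rho> > 0"
  obtains z where "z \<in> ball 0 1" "dist (cis \<theta>) z < \<rho>" "dist (k z) w < \<epsilon>"
proof -
  obtain d where d: "d > 0" "\<And>x. x \<in> {0<..<d} \<Longrightarrow> near k w \<epsilon> (cis (\<theta> + s * x))"
    using assms(1)[unfolded side_limit_def, rule_format, OF assms(3)] by blast
  have "continuous_on UNIV (\<lambda>x. cis (\<theta> + s * x))" by (intro continuous_intros)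
  then have "isCont (\<lambda>x. cis (\<theta> + s * x)) 0" by (simp add: continuous_on_eq_continuous_at)
  then obtain e where e: "e > 0" "\<And>x. dist x 0 < e \<Longrightarrow> dist (cis (\<theta> + s * x)) (cis \<theta>) < \<rho> / 2"
    unfolding continuous_at_eps_delta using half_gt_zero[OF \<open>\<rho> > 0\<close>]
    by (metis (no_types, lifting) add.right_neutral diff_zero dist_norm mult_zero_right)
  define x where "x = min d e / 2"
  have "x \<in> {0<..<d}" "dist x 0 < e" using d(1) e(1) by (auto simp: x_def)
  then obtain r where r: "r > 0" "\<forall>z\<in>ball 0 1 \<inter> ball (cis (\<theta> + s * x)) r. dist (k z) w < \<epsilon>"
    using d(2) by blast
  have "cis (\<theta> + s * x) \<in> closure (ball 0 1)" by simp
  then obtain z where z: "z \<in> ball 0 1" "dist z (cis (\<theta> + s * x)) < min r (\<rho> / 2)"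
    using r(1) \<open>\<rho> > 0\<close> unfolding closure_approachable by (metis half_gt_zero min_less_iff_conj)
  have "dist (cis \<theta>) z < \<rho>"
    using e(2)[OF \<open>dist x 0 < e\<close>] z(2) dist_triangle_half_l[of "cis \<theta>" "cis (\<theta> + s * x)" \<rho> z]
    by (simp add: dist_commute)
  then show ?thesis using that z r(2) by (auto simp: dist_commute)
qed

section \<open>Two-sided limits and extension to the closed disc\<close>

lemma cis_Arg_unit: "norm w = 1 \<Longrightarrow> cis (Arg w) = w"
  using cis_Arg[of w] by (cases "w = 0") (auto simp: sgn_eq)

lemma cis_near:
  assumes "d > 0"
  obtains \<delta> where "\<delta> > 0" "\<And>w. norm w = 1 \<Longrightarrow> dist w (cis \<theta>) < \<delta> \<Longrightarrow> \<exists>x. \<bar>x\<bar> < d \<and> w = cis (\<theta> + x)"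
proof -
  have "isCont Arg 1" by (intro continuous_at_Arg) auto
  then obtain \<delta> where \<delta>: "\<delta> > 0" "\<And>u. dist u 1 < \<delta> \<Longrightarrow> dist (Arg u) (Arg 1) < d"
    using \<open>d > 0\<close> unfolding continuous_at_eps_delta by (metis dist_norm)
  have "\<exists>x. \<bar>x\<bar> < d \<and> w = cis (\<theta> + x)" if w: "norm w = 1" "dist w (cis \<theta>) < \<delta>" for w
  proof (intro exI conjI)
    define u where "u = cis (- \<theta>) * w"
    have "u - 1 = cis (- \<theta>) * (w - cis \<theta>)" by (simp add: u_def right_diff_distrib cis_mult)
    then have "dist u 1 < \<delta>" using w(2) by (simp add: dist_norm norm_mult)
    then show "\<bar>Arg u\<bar> < d" using \<delta>(2)[of u] by (simp add: dist_real_def)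
    have "norm u = 1" using w(1) by (simp add: u_def norm_mult)
    then have "cis (Arg u) = u" by (rule cis_Arg_unit)
    then have "cis (\<theta> + Arg u) = cis \<theta> * u" by (simp add: cis_mult[symmetric])
    also have "\<dots> = w" by (simp add: u_def mult.assoc[symmetric] cis_mult)
    finally show "w = cis (\<theta> + Arg u)" by simp
  qed
  then show ?thesis using that \<delta>(1) by blast
qed

text \<open>
  The exceptional point is removed by the factor \<open>1 - cnj \<zeta> z\<close>, whose influence disappears when
  \<open>n\<close>-th roots of the estimate for \<open>B ^ n\<close> are taken.
\<close>

lemma boundary_exception:
  fixes B :: "complex \<Rightarrow> complex"
  assumes hol: "B holomorphic_on ball 0 1" and bd: "\<And>z. z \<in> ball 0 1 \<Longrightarrow> norm (B z) \<le> M"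
    and "\<epsilon> > 0" "d > 0"
    and near: "\<And>x. x \<noteq> 0 \<Longrightarrow> \<bar>x\<bar> < d \<Longrightarrow> \<exists>\<rho>>0. \<forall>z\<in>ball 0 1 \<inter> ball (cis (\<theta> + x)) \<rho>. norm (B z) \<le> \<epsilon>"
  obtains \<rho> where "\<rho> > 0" "\<And>z. z \<in> ball 0 1 \<inter> ball (cis \<theta>) \<rho> \<Longrightarrow> norm (B z) \<le> 2 * \<epsilon>"
proof -
  define \<zeta> where "\<zeta> = cis \<theta>"
  have n\<zeta>: "norm \<zeta> = 1" by (simp add: \<zeta>_def)
  obtain \<delta>0 where \<delta>0: "\<delta>0 > 0" "\<And>w. norm w = 1 \<Longrightarrow> dist w \<zeta> < \<delta>0 \<Longrightarrow> \<exists>x. \<bar>x\<bar> < d \<and> w = cis (\<theta> + x)"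
    using cis_near[OF \<open>d > 0\<close>] unfolding \<zeta>_def by blast
  define \<delta> where "\<delta> = \<delta>0 / 2"
  have "\<delta> > 0" "\<delta> < \<delta>0" using \<delta>0(1) by (simp_all add: \<delta>_def)
  have "M \<ge> 0" using bd[of 0] norm_ge_zero[of "B 0"] by (simp del: norm_ge_zero)
  \<comment> \<open>Chosen so that \<open>M * exp (- C) \<le> \<epsilon>\<close>: the exponential of
    the barrier makes up for the missing smallness of \<open>B\<close> on the arc
    \<open>|z - \<zeta>| = \<delta>\<close> inside the disc.\<close>
  define C where "C = ln (1 + M / \<epsilon>)"
  have q0: "1 + M / \<epsilon> \<ge> 1" using \<open>M \<ge> 0\<close> \<open>\<epsilon> > 0\<close> by simp
  then have "C \<ge> 0" by (simp add: C_def)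
  have "M * exp (- C) \<le> \<epsilon>"
    using q0 \<open>M \<ge> 0\<close> \<open>\<epsilon> > 0\<close> unfolding C_def exp_minus by (subst exp_ln) (auto simp: field_simps)
  define a where "a = C * (2 / \<delta>\<^sup>2)"
  have "a \<ge> 0" using \<open>C \<ge> 0\<close> by (simp add: a_def)
  define E where "E = (\<lambda>z. exp (- of_real a * (1 - cnj \<zeta> * z)))"
  have Re_le: "0 \<le> Re (1 - cnj \<zeta> * z)" and nm_le: "norm (1 - cnj \<zeta> * z) \<le> 2" if "norm z \<le> 1" for z
    using complex_Re_le_cmod[of "cnj \<zeta> * z"] norm_triangle_ineq4[of 1 "cnj \<zeta> * z"] that n\<zeta>
    by (simp_all add: norm_mult)
  have nm_eq: "norm (1 - cnj \<zeta> * z) = norm (\<zeta> - z)" for z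
  proof -
    have "1 - cnj \<zeta> * z = cnj \<zeta> * (\<zeta> - z)"
      using n\<zeta> complex_norm_square[of \<zeta>] by (simp add: right_diff_distrib mult.commute)
    then show ?thesis using n\<zeta> by (simp add: norm_mult)
  qed
  have nE: "norm (E z) = exp (- a * Re (1 - cnj \<zeta> * z))" for z
    by (simp add: E_def)
  have E1: "norm (E z) \<le> 1" if "norm z \<le> 1" for z
    unfolding nE using mult_nonneg_nonneg[OF \<open>a \<ge> 0\<close> Re_le[OF that]] by (simp del: diff_ge_0_iff_ge)
  define S where "S = ball 0 1 \<inter> ball \<zeta> \<delta>"
  define G where "G = (\<lambda>n z. (B z * E z) ^ n * ((1 - cnj \<zeta> * z) / 2))"
  have contB: "continuous_on (ball 0 1) B" using hol holomorphic_on_imp_continuous_on by blast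
  have Gle: "norm (G n z) \<le> \<epsilon> ^ n" if "z \<in> S" for n z
  proof (rule maximum_modulus_limsup[of S "G n"])
    show "open S" "bounded S" "z \<in> S"
      using that bounded_subset[OF bounded_ball[of 0 1], of S] by (auto simp: S_def)
    have "B holomorphic_on S" using hol by (rule holomorphic_on_subset) (auto simp: S_def)
    then show "G n holomorphic_on S"
      unfolding G_def E_def by (intro holomorphic_intros) auto
    fix x e assume x: "x \<in> frontier S" and "(e::real) > 0"
    have "x \<in> closure S" "x \<notin> S" using x \<open>open S\<close> by (auto simp: frontier_def interior_open)
    moreover have "closure S \<subseteq> cball 0 1 \<inter> cball \<zeta> \<delta>"
      by (rule closure_minimal) (auto simp: S_def)
    ultimately have x1: "norm x \<le> 1" "dist \<zeta> x \<le> \<delta>" and x2: "norm x = 1 \<or> dist \<zeta> x = \<delta>"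
      by (auto simp: S_def)
    have small: "norm (G n z) \<le> r ^ n" if "norm (B z) * norm (E z) \<le> r" "norm z \<le> 1" for z r
    proof -
      have "0 \<le> norm (B z) * norm (E z)" by simp
      then have "r \<ge> 0" using that(1) by linarith
      have "norm (G n z) = (norm (B z) * norm (E z)) ^ n * (norm (1 - cnj \<zeta> * z) / 2)"
        by (simp add: G_def norm_mult norm_power norm_divide)
      also have "\<dots> \<le> r ^ n * 1"
        using that nm_le[OF that(2)] by (intro mult_mono power_mono) (auto simp: \<open>r \<ge> 0\<close>)
      finally show ?thesis by simp
    qed
    consider "x = \<zeta>" | "norm x = 1" "x \<noteq> \<zeta>" | "norm x < 1" "dist \<zeta> x = \<delta>"
      using x1 x2 by fastforce
    then show "\<exists>r>0. \<forall>z\<in>S \<inter> ball x r. norm (G n z) < \<epsilon> ^ n + e"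
    proof cases
      case 1
      define r where "r = e / (M ^ n + 1)"
      have "M ^ n + 1 > 0" using \<open>M \<ge> 0\<close> by (simp add: add_nonneg_pos)
      then have "r > 0" using \<open>e > 0\<close> by (simp add: r_def)
      have "norm (G n z) < \<epsilon> ^ n + e" if z: "z \<in> S \<inter> ball x r" for z
      proof -
        have zD: "z \<in> ball 0 1" using z by (auto simp: S_def)
        have "norm (G n z) = (norm (B z) * norm (E z)) ^ n * (norm (\<zeta> - z) / 2)"
          by (simp add: G_def norm_mult norm_power norm_divide nm_eq)
        also have "\<dots> \<le> (M * 1) ^ n * norm (\<zeta> - z)"
          using bd[OF zD] E1[of z] zD \<open>M \<ge> 0\<close>
          by (intro mult_mono power_mono) (auto intro!: mult_mono)
        also have "\<dots> \<le> (M ^ n + 1) * norm (\<zeta> - z)" by (intro mult_right_mono) auto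
        also have "\<dots> < (M ^ n + 1) * r"
          using z 1 \<open>M ^ n + 1 > 0\<close> by (intro mult_strict_left_mono) (auto simp: dist_norm)
        also have "\<dots> = e" using \<open>M ^ n + 1 > 0\<close> by (simp add: r_def)
        finally show ?thesis using zero_le_power[of \<epsilon> n] \<open>\<epsilon> > 0\<close> by linarith
      qed
      then show ?thesis using \<open>r > 0\<close> by blast
    next
      case 2
      obtain t where t: "\<bar>t\<bar> < d" "x = cis (\<theta> + t)"
        using \<delta>0(2)[of x] 2 x1 \<open>\<delta> < \<delta>0\<close> by (auto simp: dist_commute)
      have "t \<noteq> 0" using 2 t by (auto simp: \<zeta>_def)
      then obtain r where r: "r > 0" "\<And>z. z \<in> ball 0 1 \<inter> ball x r \<Longrightarrow> norm (B z) \<le> \<epsilon>"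
        using near[of t] t by blast
      have "norm (G n z) \<le> \<epsilon> ^ n" if z: "z \<in> S \<inter> ball x r" for z
      proof (rule small)
        have zD: "z \<in> ball 0 1 \<inter> ball x r" using z by (auto simp: S_def)
        have "norm (B z) * norm (E z) \<le> \<epsilon> * 1"
          using r(2)[OF zD] E1[of z] zD \<open>\<epsilon> > 0\<close> by (intro mult_mono) auto
        then show "norm (B z) * norm (E z) \<le> \<epsilon>" by simp
      qed (use z in \<open>auto simp: S_def\<close>)
      then show ?thesis using r(1) \<open>e > 0\<close> by (intro exI[of _ r]) force
    next
      case 3
      have "1 \<le> 2 / \<delta>\<^sup>2 * Re (1 - cnj \<zeta> * x)"
        using barrier_on_sphere[OF n\<zeta> x1(1) 3(2) \<open>\<delta> > 0\<close>] by simp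
      then have "C * 1 \<le> C * (2 / \<delta>\<^sup>2 * Re (1 - cnj \<zeta> * x))"
        using \<open>C \<ge> 0\<close> by (intro mult_left_mono)
      then have "C \<le> a * Re (1 - cnj \<zeta> * x)" by (simp only: a_def mult.assoc mult_1_right)
      then have "norm (E x) \<le> exp (- C)" unfolding nE by simp
      then have "norm (B x) * norm (E x) \<le> M * exp (- C)"
        using bd[of x] 3 \<open>M \<ge> 0\<close> by (intro mult_mono) auto
      then have "norm (G n x) \<le> \<epsilon> ^ n"
        using \<open>M * exp (- C) \<le> \<epsilon>\<close> x1 by (intro small) auto
      moreover have "isCont (\<lambda>z. norm (G n z)) x"
      proof -
        have "continuous_on (ball 0 1) (\<lambda>z. norm (G n z))"
          unfolding G_def E_def by (intro continuous_intros contB) auto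
        then show ?thesis using 3 by (simp add: continuous_on_eq_continuous_at)
      qed
      then obtain r where "r > 0" "\<And>z. dist z x < r \<Longrightarrow> dist (norm (G n z)) (norm (G n x)) < e"
        using \<open>e > 0\<close> unfolding continuous_at_eps_delta by (metis dist_norm)
      ultimately show ?thesis
        by (intro exI[of _ r]) (force simp: dist_real_def dist_commute abs_less_iff)
    qed
  qed
  have BE: "norm (B z) * norm (E z) \<le> \<epsilon>" if "z \<in> S" for z
  proof (rule ccontr)
    assume "\<not> ?thesis"
    then have gt: "norm (B z) * norm (E z) / \<epsilon> > 1" using \<open>\<epsilon> > 0\<close> by simp
    have "z \<noteq> \<zeta>" using that n\<zeta> by (auto simp: S_def)
    then have w: "norm (\<zeta> - z) > 0" by simp
    obtain n where n: "2 / norm (\<zeta> - z) < (norm (B z) * norm (E z) / \<epsilon>) ^ n"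
      using real_arch_pow[OF gt] by blast
    have "(norm (B z) * norm (E z)) ^ n * (norm (\<zeta> - z) / 2) \<le> \<epsilon> ^ n"
      using Gle[OF that, of n] by (simp add: G_def norm_mult norm_power norm_divide nm_eq)
    then have "(norm (B z) * norm (E z) / \<epsilon>) ^ n \<le> 2 / norm (\<zeta> - z)"
      using w \<open>\<epsilon> > 0\<close> by (simp add: power_divide field_simps)
    then show False using n by simp
  qed
  \<comment> \<open>In this ball the exponent of \<open>E\<close> is at least \<open>- ln 2\<close>
    in real part, so \<open>|E| \<ge> 1 / 2\<close>; this is the origin of the factor 2.\<close>
  define \<rho> where "\<rho> = min \<delta> (ln 2 / (a + 1))"
  show ?thesis
  proof (rule that)
    show "\<rho> > 0" using \<open>\<delta> > 0\<close> \<open>a \<ge> 0\<close> by (simp add: \<rho>_def add_nonneg_pos)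
    fix z assume z: "z \<in> ball 0 1 \<inter> ball (cis \<theta>) \<rho>"
    then have "z \<in> S" by (auto simp: S_def \<rho>_def \<zeta>_def)
    have "a * Re (1 - cnj \<zeta> * z) \<le> (a + 1) * norm (1 - cnj \<zeta> * z)"
      using Re_le[of z] z \<open>a \<ge> 0\<close> by (intro mult_mono complex_Re_le_cmod) auto
    also have "\<dots> \<le> (a + 1) * (ln 2 / (a + 1))"
      using z \<open>a \<ge> 0\<close> nm_eq[of z] by (intro mult_left_mono) (auto simp: \<rho>_def \<zeta>_def dist_norm)
    also have "\<dots> = ln 2" using \<open>a \<ge> 0\<close> by simp
    finally have "exp (- ln 2) \<le> norm (E z)" unfolding nE by simp
    then have "1 / 2 \<le> norm (E z)" by (simp add: exp_minus)
    then have "norm (B z) * (1 / 2) \<le> norm (B z) * norm (E z)" by (intro mult_left_mono) auto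
    then show "norm (B z) \<le> 2 * \<epsilon>" using BE[OF \<open>z \<in> S\<close>] by simp
  qed
qed

text \<open>On either side one factor of \<open>(\<phi> - p1) * (\<phi> - p2)\<close> is small and
  the other bounded, so the product tends to 0 at \<open>cis \<theta>\<close> as well. Near
  \<open>cis \<theta>\<close> the values of \<phi> therefore cluster only at \<open>p1\<close> and
  \<open>p2\<close>, and both occur; as the intersection of two discs is connected, the two points
  coincide. The product is then a square.\<close>

lemma two_sided_limit:
  fixes \<phi> :: "complex \<Rightarrow> complex"
  assumes hol: "\<phi> holomorphic_on ball 0 1" and bd: "\<And>z. z \<in> ball 0 1 \<Longrightarrow> norm (\<phi> z) \<le> M"
    and p1: "side_limit \<phi> \<theta> 1 p1" and p2: "side_limit \<phi> \<theta> (- 1) p2"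
  shows "(\<phi> \<longlongrightarrow> p1) (at (cis \<theta>) within ball 0 1)"
proof -
  define B where "B = (\<lambda>z. (\<phi> z - p1) * (\<phi> z - p2))"
  define K where "K = max (M + norm p1) (M + norm p2) + 1"
  have "M \<ge> 0" using bd[of 0] norm_ge_zero[of "\<phi> 0"] by (simp del: norm_ge_zero)
  moreover have "K \<ge> M + norm p1 + 1" by (simp add: K_def)
  ultimately have "K > 0" using norm_ge_zero[of p1] by linarith
  have K: "norm (\<phi> z - p1) \<le> K" "norm (\<phi> z - p2) \<le> K" if "z \<in> ball 0 1" for z
    using bd[OF that] norm_triangle_ineq4[of "\<phi> z" p1] norm_triangle_ineq4[of "\<phi> z" p2]
    by (auto simp: K_def)
  have holB: "B holomorphic_on ball 0 1" unfolding B_def by (intro holomorphic_intros hol)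
  have small: "\<exists>\<rho>>0. \<forall>z\<in>ball 0 1 \<inter> ball (cis \<theta>) \<rho>. norm (B z) \<le> 2 * \<epsilon>" if "\<epsilon> > 0" for \<epsilon>
  proof -
    have e: "\<epsilon> / K > 0" using that \<open>K > 0\<close> by simp
    obtain d1 where d1: "d1 > 0" "\<And>x. x \<in> {0<..<d1} \<Longrightarrow> near \<phi> p1 (\<epsilon> / K) (cis (\<theta> + 1 * x))"
      using p1[unfolded side_limit_def, rule_format, OF e] by blast
    obtain d2 where d2: "d2 > 0" "\<And>x. x \<in> {0<..<d2} \<Longrightarrow> near \<phi> p2 (\<epsilon> / K) (cis (\<theta> + - 1 * x))"
      using p2[unfolded side_limit_def, rule_format, OF e] by blast
    have "\<exists>\<rho>>0. \<forall>z\<in>ball 0 1 \<inter> ball (cis (\<theta> + x)) \<rho>. norm (B z) \<le> \<epsilon>"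
      if x: "x \<noteq> 0" "\<bar>x\<bar> < min d1 d2" for x
    proof -
      obtain \<rho> where "\<rho> > 0" and r: "\<forall>z\<in>ball 0 1 \<inter> ball (cis (\<theta> + x)) \<rho>. dist (\<phi> z) p1 < \<epsilon> / K \<or> dist (\<phi> z) p2 < \<epsilon> / K"
      proof (cases "x > 0")
        case True
        then show ?thesis using that d1(2)[of x] x by (metis abs_of_pos greaterThanLessThan_iff min_less_iff_conj mult_1)
      next
        case False
        then show ?thesis using that d2(2)[of "- x"] x by force
      qed
      have "norm (B z) \<le> \<epsilon>" if z: "z \<in> ball 0 1 \<inter> ball (cis (\<theta> + x)) \<rho>" for z
      proof -
        have "norm (\<phi> z - p1) * norm (\<phi> z - p2) \<le> (\<epsilon> / K) * K"
          using bspec[OF r z]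
        proof
          assume "dist (\<phi> z) p1 < \<epsilon> / K"
          then show ?thesis using K[of z] z e by (intro mult_mono) (auto simp: dist_norm)
        next
          assume "dist (\<phi> z) p2 < \<epsilon> / K"
          then have "norm (\<phi> z - p2) * norm (\<phi> z - p1) \<le> (\<epsilon> / K) * K"
            using K[of z] z e by (intro mult_mono) (auto simp: dist_norm)
          then show ?thesis by (simp add: mult.commute)
        qed
        then show ?thesis using \<open>K > 0\<close> by (simp add: B_def norm_mult)
      qed
      then show ?thesis using \<open>\<rho> > 0\<close> by blast
    qed
    note nr = this
    show ?thesis
    proof (rule boundary_exception[OF holB, of "K * K" \<epsilon> "min d1 d2" \<theta>])
      show "norm (B z) \<le> K * K" if "z \<in> ball 0 1" for z
        using K[OF that] \<open>K > 0\<close> unfolding B_def norm_mult by (intro mult_mono) auto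
      show "min d1 d2 > 0" using d1(1) d2(1) by simp
    qed (use nr that in blast)+
  qed
  have "p1 = p2"
  proof (rule ccontr)
    assume "p1 \<noteq> p2"
    define D where "D = dist p1 p2 / 2"
    have "D > 0" using \<open>p1 \<noteq> p2\<close> by (simp add: D_def)
    then have "D * D / 4 > 0" by simp
    then obtain \<rho> where "\<rho> > 0" and r: "\<forall>z\<in>ball 0 1 \<inter> ball (cis \<theta>) \<rho>. norm (B z) \<le> 2 * (D * D / 4)"
      using small by blast
    define N where "N = ball 0 1 \<inter> ball (cis \<theta>) \<rho>"
    have "connected N" unfolding N_def by (intro convex_connected convex_Int convex_ball)
    have contN: "continuous_on N (\<lambda>z. dist (\<phi> z) p)" for p
      using holomorphic_on_imp_continuous_on[OF hol] unfolding N_def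
      by (intro continuous_intros) (auto intro: continuous_on_subset)
    have "open N" by (auto simp: N_def)
    define A where "A = (\<lambda>p. N \<inter> (\<lambda>z. dist (\<phi> z) p) -` {..<D})"
    have "open (A p)" for p
      unfolding A_def by (intro continuous_open_preimage contN \<open>open N\<close>) auto
    moreover have "A p1 \<noteq> {}"
    proof -
      obtain z where "z \<in> ball 0 1" "dist (cis \<theta>) z < \<rho>" "dist (\<phi> z) p1 < D"
        using side_limit_point[OF p1 _ \<open>D > 0\<close> \<open>\<rho> > 0\<close>] by blast
      then show ?thesis by (auto simp: A_def N_def)
    qed
    moreover have "A p2 \<noteq> {}"
    proof -
      obtain z where "z \<in> ball 0 1" "dist (cis \<theta>) z < \<rho>" "dist (\<phi> z) p2 < D"
        using side_limit_point[OF p2 _ \<open>D > 0\<close> \<open>\<rho> > 0\<close>] by blast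
      then show ?thesis by (auto simp: A_def N_def)
    qed
    moreover have "A p1 \<inter> A p2 = {}"
    proof -
      have False if "dist (\<phi> z) p1 < D" "dist (\<phi> z) p2 < D" for z
        using that dist_triangle2[of p1 p2 "\<phi> z"] by (simp add: D_def dist_commute)
      then show ?thesis by (auto simp: A_def)
    qed
    moreover have "N \<subseteq> A p1 \<union> A p2"
    proof
      fix z assume z: "z \<in> N"
      show "z \<in> A p1 \<union> A p2"
      proof (rule ccontr)
        assume "\<not> ?thesis"
        then have "D * D \<le> norm (\<phi> z - p1) * norm (\<phi> z - p2)"
          using z \<open>D > 0\<close> by (intro mult_mono) (auto simp: A_def dist_norm)
        also have "\<dots> \<le> 2 * (D * D / 4)" using r z by (auto simp: B_def norm_mult N_def)
        finally show False using \<open>D > 0\<close> by simp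
      qed
    qed
    ultimately show False
      using connectedD[OF \<open>connected N\<close>, of "A p1" "A p2"] by (auto simp: A_def)
  qed
  show ?thesis
    unfolding tendsto_iff
  proof (intro allI impI)
    fix e :: real assume "e > 0"
    then have "e * e / 4 > 0" by simp
    then obtain \<rho> where "\<rho> > 0" and r: "\<forall>z\<in>ball 0 1 \<inter> ball (cis \<theta>) \<rho>. norm (B z) \<le> 2 * (e * e / 4)"
      using small by blast
    have "dist (\<phi> z) p1 < e" if "z \<in> ball 0 1" "dist z (cis \<theta>) < \<rho>" for z
    proof (rule ccontr)
      assume "\<not> ?thesis"
      then have "e * e \<le> norm (\<phi> z - p1) * norm (\<phi> z - p1)"
        using \<open>e > 0\<close> by (intro mult_mono) (auto simp: dist_norm)
      also have "\<dots> \<le> 2 * (e * e / 4)" using r that \<open>p1 = p2\<close> by (auto simp: B_def norm_mult dist_commute)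
      finally show False using \<open>e > 0\<close> by simp
    qed
    then show "\<forall>\<^sub>F x in at (cis \<theta>) within ball 0 1. dist (\<phi> x) p1 < e"
      unfolding eventually_at using \<open>\<rho> > 0\<close> by blast
  qed
qed

text \<open>Only limits through the disc are given. Continuity along the circle follows because each
  boundary value is approximated by values taken inside.\<close>

lemma continuous_extension_cball:
  fixes \<phi> :: "complex \<Rightarrow> complex"
  assumes cont: "continuous_on (ball 0 1) \<phi>"
    and lim: "\<And>\<theta>. \<exists>p. (\<phi> \<longlongrightarrow> p) (at (cis \<theta>) within ball 0 1)"
  obtains \<psi> where "continuous_on (cball 0 1) \<psi>" "\<And>z. z \<in> ball 0 1 \<Longrightarrow> \<psi> z = \<phi> z"
proof -
  have "\<exists>p. \<forall>e>0. \<exists>d>0. \<forall>z\<in>ball 0 1. dist z x < d \<longrightarrow> dist (\<phi> z) p < e" if "x \<in> cball 0 1" for x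
  proof (cases "x \<in> ball 0 1")
    case True
    then show ?thesis using cont unfolding continuous_on_iff by blast
  next
    case False
    then have "norm x = 1" using that by auto
    then have "x = cis (Arg x)" by (simp add: cis_Arg_unit)
    then obtain p where p: "(\<phi> \<longlongrightarrow> p) (at x within ball 0 1)" using lim[of "Arg x"] by auto
    have "\<exists>d>0. \<forall>z\<in>ball 0 1. dist z x < d \<longrightarrow> dist (\<phi> z) p < e" if "e > 0" for e
      using p[unfolded tendsto_iff, rule_format, OF that] False unfolding eventually_at by metis
    then show ?thesis by blast
  qed
  then obtain \<psi> where \<psi>: "\<And>x e. x \<in> cball 0 1 \<Longrightarrow> e > 0 \<Longrightarrow> \<exists>d>0. \<forall>z\<in>ball 0 1. dist z x < d \<longrightarrow> dist (\<phi> z) (\<psi> x) < e"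
    by metis
  have eq: "\<psi> z = \<phi> z" if "z \<in> ball 0 1" for z
  proof (rule ccontr)
    assume "\<psi> z \<noteq> \<phi> z"
    then have "dist (\<phi> z) (\<psi> z) > 0" by simp
    moreover have "z \<in> cball 0 1" using that by simp
    ultimately obtain d where "d > 0" "\<forall>w\<in>ball 0 1. dist w z < d \<longrightarrow> dist (\<phi> w) (\<psi> z) < dist (\<phi> z) (\<psi> z)"
      using \<psi> by blast
    then show False using that by (metis dist_self less_irrefl)
  qed
  have "continuous_on (cball 0 1) \<psi>"
    unfolding continuous_on_iff
  proof (intro ballI allI impI)
    fix x :: complex and e :: real assume x: "x \<in> cball 0 1" and "e > 0"
    then have e2: "e / 2 > 0" by simp
    obtain d where d: "d > 0" "\<And>z. z \<in> ball 0 1 \<Longrightarrow> dist z x < d \<Longrightarrow> dist (\<phi> z) (\<psi> x) < e / 2"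
      using \<psi>[OF x e2] by blast
    have "dist (\<psi> y) (\<psi> x) < e" if y: "y \<in> cball 0 1" "dist y x < d / 2" for y
    proof -
      obtain d' where d': "d' > 0" "\<And>z. z \<in> ball 0 1 \<Longrightarrow> dist z y < d' \<Longrightarrow> dist (\<phi> z) (\<psi> y) < e / 2"
        using \<psi>[OF y(1) e2] by blast
      have "y \<in> closure (ball 0 1)" using y by simp
      then obtain z where z: "z \<in> ball 0 1" "dist z y < min d' (d / 2)"
        using d(1) d'(1) unfolding closure_approachable by (metis half_gt_zero min_less_iff_conj)
      then have "dist z x < d" using y(2) dist_triangle[of z x y] by simp
      then have "dist (\<phi> z) (\<psi> x) < e / 2" "dist (\<phi> z) (\<psi> y) < e / 2" using d(2) d'(2) z by auto
      then show ?thesis using dist_triangle2[of "\<psi> y" "\<psi> x" "\<phi> z"] by (simp add: dist_commute)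
    qed
    then show "\<exists>d>0. \<forall>x'\<in>cball 0 1. dist x' x < d \<longrightarrow> dist (\<psi> x') (\<psi> x) < e"
      using d(1) half_gt_zero by blast
  qed
  then show ?thesis using that eq by blast
qed

text \<open>The crossing argument yields side limits of \<open>f \<circ> \<phi>\<close>, but the
  two-sided argument needs a holomorphic function. On the compact set \<open>K\<close> the injective
  map \<open>f\<close> is a homeomorphism onto its image, and its inverse carries the limits over to
  \<phi>.\<close>

lemma conformal_extension:
  fixes f \<phi> :: "complex \<Rightarrow> complex"
  assumes hol: "\<phi> holomorphic_on ball 0 1" and im: "\<phi> ` ball 0 1 \<subseteq> K" and "compact K"
    and f: "continuous_on K f" "inj_on f K"
    and F: "level_connected F1" "level_connected F2"
    and re: "\<And>z. z \<in> ball 0 1 \<Longrightarrow> Re (F1 z) = Re (f (\<phi> z))"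
    and imag: "\<And>z. z \<in> ball 0 1 \<Longrightarrow> Re (F2 z) = Im (f (\<phi> z))"
  obtains \<psi> where "continuous_on (cball 0 1) \<psi>" "\<And>z. z \<in> ball 0 1 \<Longrightarrow> \<psi> z = \<phi> z" "\<psi> ` cball 0 1 \<subseteq> K"
proof -
  obtain g where "homeomorphism K (f ` K) f g"
    using homeomorphism_compact[OF \<open>compact K\<close> f(1) refl f(2)] by blast
  then have g: "continuous_on (f ` K) g" "\<And>x. x \<in> K \<Longrightarrow> g (f x) = x"
    by (auto simp: homeomorphism_def)
  have "closed (f ` K)" using compact_continuous_image[OF f(1) \<open>compact K\<close>] compact_imp_closed by blast
  have side: "\<exists>p. side_limit \<phi> \<theta> s p" if s: "s = 1 \<or> s = -1" for s \<theta>
  proof -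
    obtain w where w: "side_limit (\<lambda>z. f (\<phi> z)) \<theta> s w"
      by (rule side_limit_exists[OF F s, of "\<lambda>z. f (\<phi> z)" \<theta>]) (use re imag in auto)
    have "w \<in> closure (f ` K)"
      unfolding closure_approachable
    proof (intro allI impI)
      fix e :: real assume "e > 0"
      obtain z where "z \<in> ball 0 1" "dist (f (\<phi> z)) w < e"
        using side_limit_point[OF w s \<open>e > 0\<close> zero_less_one] by blast
      then show "\<exists>y\<in>f ` K. dist y w < e" using im by blast
    qed
    then have wK: "w \<in> f ` K" using \<open>closed (f ` K)\<close> by simp
    have "side_limit \<phi> \<theta> s (g w)"
      unfolding side_limit_def
    proof (intro allI impI)
      fix \<epsilon> :: real assume "\<epsilon> > 0"
      then obtain e where "e > 0" and e: "\<And>y. y \<in> f ` K \<Longrightarrow> dist y w < e \<Longrightarrow> dist (g y) (g w) < \<epsilon>"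
        using g(1)[unfolded continuous_on_iff, rule_format, OF wK] by blast
      obtain d where d: "d > 0" "\<And>x. x \<in> {0<..<d} \<Longrightarrow> near (\<lambda>z. f (\<phi> z)) w e (cis (\<theta> + s * x))"
        using w[unfolded side_limit_def, rule_format, OF \<open>e > 0\<close>] by blast
      have "dist (\<phi> z) (g w) < \<epsilon>" if "z \<in> ball 0 1" "dist (f (\<phi> z)) w < e" for z
      proof -
        have "\<phi> z \<in> K" using im that(1) by blast
        then show ?thesis using e[of "f (\<phi> z)"] g(2)[of "\<phi> z"] that(2) by simp
      qed
      then show "\<exists>d>0. \<forall>x\<in>{0<..<d}. near \<phi> (g w) \<epsilon> (cis (\<theta> + s * x))"
        using d by (meson IntD1)
    qed
    then show ?thesis by blast
  qed
  have "bounded K" using \<open>compact K\<close> compact_imp_bounded by blast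
  then obtain M where M: "\<And>x. x \<in> K \<Longrightarrow> norm x \<le> M" by (meson bounded_iff)
  have "\<exists>p. (\<phi> \<longlongrightarrow> p) (at (cis \<theta>) within ball 0 1)" for \<theta>
  proof -
    obtain p1 p2 where "side_limit \<phi> \<theta> 1 p1" "side_limit \<phi> \<theta> (- 1) p2" using side by blast
    then show ?thesis using two_sided_limit[OF hol, of M] M im by blast
  qed
  then obtain \<psi> where \<psi>: "continuous_on (cball 0 1) \<psi>" "\<And>z. z \<in> ball 0 1 \<Longrightarrow> \<psi> z = \<phi> z"
    using continuous_extension_cball holomorphic_on_imp_continuous_on[OF hol] by metis
  have "\<psi> ` closure (ball 0 1) \<subseteq> K"
    by (rule image_closure_subset) (use \<psi> im \<open>compact K\<close> compact_imp_closed in auto)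
  then show ?thesis using that \<psi> by simp
qed

section \<open>Unimodal boundary values and the hyperbolic flow\<close>

lemma circle_interlace:
  fixes U :: "complex \<Rightarrow> real"
  assumes lc: "level_connected F" and cont: "continuous_on (cball 0 1) U"
    and eq: "\<And>z. z \<in> ball 0 1 \<Longrightarrow> Re (F z) = U z"
    and lt: "\<theta>1 < \<theta>2" "\<theta>2 < \<theta>3" "\<theta>3 < \<theta>4" "\<theta>4 < \<theta>1 + 2 * pi" and "c'' < c'"
    and "U (cis \<theta>1) > c'" "U (cis \<theta>3) > c'" "U (cis \<theta>2) < c''" "U (cis \<theta>4) < c''"
  shows False
proof -
  have cl: "cis \<theta> \<in> closure {z \<in> ball 0 1. Re (F z) \<in> S}" if S: "open S" "U (cis \<theta>) \<in> S" for \<theta> S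
    unfolding closure_approachable
  proof (intro allI impI)
    fix e :: real assume "e > 0"
    obtain r where r: "r > 0" "\<And>y. dist y (U (cis \<theta>)) < r \<Longrightarrow> y \<in> S"
      using S unfolding open_dist by blast
    have "cis \<theta> \<in> cball 0 1" by simp
    then obtain d where d: "d > 0" "\<And>z. z \<in> cball 0 1 \<Longrightarrow> dist z (cis \<theta>) < d \<Longrightarrow> dist (U z) (U (cis \<theta>)) < r"
      using cont r(1) unfolding continuous_on_iff by blast
    have "cis \<theta> \<in> closure (ball 0 1)" by simp
    then obtain z where z: "z \<in> ball 0 1" "dist z (cis \<theta>) < min d e"
      using d(1) \<open>e > 0\<close> unfolding closure_approachable by (metis min_less_iff_conj)
    then have "U z \<in> S" using r(2) d(2)[of z] by auto
    then show "\<exists>y\<in>{z \<in> ball 0 1. Re (F z) \<in> S}. dist y (cis \<theta>) < e"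
      using z eq[OF z(1)] by (intro bexI[of _ z]) auto
  qed
  show False
    by (rule level_connected_interlace_cis[OF lc lt \<open>c'' < c'\<close>])
       (use cl[of "{c'<..}"] cl[of "{..<c''}"] assms in simp_all)
qed

text \<open>In the Cayley coordinate the automorphism with fixed points 1 and -1 is multiplication
  by \<open>(1 - s) / (1 + s)\<close>, so \<open>tan (t / 2)\<close> shrinks and the angle moves
  towards 0.\<close>

lemma circle_flow_angle:
  assumes "- pi < t" "t < pi" "0 < s" "s < (1::real)"
  shows "(cis t + s) / (1 + s * cis t) = cis (2 * arctan ((1 - s) / (1 + s) * tan (t / 2)))"
proof (rule cayley_inj)
  define t' where "t' = 2 * arctan ((1 - s) / (1 + s) * tan (t / 2))"
  define T where "T = (cis t + s) / (1 + s * cis t)"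
  have t': "- pi < t'" "t' < pi"
    using arctan_bounded[of "(1 - s) / (1 + s) * tan (t / 2)"] by (auto simp: t'_def)
  have ne: "1 + cis t \<noteq> 0" using cis_neq_minus_one[OF assms(1,2)] by (simp add: add_eq_0_iff)
  have ne2: "1 + s * cis t \<noteq> 0"
  proof
    assume "1 + s * cis t = 0"
    then have "norm (s * cis t) = norm (- 1 :: complex)" by (metis add_eq_0_iff)
    then show False using assms by (simp add: norm_mult)
  qed
  have s1: "1 + complex_of_real s \<noteq> 0" using assms by (metis add_pos_pos less_irrefl of_real_1 of_real_add of_real_eq_0_iff zero_less_one)
  have a: "1 - T = (1 - s) * (1 - cis t) / (1 + s * cis t)" "1 + T = (1 + s) * (1 + cis t) / (1 + s * cis t)"
    using ne2 by (simp_all add: T_def field_simps)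
  have "cayley T = ((1 - s) / (1 + s)) * cayley (cis t)"
    using ne ne2 s1 by (simp add: cayley_def a)
  also have "\<dots> = of_real ((1 - s) / (1 + s) * tan (t / 2))"
    using assms by (simp add: cayley_cis)
  also have "\<dots> = cayley (cis t')"
    using cayley_cis[OF t'] by (simp add: t'_def tan_arctan)
  finally show "cayley ((cis t + s) / (1 + s * cis t)) = cayley (cis (2 * arctan ((1 - s) / (1 + s) * tan (t / 2))))"
    by (simp add: T_def t'_def)
  show "cis (2 * arctan ((1 - s) / (1 + s) * tan (t / 2))) \<noteq> - 1"
    using cis_neq_minus_one[OF t'] by (simp add: t'_def)
  have "1 + T \<noteq> 0" using a(2) ne ne2 s1 by simp
  then show "(cis t + s) / (1 + s * cis t) \<noteq> - 1" by (auto simp: T_def)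
qed

lemma flow_norm:
  fixes z :: complex
  assumes "0 < s" "s < (1::real)" "norm z \<le> 1"
  shows "1 + s * z \<noteq> 0" "norm z < 1 \<Longrightarrow> norm ((z + s) / (1 + s * z)) < 1" "norm ((z + s) / (1 + s * z)) \<le> 1"
proof -
  show ne: "1 + s * z \<noteq> 0"
  proof
    assume "1 + s * z = 0"
    then have "norm (s * z) = norm (- 1 :: complex)" by (metis add_eq_0_iff)
    then have "s * norm z = 1" using assms by (simp add: norm_mult)
    moreover have "s * norm z \<le> s * 1" using assms by (intro mult_left_mono) auto
    ultimately show False using assms by simp
  qed
  have eq: "(norm (1 + s * z))\<^sup>2 - (norm (z + s))\<^sup>2 = (1 - s\<^sup>2) * (1 - (norm z)\<^sup>2)"
    by (simp only: cmod_power2) (simp add: power2_eq_square algebra_simps)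
  have s2: "1 - s\<^sup>2 > 0" using assms by (simp add: power_less_one_iff)
  show "norm ((z + s) / (1 + s * z)) < 1" if "norm z < 1"
  proof -
    have "(norm z)\<^sup>2 < 1" using that by (simp add: power_less_one_iff)
    then have "(norm (z + s))\<^sup>2 < (norm (1 + s * z))\<^sup>2" using eq s2 mult_pos_pos[OF s2, of "1 - (norm z)\<^sup>2"] by linarith
    then have "norm (z + s) < norm (1 + s * z)" by (rule power2_less_imp_less) simp
    then show ?thesis using ne by (simp add: norm_divide)
  qed
  have "(norm z)\<^sup>2 \<le> 1" using assms(3) by (simp add: power_le_one)
  then have "(norm (z + s))\<^sup>2 \<le> (norm (1 + s * z))\<^sup>2"
    using eq s2 mult_nonneg_nonneg[of "1 - s\<^sup>2" "1 - (norm z)\<^sup>2"] by linarith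
  then have "norm (z + s) \<le> norm (1 + s * z)" by (rule power2_le_imp_le) simp
  then show "norm ((z + s) / (1 + s * z)) \<le> 1" using ne by (simp add: norm_divide)
qed

text \<open>On the circle the flow moves points towards 1 without leaving their arc between -1 and
  1. A decrease from \<open>w\<close> to its image would make the maximum point 1, the image,
  \<open>w\<close> and the minimum point -1 alternate between high and low. The inequality passes to
  the disc by the maximum principle for \<open>F - F \<circ> T\<close>, whose real part has
  continuous boundary values.\<close>

lemma hyperbolic_flow_increases:
  fixes U :: "complex \<Rightarrow> real"
  assumes lc: "level_connected F" and cont: "continuous_on (cball 0 1) U"
    and eq: "\<And>z. z \<in> ball 0 1 \<Longrightarrow> Re (F z) = U z"
    and max: "\<And>w. norm w = 1 \<Longrightarrow> U w \<le> U 1" and min: "\<And>w. norm w = 1 \<Longrightarrow> U (- 1) \<le> U w"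
    and s: "0 < s" "s < (1::real)" and z: "z \<in> ball 0 1"
  shows "U z \<le> U ((z + s) / (1 + s * z))"
proof -
  define T where "T = (\<lambda>z. (z + of_real s) / (1 + of_real s * z) :: complex)"
  have contT: "continuous_on (cball 0 1) T"
    unfolding T_def using flow_norm(1)[OF s] by (intro continuous_intros) auto
  have TD: "T ` cball 0 1 \<subseteq> cball 0 1" "T ` ball 0 1 \<subseteq> ball 0 1"
    using flow_norm[OF s] by (auto simp: T_def)
  have circle: "U w \<le> U (T w)" if w: "norm w = 1" for w
  proof (rule ccontr)
    assume "\<not> ?thesis"
    then have lt: "U (T w) < U w" by simp
    \<comment> \<open>The levels lie strictly between \<open>U (T w)\<close> and \<open>U w\<close>,
      so the values at 1 and -1 satisfy strict bounds even if they equal \<open>U w\<close> and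
      \<open>U (T w)\<close>.\<close>
    define d where "d = (U w - U (T w)) / 3"
    have d: "U (T w) < U (T w) + d" "U (T w) + d < U w - d" "U w - d < U w" using lt by (auto simp: d_def field_simps)
    have "w \<noteq> 1" using lt flow_norm(1)[OF s, of 1] by (auto simp: T_def add.commute)
    have "w \<noteq> - 1"
    proof
      assume "w = - 1"
      then have "T w = - 1" using s by (simp add: T_def divide_eq_eq add_eq_0_iff)
      then show False using lt \<open>w = - 1\<close> by simp
    qed
    define t where "t = Arg w"
    have wt: "w = cis t" using cis_Arg_unit[OF w] by (simp add: t_def)
    have "- pi < t" "t \<le> pi" using Arg_bounded by (auto simp: t_def)
    moreover have "t \<noteq> pi" "t \<noteq> 0" using wt \<open>w \<noteq> 1\<close> \<open>w \<noteq> - 1\<close> by auto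
    ultimately have t: "- pi < t" "t < pi" "t \<noteq> 0" by auto
    define \<kappa> where "\<kappa> = (1 - s) / (1 + s)"
    have \<kappa>: "0 < \<kappa>" "\<kappa> < 1" using s by (auto simp: \<kappa>_def)
    define t' where "t' = 2 * arctan (\<kappa> * tan (t / 2))"
    have Tw: "T w = cis t'" unfolding T_def wt t'_def \<kappa>_def by (rule circle_flow_angle[OF t(1,2) s])
    have att: "2 * arctan (tan (t / 2)) = t" using t by (simp add: arctan_tan)
    have T1: "norm (T w) = 1" by (simp add: Tw)
    \<comment> \<open>Cyclic order: 1, \<open>T w\<close>, \<open>w\<close>, -1 for positive
      \<open>t\<close> and \<open>w\<close>, \<open>T w\<close>, 1, -1 for negative
      \<open>t\<close>. High and low alternate in both cases.\<close>
    show False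
    proof (cases "t > 0")
      case True
      then have "tan (t / 2) > 0" using t by (intro tan_gt_zero) auto
      then have "0 < \<kappa> * tan (t / 2)" "\<kappa> * tan (t / 2) < tan (t / 2)" using \<kappa> by auto
      then have t': "0 < t'" "t' < t"
        unfolding t'_def using att arctan_less_iff[of "\<kappa> * tan (t / 2)" "tan (t / 2)"] zero_less_arctan_iff by (force, linarith)
      show False
        by (rule circle_interlace[OF lc cont eq, of 0 t' t pi "U (T w) + d" "U w - d"])
           (use t t' d max[OF w] min[OF T1] in \<open>auto simp: wt[symmetric] Tw[symmetric]\<close>)
    next
      case False
      then have "tan (- t / 2) > 0" using t by (intro tan_gt_zero) auto
      then have "tan (t / 2) < 0" by simp
      then have "\<kappa> * tan (t / 2) < 0" "tan (t / 2) < \<kappa> * tan (t / 2)"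
        using \<kappa> by (auto simp: mult_pos_neg)
      then have t': "t' < 0" "t < t'"
        unfolding t'_def using att arctan_less_iff[of "tan (t / 2)" "\<kappa> * tan (t / 2)"] arctan_less_zero_iff by (force, linarith)
      show False
        by (rule circle_interlace[OF lc cont eq, of t t' 0 pi "U (T w) + d" "U w - d"])
           (use t t' d max[OF w] min[OF T1] in \<open>auto simp: wt[symmetric] Tw[symmetric]\<close>)
    qed
  qed
  have hol: "F holomorphic_on ball 0 1" using lc by (simp add: level_connected_def)
  have "Re (F z - F (T z)) \<le> 0"
  proof (rule maximum_principle_Re[OF open_ball bounded_ball _ _ z])
    have "T holomorphic_on ball 0 1"
      unfolding T_def using flow_norm(1)[OF s] by (intro holomorphic_intros) auto
    then show "(\<lambda>z. F z - F (T z)) holomorphic_on ball 0 1"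
      by (intro holomorphic_intros hol holomorphic_on_compose_gen[of T _ F "ball 0 1", unfolded o_def]) (use TD in auto)
    fix x :: complex and e :: real assume x: "x \<in> frontier (ball 0 1)" and "e > 0"
    have x1: "norm x = 1" using x by (simp add: frontier_ball)
    have "continuous_on (cball 0 1) (\<lambda>z. U z - U (T z))"
      by (intro continuous_intros cont continuous_on_compose2[OF cont contT]) (use TD in auto)
    moreover have "x \<in> cball 0 1" using x1 by simp
    ultimately obtain d where "d > 0" and d: "\<And>z. z \<in> cball 0 1 \<Longrightarrow> dist z x < d \<Longrightarrow> dist (U z - U (T z)) (U x - U (T x)) < e"
      using \<open>e > 0\<close> unfolding continuous_on_iff by metis
    have "Re (F z - F (T z)) < 0 + e" if zz: "z \<in> ball 0 1 \<inter> ball x d" for z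
    proof -
      have "z \<in> cball 0 1" "dist z x < d" "z \<in> ball 0 1" using zz by (auto simp: dist_commute)
      moreover from this have "T z \<in> ball 0 1" using TD(2) by blast
      ultimately have "dist (U z - U (T z)) (U x - U (T x)) < e" "Re (F z - F (T z)) = U z - U (T z)"
        using d eq by auto
      then show ?thesis using circle[OF x1] by (simp add: dist_real_def abs_less_iff)
    qed
    then show "\<exists>d>0. \<forall>z\<in>ball 0 1 \<inter> ball x d. Re (F z - F (T z)) < 0 + e"
      using \<open>d > 0\<close> by blast
  qed
  moreover have "T z \<in> ball 0 1" using TD z by blast
  ultimately show ?thesis using eq[OF z] eq[of "T z"] by (simp add: T_def)
qed

text \<open>If neither of the two arcs between two maximum points consists of maximum points, each
  arc contains a lower point, and the four points alternate.\<close>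

lemma argmax_connected:
  fixes U :: "complex \<Rightarrow> real"
  assumes lc: "level_connected F" and cont: "continuous_on (cball 0 1) U"
    and eq: "\<And>z. z \<in> ball 0 1 \<Longrightarrow> Re (F z) = U z"
  shows "connected {\<zeta> \<in> sphere 0 1. \<forall>w\<in>sphere 0 1. U w \<le> U \<zeta>}" (is "connected ?Z")
proof -
  have arc: "\<exists>A. connected A \<and> A \<subseteq> ?Z \<and> cis a \<in> A \<and> cis b \<in> A"
    if ab: "cis a \<in> ?Z" "cis b \<in> ?Z" "a < b" "b < a + 2 * pi" for a b
  proof (cases "cis ` {a..b} \<subseteq> ?Z \<or> cis ` {b..a + 2 * pi} \<subseteq> ?Z")
    case True
    have c2: "cis a \<in> cis ` {b..a + 2 * pi}"
      using ab by (intro image_eqI[of _ _ "a + 2 * pi"]) (auto simp: cis_mult[symmetric])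
    have "connected (cis ` S)" if "connected S" for S
      using that by (intro connected_continuous_image continuous_intros)
    then have "connected (cis ` {a..b})" "connected (cis ` {b..a + 2 * pi})" by auto
    from True show ?thesis
    proof
      assume "cis ` {a..b} \<subseteq> ?Z"
      then show ?thesis using \<open>connected (cis ` {a..b})\<close> ab by (intro exI[of _ "cis ` {a..b}"]) auto
    next
      assume "cis ` {b..a + 2 * pi} \<subseteq> ?Z"
      then show ?thesis using \<open>connected (cis ` {b..a + 2 * pi})\<close> c2 ab
        by (intro exI[of _ "cis ` {b..a + 2 * pi}"]) auto
    qed
  next
    case False
    then obtain x y where xy: "x \<in> {a..b}" "cis x \<notin> ?Z" "y \<in> {b..a + 2 * pi}" "cis y \<notin> ?Z" by blast
    have low: "U w < U (cis a)" if w: "w \<in> sphere 0 1" "w \<notin> ?Z" for w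
    proof -
      obtain v where "v \<in> sphere 0 1" "U w < U v" using w by force
      then show ?thesis using ab(1) by force
    qed
    have "U (cis b) \<le> U (cis a)" "U (cis a) \<le> U (cis b)" using ab(1,2) by auto
    then have Uab: "U (cis b) = U (cis a)" by simp
    have lx: "U (cis x) < U (cis a)" "U (cis y) < U (cis a)" using low xy by auto
    have "cis y \<noteq> cis (a + 2 * pi)" using lx by (auto simp: cis_mult[symmetric])
    then have ord: "a < x" "x < b" "b < y" "y < a + 2 * pi"
      using xy lx Uab by (auto simp: order.order_iff_strict)
    define m where "m = max (U (cis x)) (U (cis y))"
    define d where "d = (U (cis a) - m) / 3"
    have "d > 0" and d: "m + d < U (cis a) - d" using lx by (auto simp: d_def m_def field_simps)
    have "U (cis x) < m + d" "U (cis y) < m + d" using \<open>d > 0\<close> by (auto simp: m_def)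
    then show ?thesis
      using circle_interlace[OF lc cont eq ord d] Uab \<open>d > 0\<close> by auto
  qed
  show ?thesis
    unfolding connected_iff_connected_component
  proof (intro ballI)
    fix p q assume pq: "p \<in> ?Z" "q \<in> ?Z"
    define a b where "a = Arg p" and "b = Arg q"
    have p: "p = cis a" and q: "q = cis b"
      using pq cis_Arg_unit[of p] cis_Arg_unit[of q] by (auto simp: a_def b_def)
    have bnd: "a < b + 2 * pi" "b < a + 2 * pi" using Arg_bounded[of p] Arg_bounded[of q] by (auto simp: a_def b_def)
    consider "a < b" | "b < a" | "a = b" by linarith
    then show "connected_component ?Z p q"
    proof cases
      case 1 then show ?thesis using arc[of a b] pq bnd unfolding connected_component_def p q by blast
    next
      case 2 then show ?thesis using arc[of b a] pq bnd unfolding connected_component_def p q by blast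
    next
      case 3 then show ?thesis using pq p q by (simp add: connected_component_refl)
    qed
  qed
qed

text \<open>
  If \<open>x\<close> and \<open>y\<close> run through the (connected) sets of maximum and minimum points of \<open>Re (a k)\<close>, then
  \<open>Im (y cnj x)\<close> vanishes only for \<open>y = -x\<close>. Otherwise its sign depends only on \<open>a\<close>, is locally
  constant, and changes under \<open>a \<mapsto> -a\<close>.
\<close>

lemma antipodal_extremes:
  fixes k :: "complex \<Rightarrow> complex" and F :: "complex \<Rightarrow> complex \<Rightarrow> complex"
  assumes cont: "continuous_on (cball 0 1) k"
    and lc: "\<And>a. norm a = 1 \<Longrightarrow> level_connected (F a)"
    and eq: "\<And>a z. norm a = 1 \<Longrightarrow> z \<in> ball 0 1 \<Longrightarrow> Re (F a z) = Re (a * k z)"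
    and nc: "\<And>a c. norm a = 1 \<Longrightarrow> \<exists>w\<in>sphere 0 1. Re (a * k w) \<noteq> c"
  obtains a \<zeta> where "norm a = 1" "norm \<zeta> = 1"
    "\<And>w. norm w = 1 \<Longrightarrow> Re (a * k w) \<le> Re (a * k \<zeta>) \<and> Re (a * k (- \<zeta>)) \<le> Re (a * k w)"
proof (rule ccontr)
  assume no: "\<not> thesis"
  note thesisI = that
  \<comment> \<open>The minimum points of \<open>Re (a * k w)\<close> are the maximum points for
    \<open>- a\<close>, so one family of sets covers both.\<close>
  define Z where "Z = (\<lambda>a. {\<zeta> \<in> sphere 0 1. \<forall>w\<in>sphere 0 1. Re (a * k w) \<le> Re (a * k \<zeta>)})"
  have contU: "continuous_on (cball 0 1) (\<lambda>z. Re (a * k z))" for a by (intro continuous_intros cont)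
  have conn: "connected (Z a)" if "norm a = 1" for a
    unfolding Z_def using argmax_connected[OF lc[OF that] contU] eq[OF that] by blast
  have ne: "Z a \<noteq> {}" for a
  proof -
    have "continuous_on (sphere 0 1) (\<lambda>z. Re (a * k z))"
      using contU by (rule continuous_on_subset) auto
    then show ?thesis
      using continuous_attains_sup[of "sphere 0 1" "\<lambda>z. Re (a * k z)"] by (force simp: Z_def)
  qed
  have anti: "- x \<notin> Z (- a)" if ax: "norm a = 1" "x \<in> Z a" for a x
  proof
    assume mx: "- x \<in> Z (- a)"
    have "Re (a * k w) \<le> Re (a * k x) \<and> Re (a * k (- x)) \<le> Re (a * k w)" if "norm w = 1" for w
    proof
      show "Re (a * k w) \<le> Re (a * k x)"
        using ax(2) that unfolding Z_def mem_Collect_eq by (metis mem_sphere_0)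
      have "Re (- a * k w) \<le> Re (- a * k (- x))"
        using mx that unfolding Z_def mem_Collect_eq by (metis mem_sphere_0)
      then show "Re (a * k (- x)) \<le> Re (a * k w)" by simp
    qed
    moreover have "norm x = 1" using ax(2) by (simp add: Z_def)
    ultimately show False using no thesisI[OF ax(1)] by blast
  qed
  have disj: "x \<notin> Z (- a)" if "norm a = 1" "x \<in> Z a" for a x
  proof
    assume "x \<in> Z (- a)"
    then have "Re (a * k w) = Re (a * k x)" if "w \<in> sphere 0 1" for w
      using \<open>x \<in> Z a\<close> that by (force simp: Z_def)
    then show False using nc[OF \<open>norm a = 1\<close>, of "Re (a * k x)"] by blast
  qed
  \<comment> \<open>A real product of unimodular numbers is 1 or -1. Here \<open>y = x\<close> would
    make \<open>Re (a * k w)\<close> constant on the circle, and \<open>y = - x\<close> is the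
    antipodal pair assumed not to exist.\<close>
  have im0: "Im (y * cnj x) \<noteq> 0" if "norm a = 1" "x \<in> Z a" "y \<in> Z (- a)" for a x y
  proof
    assume "Im (y * cnj x) = 0"
    moreover have n: "norm x = 1" "norm y = 1" using that by (auto simp: Z_def)
    ultimately have "y * cnj x = 1 \<or> y * cnj x = - 1"
      using cmod_eq_Re[of "y * cnj x"] by (auto simp: norm_mult complex_eq_iff abs_if split: if_splits)
    then have "(y * cnj x) * x = x \<or> (y * cnj x) * x = - x" by auto
    moreover have "(y * cnj x) * x = y" using n complex_norm_square[of x] by (simp add: mult.assoc mult.commute)
    ultimately have "y = x \<or> y = - x" by simp
    then show False using anti disj that by blast
  qed
  define P where "P = (\<lambda>t. \<forall>x\<in>Z (cis t). \<forall>y\<in>Z (- cis t). Im (y * cnj x) > 0)"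
  have dich: "P t" if pos: "x \<in> Z (cis t)" "y \<in> Z (- cis t)" "Im (y * cnj x) > 0" for t x y
    unfolding P_def
  proof (intro ballI)
    fix x' y' assume xy': "x' \<in> Z (cis t)" "y' \<in> Z (- cis t)"
    define S where "S = (\<lambda>p. Im (snd p * cnj (fst p))) ` (Z (cis t) \<times> Z (- cis t))"
    have "connected S"
      unfolding S_def using conn
      by (intro connected_continuous_image connected_Times continuous_intros) auto
    moreover have "Im (y * cnj x) \<in> S" "Im (y' * cnj x') \<in> S"
      using pos xy' by (force simp: S_def)+
    moreover have "0 \<notin> S" using im0[of "cis t"] by (auto simp: S_def simp del: times_complex.sel) 
    ultimately have "\<not> Im (y' * cnj x') \<le> 0"
      using connectedD_interval[of S "Im (y' * cnj x')" "Im (y * cnj x)" 0] pos(3) by auto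
    then show "Im (y' * cnj x') > 0" by simp
  qed
  have shift: "P (t + pi) \<longleftrightarrow> \<not> P t" for t
  proof -
    have cs: "cis (t + pi) = - cis t" by (simp add: cis_mult[symmetric])
    obtain x y where xy: "x \<in> Z (cis t)" "y \<in> Z (- cis t)" using ne by blast
    have sw: "Im (x * cnj y) = - Im (y * cnj x)" by simp
    show ?thesis
    proof (cases "Im (y * cnj x) > 0")
      case True
      then have "P t" using dich xy by blast
      moreover have "\<not> P (t + pi)" using True xy sw unfolding P_def cs by (force simp del: times_complex.sel)
      ultimately show ?thesis by simp
    next
      case False
      then have "\<not> P t" using xy by (auto simp: P_def)
      have "Im (y * cnj x) < 0" using False im0[OF norm_cis xy] by linarith
      then have "Im (x * cnj y) > 0" using sw by linarith
      then have "P (t + pi)" using xy by (intro dich[of y _ x]) (simp_all only: cs minus_minus)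
      then show ?thesis using \<open>\<not> P t\<close> by simp
    qed
  qed
  \<comment> \<open>Extreme points for a convergent sequence of angles have a convergent
    subsequence, whose limit is extreme for the limit angle. The limiting inequality is weak, and
    \<open>im0\<close> makes it strict.\<close>
  have "closed {t. P t}"
    unfolding closed_sequential_limits
  proof (intro allI impI)
    fix t :: "nat \<Rightarrow> real" and l assume *: "(\<forall>n. t n \<in> {t. P t}) \<and> t \<longlonglongrightarrow> l"
    have "\<forall>n. \<exists>p. fst p \<in> Z (cis (t n)) \<and> snd p \<in> Z (- cis (t n))" using ne by (metis ex_in_conv fst_conv snd_conv)
    then obtain p where p: "\<And>n. fst (p n) \<in> Z (cis (t n))" "\<And>n. snd (p n) \<in> Z (- cis (t n))" by metis
    have "seq_compact (sphere (0::complex) 1 \<times> sphere (0::complex) 1)"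
      by (intro compact_imp_seq_compact compact_Times) auto
    moreover have "\<forall>n. p n \<in> sphere 0 1 \<times> sphere 0 1" using p by (auto simp: Z_def mem_Times_iff)
    ultimately obtain q r where q: "q \<in> sphere 0 1 \<times> sphere 0 1" "strict_mono (r :: nat \<Rightarrow> nat)" "(p \<circ> r) \<longlonglongrightarrow> q"
      unfolding seq_compact_def by metis
    have lf: "(\<lambda>n. fst (p (r n))) \<longlonglongrightarrow> fst q" and ls: "(\<lambda>n. snd (p (r n))) \<longlonglongrightarrow> snd q"
      using tendsto_fst[OF q(3)] tendsto_snd[OF q(3)] by (simp_all add: o_def)
    have tr: "(\<lambda>n. t (r n)) \<longlonglongrightarrow> l"
      using LIMSEQ_subseq_LIMSEQ[OF conjunct2[OF *] q(2)] by (simp add: o_def)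
    have lc: "(\<lambda>n. cis (t (r n))) \<longlonglongrightarrow> cis l"
      using continuous_on_tendsto_compose[OF _ tr, of UNIV cis] by (simp add: continuous_on_cis continuous_on_id)
    have Zlim: "x \<in> Z a" if lim: "a' \<longlonglongrightarrow> a" "x' \<longlonglongrightarrow> x" and x': "\<And>n. x' n \<in> Z (a' n)" "x \<in> sphere 0 1"
      for a' x' :: "nat \<Rightarrow> complex" and a x
      unfolding Z_def
    proof (intro CollectI conjI ballI)
      have k': "(\<lambda>n. k (x' n)) \<longlonglongrightarrow> k x"
        by (rule continuous_on_tendsto_compose[OF cont lim(2)]) (use x' in \<open>auto simp: Z_def\<close>)
      fix w :: complex assume w: "w \<in> sphere 0 1"
      have "(\<lambda>n. Re (a' n * k w)) \<longlonglongrightarrow> Re (a * k w)" by (intro tendsto_intros lim)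
      moreover have "(\<lambda>n. Re (a' n * k (x' n))) \<longlonglongrightarrow> Re (a * k x)" by (intro tendsto_intros lim k')
      moreover have "Re (a' n * k w) \<le> Re (a' n * k (x' n))" for n
        using x'(1)[of n] w unfolding Z_def by blast
      ultimately show "Re (a * k w) \<le> Re (a * k x)" by (meson LIMSEQ_le)
    qed (rule x')
    have "fst q \<in> Z (cis l)" "snd q \<in> Z (- cis l)"
      by (rule Zlim[OF lc lf]; use p q in auto) (rule Zlim[OF tendsto_minus[OF lc] ls]; use p q in auto)
    moreover have "Im (snd q * cnj (fst q)) \<ge> 0"
    proof (rule LIMSEQ_le_const)
      show "(\<lambda>n. Im (snd (p (r n)) * cnj (fst (p (r n))))) \<longlonglongrightarrow> Im (snd q * cnj (fst q))"
        by (intro tendsto_intros lf ls)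
      have "P (t (r n))" for n using * by auto
      then show "\<exists>N. \<forall>n\<ge>N. 0 \<le> Im (snd (p (r n)) * cnj (fst (p (r n))))"
        using p unfolding P_def by (meson less_imp_le)
    qed
    ultimately show "l \<in> {t. P t}"
      using im0[OF norm_cis, of "fst q" l "snd q"] dich[of "fst q" l "snd q"] by force
  qed
  moreover have "closed {t. \<not> P t}"
  proof -
    \<comment> \<open>Translation by \<open>pi\<close> exchanges the two sets, so both are closed
      and nonempty, against the connectedness of the line.\<close>
    have "{t. \<not> P t} = (\<lambda>t. t + pi) -` {t. P t}" using shift by auto
    then show ?thesis
      using \<open>closed {t. P t}\<close> by (simp only:) (intro continuous_closed_vimage continuous_intros)
  qed
  moreover have "{t. P t} \<noteq> {}" "{t. \<not> P t} \<noteq> {}" using shift[of 0] by (cases "P 0"; auto)+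
  ultimately show False
    using connected_UNIV[where 'a=real] unfolding connected_closed
    by (metis (mono_tags, lifting) Collect_neg_eq Compl_partition Compl_disjoint inf_top.right_neutral order_refl Int_UNIV_right)
qed

lemma convex_flow_of_regular:
  fixes f \<phi> :: "complex \<Rightarrow> complex" and F :: "complex \<Rightarrow> complex \<Rightarrow> complex"
  assumes hol: "\<phi> holomorphic_on ball 0 1" and im: "\<phi> ` ball 0 1 \<subseteq> K" and "compact K"
    and f: "continuous_on K f" "inj_on f K"
    and lc: "\<And>a. norm a = 1 \<Longrightarrow> level_connected (F a)"
    and eq: "\<And>a z. norm a = 1 \<Longrightarrow> z \<in> ball 0 1 \<Longrightarrow> Re (F a z) = Re (a * f (\<phi> z))"
    and nc: "\<And>a c. norm a = 1 \<Longrightarrow> \<exists>z\<in>ball 0 1. Re (a * f (\<phi> z)) \<noteq> c"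
  obtains a P where "norm a = 1" "norm P = 1"
    "\<And>s z. 0 < s \<Longrightarrow> s < (1::real) \<Longrightarrow> z \<in> ball 0 1 \<Longrightarrow>
       Re (a * f (\<phi> (P * z))) \<le> Re (a * f (\<phi> (P * ((z + s) / (1 + s * z)))))"
proof -
  \<comment> \<open>The directions 1 and \<open>- \<i>\<close> supply the real and the imaginary
    part of \<open>f \<circ> \<phi>\<close>, as needed for its side limits.\<close>
  have "Re (F 1 z) = Re (f (\<phi> z))" "Re (F (- \<i>) z) = Im (f (\<phi> z))" if "z \<in> ball 0 1" for z
    using eq[of 1 z] eq[of "- \<i>" z] that by auto
  then obtain \<psi> where \<psi>: "continuous_on (cball 0 1) \<psi>" "\<And>z. z \<in> ball 0 1 \<Longrightarrow> \<psi> z = \<phi> z" "\<psi> ` cball 0 1 \<subseteq> K"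
    using conformal_extension[OF hol im \<open>compact K\<close> f lc[of 1] lc[of "- \<i>"]] by auto
  define k where "k = (\<lambda>z. f (\<psi> z))"
  have contk: "continuous_on (cball 0 1) k"
    unfolding k_def by (rule continuous_on_compose2[OF f(1) \<psi>(1) \<psi>(3)])
  have keq: "Re (F a z) = Re (a * k z)" if "norm a = 1" "z \<in> ball 0 1" for a z
    using eq[OF that] \<psi>(2)[OF that(2)] by (simp add: k_def)
  \<comment> \<open>A constant boundary value of \<open>Re (F a z)\<close> would force the same
    constant in the disc, by the maximum principle for \<open>F a\<close> and its negative.\<close>
  have nck: "\<exists>w\<in>sphere 0 1. Re (a * k w) \<noteq> c" if a: "norm a = 1" for a c
  proof (rule ccontr)
    assume "\<not> ?thesis"
    then have con: "Re (a * k w) = c" if "w \<in> sphere 0 1" for w using that by blast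
    have holF: "F a holomorphic_on ball 0 1" using lc[OF a] by (simp add: level_connected_def)
    have near: "\<exists>d>0. \<forall>z\<in>ball 0 1 \<inter> ball x d. \<bar>Re (F a z) - c\<bar> < e"
      if x: "x \<in> frontier (ball 0 1)" and "e > 0" for x :: complex and e :: real
    proof -
      have xs: "x \<in> sphere 0 1" "x \<in> cball 0 1" using x by (auto simp: frontier_ball)
      have "continuous_on (cball 0 1) (\<lambda>z. Re (a * k z))" by (intro continuous_intros contk)
      then obtain d where "d > 0" "\<And>z. z \<in> cball 0 1 \<Longrightarrow> dist z x < d \<Longrightarrow> dist (Re (a * k z)) (Re (a * k x)) < e"
        using xs(2) \<open>e > 0\<close> unfolding continuous_on_iff by metis
      then show ?thesis using con[OF xs(1)] keq[OF a]
        by (intro exI[of _ d]) (auto simp: dist_real_def dist_commute simp del: times_complex.sel)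
    qed
    have near': "\<exists>d>0. \<forall>z\<in>ball 0 1 \<inter> ball x d. Re (F a z) < c + e"
      "\<exists>d>0. \<forall>z\<in>ball 0 1 \<inter> ball x d. Re (- F a z) < - c + e"
      if xe: "x \<in> frontier (ball 0 1)" "e > 0" for x :: complex and e :: real
    proof -
      obtain d where d: "d > 0" "\<And>z. z \<in> ball 0 1 \<inter> ball x d \<Longrightarrow> \<bar>Re (F a z) - c\<bar> < e"
        using near[OF xe] by blast
      have "Re (F a z) < c + e" "Re (- F a z) < - c + e" if "z \<in> ball 0 1 \<inter> ball x d" for z
        using d(2)[OF that] unfolding abs_less_iff by simp_all
      then show "\<exists>d>0. \<forall>z\<in>ball 0 1 \<inter> ball x d. Re (F a z) < c + e"
        "\<exists>d>0. \<forall>z\<in>ball 0 1 \<inter> ball x d. Re (- F a z) < - c + e"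
        using d(1) by blast+
    qed
    have "Re (F a z) = c" if z: "z \<in> ball 0 1" for z
    proof (rule antisym)
      show "Re (F a z) \<le> c"
        by (rule maximum_principle_Re[OF open_ball bounded_ball holF near'(1) z])
      have "Re (- F a z) \<le> - c"
        by (rule maximum_principle_Re[OF open_ball bounded_ball holomorphic_on_minus[OF holF] near'(2) z])
      then show "c \<le> Re (F a z)" by simp
    qed
    then show False using nc[OF a, of c] eq[OF a] by metis
  qed
  obtain a P where aP: "norm a = 1" "norm P = 1"
    "\<And>w. norm w = 1 \<Longrightarrow> Re (a * k w) \<le> Re (a * k P) \<and> Re (a * k (- P)) \<le> Re (a * k w)"
    using antipodal_extremes[OF contk lc keq nck] by blast
  show ?thesis
  proof (rule that[OF aP(1,2)])
    fix s :: real and z :: complex assume s: "0 < s" "s < 1" and z: "z \<in> ball 0 1"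
    have PD: "P * z \<in> ball 0 1" if "z \<in> ball 0 1" for z using that aP(2) by (simp add: norm_mult)
    have "Re (a * k (P * z)) \<le> Re (a * k (P * ((z + s) / (1 + s * z))))"
    proof (rule hyperbolic_flow_increases[OF level_connected_rotate[OF lc[OF aP(1)] aP(2)] _ _ _ _ s z])
      show "continuous_on (cball 0 1) (\<lambda>z. Re (a * k (P * z)))"
        by (intro continuous_intros continuous_on_compose2[OF contk]) (auto simp: norm_mult aP)
    qed (use keq[OF aP(1) PD] aP in \<open>auto simp: norm_mult simp del: times_complex.sel\<close>)
    moreover have "(z + s) / (1 + s * z) \<in> ball 0 1" using flow_norm(2)[OF s, of z] z by simp
    ultimately show "Re (a * f (\<phi> (P * z))) \<le> Re (a * f (\<phi> (P * ((z + s) / (1 + s * z)))))"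
      unfolding k_def by (simp only: \<psi>(2)[OF PD[OF z]] \<psi>(2)[OF PD])
  qed
qed

section \<open>Convex harmonic maps\<close>

text \<open>The Moebius map \<open>(p - c) / (p + c)\<close> takes the right half-plane to the disc
  and \<open>c\<close> to 0, so the Schwarz lemma applies.\<close>

lemma positive_real_part_bound:
  fixes p :: "complex \<Rightarrow> complex"
  assumes hol: "p holomorphic_on ball 0 1" and pos: "\<And>z. z \<in> ball 0 1 \<Longrightarrow> Re (p z) > 0"
    and p0: "p 0 = of_real c" and z: "z \<in> ball 0 1"
  shows "norm (p z) \<le> c * (1 + norm z) / (1 - norm z)"
proof -
  have "c > 0" using pos[of 0] p0 by simp
  define w where "w = (\<lambda>z. (p z - c) / (p z + c))"
  have ne: "p z + c \<noteq> 0" if "z \<in> ball 0 1" for z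
    using pos[OF that] \<open>c > 0\<close> by (metis Re_complex_of_real add_pos_pos less_irrefl plus_complex.sel(1) zero_complex.sel(1))
  have "norm (w z) \<le> norm z"
  proof (rule Schwarz_Lemma(1))
    show "w holomorphic_on ball 0 1"
      unfolding w_def by (intro holomorphic_intros hol) (use ne in auto)
    show "w 0 = 0" by (simp add: w_def p0)
    show "norm (w z) < 1" if "norm z < 1" for z
    proof -
      have zb: "z \<in> ball 0 1" using that by simp
      have "(norm (p z - c))\<^sup>2 = (norm (p z + c))\<^sup>2 - 4 * c * Re (p z)"
        by (simp only: cmod_power2) (simp add: power2_eq_square algebra_simps)
      moreover have "4 * c * Re (p z) > 0" using pos[OF zb] \<open>c > 0\<close> by simp
      ultimately have "(norm (p z - c))\<^sup>2 < (norm (p z + c))\<^sup>2" by linarith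
      then have "norm (p z - c) < norm (p z + c)" by (rule power2_less_imp_less) simp
      then show ?thesis using ne[OF zb] by (simp add: w_def norm_divide)
    qed
  qed (use z in auto)
  then have "norm (p z - c) \<le> norm z * norm (p z + c)"
    using ne[OF z] by (simp add: w_def norm_divide divide_le_eq)
  also have "\<dots> \<le> norm z * (norm (p z) + c)"
    using norm_triangle_ineq[of "p z" "of_real c"] \<open>c > 0\<close> by (intro mult_left_mono) auto
  finally have "norm (p z) - c \<le> norm z * (norm (p z) + c)"
    using norm_triangle_ineq2[of "p z" "of_real c"] \<open>c > 0\<close> by simp
  then show ?thesis using z by (simp add: pos_le_divide_eq algebra_simps)
qed

text \<open>The bound \<open>r \<le> l\<close> limits how much \<phi> can contract at 0:
  \<open>z \<mapsto> u (r z)\<close> is a self-map of the disc fixing 0, so by the Schwarz lemma the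
  inverse of the map has derivative at most \<open>1 / r\<close> in modulus there. A rotation makes
  the derivative of \<phi> at 0 positive.\<close>

lemma Riemann_map_normalized:
  fixes G :: "complex set"
  assumes "open G" "simply_connected G" "ball 0 r \<subseteq> G" "G \<subseteq> ball 0 1" "0 < r"
  obtains \<phi> u where "\<phi> holomorphic_on ball 0 1" "u holomorphic_on G"
    "\<And>z. z \<in> ball 0 1 \<Longrightarrow> \<phi> z \<in> G \<and> u (\<phi> z) = z" "\<And>w. w \<in> G \<Longrightarrow> u w \<in> ball 0 1 \<and> \<phi> (u w) = w"
    "\<phi> 0 = 0" "\<exists>l. deriv \<phi> 0 = of_real l \<and> r \<le> l"
proof -
  have "0 \<in> G" using assms by auto
  moreover have "G \<noteq> UNIV" using assms(4) bounded_ball bounded_subset not_bounded_UNIV by metis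
  ultimately obtain u0 v0 where 0: "u0 holomorphic_on G" "v0 holomorphic_on ball 0 1"
      "\<And>z. z \<in> G \<Longrightarrow> u0 z \<in> ball 0 1 \<and> v0 (u0 z) = z" "\<And>z. z \<in> ball 0 1 \<Longrightarrow> v0 z \<in> G \<and> u0 (v0 z) = z"
    using Riemann_mapping_theorem[of G] assms(1,2) by blast
  define w0 where "w0 = u0 0"
  have w0: "norm w0 < 1" using 0(3)[OF \<open>0 \<in> G\<close>] by (simp add: w0_def)
  define M N where "M = Moebius_function 0 (- w0)" and "N = Moebius_function 0 w0"
  have MN: "M (N z) = z" "N (M z) = z" if "norm z < 1" for z
    using that w0 unfolding M_def N_def by (auto intro!: Moebius_function_compose)
  have MD: "norm (M z) < 1" "norm (N z) < 1" if "norm z < 1" for z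
    using that w0 unfolding M_def N_def by (auto intro!: Moebius_function_norm_lt_1)
  have holM: "M holomorphic_on ball 0 1" "N holomorphic_on ball 0 1"
    using w0 unfolding M_def N_def by (auto intro!: Moebius_function_holomorphic)
  define v u where "v = (\<lambda>z. v0 (M z))" and "u = (\<lambda>w. N (u0 w))"
  have v: "v holomorphic_on ball 0 1"
    unfolding v_def by (rule holomorphic_on_compose_gen[OF holM(1) 0(2), unfolded o_def]) (use MD in auto)
  have u: "u holomorphic_on G"
    unfolding u_def by (rule holomorphic_on_compose_gen[OF 0(1) holM(2), unfolded o_def]) (use 0(3) in auto)
  have vu: "v z \<in> G \<and> u (v z) = z" if "z \<in> ball 0 1" for z
    using that 0(4)[of "M z"] MD MN by (simp add: v_def u_def)
  have uv: "u w \<in> ball 0 1 \<and> v (u w) = w" if "w \<in> G" for w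
    using 0(3)[OF that] MD MN by (simp add: v_def u_def)
  have "M 0 = w0" by (simp add: M_def Moebius_function_simple)
  then have v00: "v 0 = 0" using 0(3)[OF \<open>0 \<in> G\<close>] by (simp add: v_def w0_def)
  then have u00: "u 0 = 0" using vu[of 0] by simp
  have r1: "norm (deriv v 0) \<ge> r"
  proof -
    define \<psi> where "\<psi> = (\<lambda>z. u (of_real r * z))"
    have rG: "of_real r * z \<in> G" if "norm z < 1" for z
    proof -
      have "norm (of_real r * z) < r" using that \<open>0 < r\<close> by (simp add: norm_mult)
      then show ?thesis using assms(3) by (auto simp: subset_iff)
    qed
    have hol\<psi>: "\<psi> holomorphic_on ball 0 1"
      unfolding \<psi>_def
      by (intro holomorphic_on_compose_gen[of "\<lambda>z. of_real r * z" _ u G, unfolded o_def] holomorphic_intros u)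
         (use rG in auto)
    have "norm (deriv \<psi> 0) \<le> 1"
    proof (rule Schwarz_Lemma(2)[OF hol\<psi>])
      show "\<psi> 0 = 0" by (simp add: \<psi>_def u00)
      show "norm (\<psi> z) < 1" if "norm z < 1" for z using uv[OF rG[OF that]] by (simp add: \<psi>_def)
    qed (rule zero_less_one[THEN le_less_trans[OF norm_zero[THEN eq_refl]]])
    have d\<psi>: "(\<psi> has_field_derivative deriv \<psi> 0) (at 0)"
      using hol\<psi> by (auto intro: holomorphic_derivI)
    have \<psi>0: "\<psi> 0 = 0" by (simp add: \<psi>_def u00)
    have dv: "(v has_field_derivative deriv v 0) (at (\<psi> 0))"
      using v \<psi>0 by (auto intro: holomorphic_derivI)
    have "((\<lambda>z. v (\<psi> z)) has_field_derivative deriv v 0 * deriv \<psi> 0) (at 0)"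
      using DERIV_chain2[OF dv d\<psi>] .
    moreover have "((\<lambda>z. v (\<psi> z)) has_field_derivative of_real r) (at 0)"
    proof (rule has_field_derivative_transform_within_open[of "\<lambda>z. of_real r * z" _ _ "ball 0 1"])
      show "((*) (complex_of_real r) has_field_derivative complex_of_real r) (at 0)"
        by (auto intro!: derivative_eq_intros)
      show "of_real r * z = v (\<psi> z)" if "z \<in> ball 0 1" for z
        using uv[OF rG[of z]] that by (simp add: \<psi>_def)
    qed auto
    ultimately have "deriv v 0 * deriv \<psi> 0 = of_real r" by (rule DERIV_unique)
    then have "r = norm (deriv v 0) * norm (deriv \<psi> 0)"
      using \<open>0 < r\<close> by (metis abs_of_pos norm_mult norm_of_real)
    also have "\<dots> \<le> norm (deriv v 0) * 1" using \<open>norm (deriv \<psi> 0) \<le> 1\<close> by (intro mult_left_mono) auto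
    finally show ?thesis by simp
  qed
  define e where "e = cnj (deriv v 0) / of_real (norm (deriv v 0))"
  have n0: "norm (deriv v 0) > 0" using r1 \<open>0 < r\<close> by linarith
  then have ne: "norm e = 1" by (simp add: e_def norm_divide)
  have ee: "cnj e * e = 1" "e * cnj e = 1" using ne complex_norm_square[of e] by (simp_all add: mult.commute)
  have de: "deriv v 0 * e = of_real (norm (deriv v 0))"
    using n0 complex_norm_square[of "deriv v 0"] by (simp add: e_def field_simps power2_eq_square)
  define \<phi> where "\<phi> = (\<lambda>z. v (e * z))"
  define u' where "u' = (\<lambda>w. cnj e * u w)"
  show ?thesis
  proof (rule that[of \<phi> u'])
    show "\<phi> holomorphic_on ball 0 1"
      unfolding \<phi>_def
      by (intro holomorphic_on_compose_gen[of "\<lambda>z. e * z" _ v "ball 0 1", unfolded o_def] holomorphic_intros v)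
         (auto simp: norm_mult ne)
    show "u' holomorphic_on G" unfolding u'_def by (intro holomorphic_intros u)
    show "\<phi> z \<in> G \<and> u' (\<phi> z) = z" if "z \<in> ball 0 1" for z
      using vu[of "e * z"] that ne ee by (simp add: \<phi>_def u'_def norm_mult mult.assoc[symmetric])
    show "u' w \<in> ball 0 1 \<and> \<phi> (u' w) = w" if "w \<in> G" for w
      using uv[OF that] ne ee by (simp add: \<phi>_def u'_def norm_mult mult.assoc[symmetric])
    show "\<phi> 0 = 0" by (simp add: \<phi>_def v00)
    have "(v has_field_derivative deriv v 0) (at (e * 0))" using v by (auto intro: holomorphic_derivI)
    moreover have "((\<lambda>z. e * z) has_field_derivative e) (at 0)" by (auto intro!: derivative_eq_intros)
    ultimately have "(\<phi> has_field_derivative deriv v 0 * e) (at 0)"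
      unfolding \<phi>_def by (rule DERIV_chain2)
    then show "\<exists>l. deriv \<phi> 0 = of_real l \<and> r \<le> l"
      using de r1 by (metis DERIV_imp_deriv)
  qed
qed

text \<open>Write \<open>\<phi> z = z * k z\<close> with \<open>|k| \<le> 1\<close>. Then
  \<open>1 - k\<close> has nonnegative real part and is small at 0, hence small on compact subsets
  of the disc.\<close>

lemma near_identity:
  fixes \<phi> :: "complex \<Rightarrow> complex"
  assumes hol: "\<phi> holomorphic_on ball 0 1" and "\<phi> 0 = 0" and D: "\<And>z. z \<in> ball 0 1 \<Longrightarrow> norm (\<phi> z) < 1"
    and d: "deriv \<phi> 0 = of_real l" "r \<le> l" and "r < 1" and z: "z \<in> ball 0 1"
  shows "norm (\<phi> z - z) \<le> 4 * (1 - r) / (1 - norm z)"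
proof -
  obtain k where k: "k holomorphic_on ball 0 1" "\<And>z. norm z < 1 \<Longrightarrow> \<phi> z = z * k z" "deriv \<phi> 0 = k 0"
    using Schwarz3[OF hol \<open>\<phi> 0 = 0\<close>] by metis
  have D': "\<And>z. norm z < 1 \<Longrightarrow> norm (\<phi> z) < 1" using D by simp
  have k1: "norm (k z) \<le> 1" if "norm z < 1" for z
  proof (cases "z = 0")
    case True
    then show ?thesis using Schwarz_Lemma(2)[OF hol \<open>\<phi> 0 = 0\<close> D', of 0] k(3) by simp
  next
    case False
    then show ?thesis using Schwarz_Lemma(1)[OF hol \<open>\<phi> 0 = 0\<close> D' that] k(2)[OF that] by (simp add: norm_mult)
  qed
  \<comment> \<open>Adding \<open>1 - r\<close> makes the real part strictly positive even if
    \<open>k\<close> is constantly 1. The value at 0 is then at most \<open>2 * (1 - r)\<close>, and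
    \<open>1 + |z| \<le> 2\<close> gives the constant 4.\<close>
  define p where "p = (\<lambda>z. 1 - k z + of_real (1 - r))"
  have "norm (p z) \<le> ((1 - l) + (1 - r)) * (1 + norm z) / (1 - norm z)"
  proof (rule positive_real_part_bound[OF _ _ _ z])
    show "p holomorphic_on ball 0 1" unfolding p_def by (intro holomorphic_intros k)
    show "Re (p z) > 0" if "z \<in> ball 0 1" for z
      using k1[of z] complex_Re_le_cmod[of "k z"] that \<open>r < 1\<close> by (simp add: p_def)
    show "p 0 = of_real ((1 - l) + (1 - r))" using k(3) d(1) by (simp add: p_def)
  qed
  also have "\<dots> \<le> 2 * (1 - r) * 2 / (1 - norm z)"
    using z d(2) \<open>r < 1\<close> by (intro divide_right_mono mult_mono) auto
  finally have 1: "norm (p z) \<le> 4 * (1 - r) / (1 - norm z)" by simp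
  have "norm (1 - k z) \<le> norm (p z)"
  proof (rule power2_le_imp_le)
    have "Re (1 - k z) \<ge> 0" using k1[of z] complex_Re_le_cmod[of "k z"] z by simp
    then have "(Re (1 - k z))\<^sup>2 \<le> (Re (1 - k z) + (1 - r))\<^sup>2"
      using \<open>r < 1\<close> by (intro power_mono) auto
    then show "(norm (1 - k z))\<^sup>2 \<le> (norm (p z))\<^sup>2"
      unfolding cmod_power2 by (simp add: p_def)
  qed simp
  have "norm (\<phi> z - z) = norm z * norm (1 - k z)"
    using k(2)[of z] z by (simp add: norm_mult[symmetric] right_diff_distrib norm_minus_commute)
  also have "\<dots> \<le> 1 * norm (1 - k z)" using z by (intro mult_right_mono) auto
  finally show ?thesis using \<open>norm (1 - k z) \<le> norm (p z)\<close> 1 by simp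
qed

text \<open>The compact convex set \<open>C\<close> is the hull of the image of
  \<open>cball 0 r\<close>; convexity of the whole image keeps it inside. Invariance of domain puts
  the image of the open disc of radius \<open>r\<close> into its interior, so the preimage
  \<open>G\<close> contains \<open>ball 0 r\<close> and its Riemann map is close to the
  identity.\<close>

lemma convex_flow_approx:
  fixes h g :: "complex \<Rightarrow> complex"
  defines "f \<equiv> \<lambda>z. h z + cnj (g z)"
  assumes hol: "h holomorphic_on ball 0 1" "g holomorphic_on ball 0 1"
    and inj: "inj_on f (ball 0 1)" and conv: "convex (f ` ball 0 1)" and r: "0 < r" "r < 1"
  obtains a P :: complex and \<phi> :: "complex \<Rightarrow> complex" where "norm a = 1" "norm P = 1"
    "\<And>z. z \<in> ball 0 1 \<Longrightarrow> \<phi> z \<in> ball 0 1 \<and> norm (\<phi> z - z) \<le> 4 * (1 - r) / (1 - norm z)"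
    "\<And>s z. 0 < s \<Longrightarrow> s < (1::real) \<Longrightarrow> z \<in> ball 0 1 \<Longrightarrow>
       Re (a * f (\<phi> (P * z))) \<le> Re (a * f (\<phi> (P * ((z + s) / (1 + s * z)))))"
proof -
  have contf: "continuous_on (ball 0 1) f"
    unfolding f_def using hol by (intro continuous_intros holomorphic_on_imp_continuous_on)
  obtain j where "homeomorphism (ball 0 1) (f ` ball 0 1) f j"
    using invariance_of_domain_homeomorphism[OF open_ball contf _ inj] by auto
  then have j: "continuous_on (f ` ball 0 1) j" "\<And>z. z \<in> ball 0 1 \<Longrightarrow> j (f z) = z"
    "\<And>w. w \<in> f ` ball 0 1 \<Longrightarrow> j w \<in> ball 0 1 \<and> f (j w) = w"
    by (auto simp: homeomorphism_def)
  define C where "C = convex hull (f ` cball 0 r)"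
  have cb: "cball 0 r \<subseteq> ball (0::complex) 1" using r by auto
  have "compact (f ` cball 0 r)"
    using contf cb by (intro compact_continuous_image) (auto intro: continuous_on_subset)
  then have "compact C" unfolding C_def by (rule compact_convex_hull)
  have CD: "C \<subseteq> f ` ball 0 1"
    unfolding C_def using cb conv by (intro hull_minimal) auto
  define \<Omega> where "\<Omega> = interior C"
  have \<Omega>: "open \<Omega>" "convex \<Omega>" "\<Omega> \<subseteq> C" "\<Omega> \<subseteq> f ` ball 0 1"
    using CD interior_subset[of C] by (auto simp: \<Omega>_def C_def convex_interior)
  have "f ` ball 0 r \<subseteq> \<Omega>"
    unfolding \<Omega>_def
  proof (rule interior_maximal)
    show "f ` ball 0 r \<subseteq> C" unfolding C_def by (rule order_trans[OF _ hull_subset]) auto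
    have "ball 0 r \<subseteq> ball (0::complex) 1" using r by auto
    then show "open (f ` ball 0 r)"
      using contf inj by (intro invariance_of_domain) (auto intro: continuous_on_subset inj_on_subset)
  qed
  define K where "K = j ` C"
  define G where "G = j ` \<Omega>"
  have "compact K"
    unfolding K_def using j(1) CD \<open>compact C\<close> by (intro compact_continuous_image) (auto intro: continuous_on_subset)
  have KD: "K \<subseteq> ball 0 1" using j(3) CD by (auto simp: K_def)
  have "G \<subseteq> K" using \<Omega>(3) by (auto simp: G_def K_def)
  have GD: "G \<subseteq> ball 0 1" using \<open>G \<subseteq> K\<close> KD by auto
  have fG: "f w \<in> \<Omega> \<and> j (f w) = w" if "w \<in> G" for w
    using that j(3) \<Omega>(4) by (auto simp: G_def)
  have jO: "j w \<in> G \<and> f (j w) = w" if "w \<in> \<Omega>" for w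
    using that j(3) \<Omega>(4) by (auto simp: G_def)
  have "G = ball 0 1 \<inter> f -` \<Omega>"
    using fG GD j(2) by (force simp: G_def)
  then have "open G" using continuous_open_preimage[OF contf open_ball \<Omega>(1)] by simp
  have "\<Omega> homeomorphic G"
  proof (rule homeomorphicI[of j _ _ f])
    show "j ` \<Omega> = G" by (simp add: G_def)
    show "f ` G = \<Omega>" using fG jO by (force simp: image_iff)
    show "continuous_on \<Omega> j" using j(1) \<Omega>(4) by (rule continuous_on_subset)
    show "continuous_on G f" using contf GD by (rule continuous_on_subset)
  qed (use jO fG in auto)
  then have "simply_connected G"
    using convex_imp_simply_connected[OF \<Omega>(2)] homeomorphic_simply_connected_eq by blast
  have "ball 0 r \<subseteq> G"
  proof
    fix z :: complex assume z: "z \<in> ball 0 r"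
    then have "f z \<in> \<Omega>" using \<open>f ` ball 0 r \<subseteq> \<Omega>\<close> by blast
    moreover have "j (f z) = z" using z r by (intro j(2)) auto
    ultimately show "z \<in> G" unfolding G_def by (metis imageI)
  qed
  obtain \<phi> u where \<phi>: "\<phi> holomorphic_on ball 0 1" "u holomorphic_on G"
    "\<And>z. z \<in> ball 0 1 \<Longrightarrow> \<phi> z \<in> G \<and> u (\<phi> z) = z" "\<And>w. w \<in> G \<Longrightarrow> u w \<in> ball 0 1 \<and> \<phi> (u w) = w"
    "\<phi> 0 = 0" "\<exists>l. deriv \<phi> 0 = of_real l \<and> r \<le> l"
    using Riemann_map_normalized[OF \<open>open G\<close> \<open>simply_connected G\<close> \<open>ball 0 r \<subseteq> G\<close> GD r(1)] by blast
  have \<phi>D: "\<phi> z \<in> ball 0 1" if "z \<in> ball 0 1" for z using \<phi>(3)[OF that] GD by blast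
  \<comment> \<open>Holomorphic, with the same real part as \<open>a * f (\<phi> z)\<close>:
    conjugating the summand \<open>a * cnj (g (\<phi> z))\<close> does not change its real
    part.\<close>
  define F where "F = (\<lambda>a z. a * h (\<phi> z) + cnj a * g (\<phi> z))"
  have ReF: "Re (F a z) = Re (a * f (\<phi> z))" for a z by (simp add: F_def f_def algebra_simps)
  obtain B where B: "\<And>w. w \<in> C \<Longrightarrow> norm w \<le> B"
    using compact_imp_bounded[OF \<open>compact C\<close>] by (meson bounded_iff)
  have lc: "level_connected (F a)" if a: "norm a = 1" for a
    unfolding level_connected_def
  proof (intro conjI allI)
    show "F a holomorphic_on ball 0 1"
      unfolding F_def
      by (intro holomorphic_intros holomorphic_on_compose_gen[OF \<phi>(1) hol(1), unfolded o_def]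
          holomorphic_on_compose_gen[OF \<phi>(1) hol(2), unfolded o_def]) (use \<phi>D in auto)
    have "\<bar>Re (F a z)\<bar> \<le> B" if z: "z \<in> ball 0 1" for z
    proof -
      have "f (\<phi> z) \<in> C" using fG \<phi>(3)[OF z] \<Omega>(3) by blast
      then have "norm (a * f (\<phi> z)) \<le> B" using B a by (simp add: norm_mult)
      then show ?thesis unfolding ReF using abs_Re_le_cmod order_trans by blast
    qed
    then show "\<exists>B. \<forall>z\<in>ball 0 1. \<bar>Re (F a z)\<bar> \<le> B" by blast
    \<comment> \<open>Here convexity becomes connectedness: the level set is the image, under the
      continuous map \<open>u \<circ> j\<close>, of the part of \<Omega> in a half-plane.\<close>
    have conn: "connected {z \<in> ball 0 1. Re (F a z) \<in> S}" if "convex (\<Omega> \<inter> {w. Re (a * w) \<in> S})" for S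
    proof -
      have "{z \<in> ball 0 1. Re (F a z) \<in> S} = (\<lambda>w. u (j w)) ` (\<Omega> \<inter> {w. Re (a * w) \<in> S})"
      proof (intro equalityI subsetI)
        fix z assume "z \<in> {z \<in> ball 0 1. Re (F a z) \<in> S}"
        then have z: "z \<in> ball 0 1" "Re (a * f (\<phi> z)) \<in> S" by (auto simp: ReF)
        moreover have "z = u (j (f (\<phi> z)))" "f (\<phi> z) \<in> \<Omega>" using \<phi>(3)[OF z(1)] fG by auto
        ultimately show "z \<in> (\<lambda>w. u (j w)) ` (\<Omega> \<inter> {w. Re (a * w) \<in> S})" by blast
      next
        fix z assume "z \<in> (\<lambda>w. u (j w)) ` (\<Omega> \<inter> {w. Re (a * w) \<in> S})"
        then obtain w where w: "w \<in> \<Omega>" "Re (a * w) \<in> S" "z = u (j w)" by blast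
        then have "z \<in> ball 0 1" "f (\<phi> z) = w" using jO[OF w(1)] \<phi>(4) by auto
        then show "z \<in> {z \<in> ball 0 1. Re (F a z) \<in> S}" using w by (simp only: ReF mem_Collect_eq)
      qed
      moreover have "continuous_on (\<Omega> \<inter> {w. Re (a * w) \<in> S}) (\<lambda>w. u (j w))"
      proof (rule continuous_on_compose2[OF holomorphic_on_imp_continuous_on[OF \<phi>(2)]])
        show "continuous_on (\<Omega> \<inter> {w. Re (a * w) \<in> S}) j"
          using j(1) \<Omega>(4) by (auto intro: continuous_on_subset)
        show "j ` (\<Omega> \<inter> {w. Re (a * w) \<in> S}) \<subseteq> G" by (auto simp: G_def)
      qed
      ultimately show ?thesis using connected_continuous_image convex_connected[OF that] by metis
    qed
    have Re_inner: "Re (a * w) = cnj a \<bullet> w" for w by (simp add: inner_complex_def)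
    have "convex {w. Re (a * w) > c}" "convex {w. Re (a * w) < c}" for c
      unfolding Re_inner by (rule convex_halfspace_gt, rule convex_halfspace_lt)
    then show "connected {z \<in> ball 0 1. Re (F a z) > c}" "connected {z \<in> ball 0 1. Re (F a z) < c}" for c
      using conn[of "{c<..}"] conn[of "{..<c}"] \<Omega>(2) by (simp_all add: convex_Int del: times_complex.sel)
  qed
  have nc: "\<exists>z\<in>ball 0 1. Re (a * f (\<phi> z)) \<noteq> c" if a: "norm a = 1" for a c
  proof (rule ccontr)
    assume "\<not> ?thesis"
    then have con: "Re (a * f (\<phi> z)) = c" if "z \<in> ball 0 1" for z using that by blast
    have con': "Re (a * w) = c" if "w \<in> \<Omega>" for w
      using con[of "u (j w)"] jO[OF that] \<phi>(4)[of "j w"] by simp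
    have "f 0 \<in> \<Omega>" using \<open>f ` ball 0 r \<subseteq> \<Omega>\<close> r by auto
    then obtain d where d: "d > 0" "cball (f 0) d \<subseteq> \<Omega>" using \<Omega>(1) open_contains_cball by blast
    \<comment> \<open>Moving from \<open>f 0\<close> by \<open>d\<close> in the direction
      \<open>cnj a\<close> raises \<open>Re (a * w)\<close> by exactly \<open>d\<close>.\<close>
    have "f 0 + of_real d * cnj a \<in> \<Omega>"
      using d a by (intro subsetD[OF d(2)]) (simp add: dist_norm norm_mult)
    then have "Re (a * (f 0 + of_real d * cnj a)) = c" by (rule con')
    moreover have "a * (f 0 + of_real d * cnj a) = a * f 0 + of_real d"
      using a complex_norm_square[of a] by (simp add: distrib_left mult.left_commute)
    moreover have "Re (a * f 0) = c" using con' \<open>f 0 \<in> \<Omega>\<close> by blast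
    ultimately show False using d(1) by simp
  qed
  have im: "\<phi> ` ball 0 1 \<subseteq> K" using \<phi>(3) \<open>G \<subseteq> K\<close> by blast
  have fK: "continuous_on K f" "inj_on f K"
    using contf inj KD by (auto intro: continuous_on_subset inj_on_subset)
  obtain a P where aP: "norm a = 1" "norm P = 1"
    "\<And>s z. 0 < s \<Longrightarrow> s < (1::real) \<Longrightarrow> z \<in> ball 0 1 \<Longrightarrow>
       Re (a * f (\<phi> (P * z))) \<le> Re (a * f (\<phi> (P * ((z + s) / (1 + s * z)))))"
    using convex_flow_of_regular[OF \<phi>(1) im \<open>compact K\<close> fK lc ReF nc] by metis
  show ?thesis
  proof (rule that[OF aP(1,2) _ aP(3)])
    fix z :: complex assume z: "z \<in> ball 0 1"
    obtain l where "deriv \<phi> 0 = of_real l" "r \<le> l" using \<phi>(6) by blast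
    then show "\<phi> z \<in> ball 0 1 \<and> norm (\<phi> z - z) \<le> 4 * (1 - r) / (1 - norm z)"
      using near_identity[OF \<phi>(1,5) _ _ _ r(2) z] \<phi>D[OF z] \<phi>D by auto
  qed
qed

text \<open>This is the limit \<open>r \<rightarrow> 1\<close>. The unimodular pairs
  \<open>(a, P)\<close> have a convergent subsequence. The bound on \<open>|\<phi> z - z|\<close>
  depends only on \<open>|z|\<close>, so it can be used at the moving points
  \<open>P n * z\<close>.\<close>

lemma convex_harmonic_flow:
  fixes h g :: "complex \<Rightarrow> complex"
  defines "f \<equiv> \<lambda>z. h z + cnj (g z)"
  assumes hol: "h holomorphic_on ball 0 1" "g holomorphic_on ball 0 1"
    and inj: "inj_on f (ball 0 1)" and conv: "convex (f ` ball 0 1)"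
  obtains a P :: complex where "norm a = 1" "norm P = 1"
    "\<And>s z. 0 < s \<Longrightarrow> s < (1::real) \<Longrightarrow> z \<in> ball 0 1 \<Longrightarrow>
       Re (a * f (P * z)) \<le> Re (a * f (P * ((z + s) / (1 + s * z))))"
proof -
  define r where "r = (\<lambda>n::nat. 1 - 1 / (real n + 2))"
  have r: "0 < r n" "r n < 1" for n by (simp_all add: r_def)
  define Q where "Q = (\<lambda>n (a :: complex) (P :: complex) \<phi>. norm a = 1 \<and> norm P = 1 \<and>
    (\<forall>z\<in>ball 0 1. \<phi> z \<in> ball 0 1 \<and> norm (\<phi> z - z) \<le> 4 * (1 - r n) / (1 - norm z)) \<and>
    (\<forall>s z. 0 < s \<longrightarrow> s < (1::real) \<longrightarrow> z \<in> ball 0 1 \<longrightarrow>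
       Re (a * f (\<phi> (P * z))) \<le> Re (a * f (\<phi> (P * ((z + s) / (1 + s * z)))))))"
  have "\<exists>a P \<phi>. Q n a P \<phi>" for n
  proof (rule convex_flow_approx[OF hol inj[unfolded f_def] conv[unfolded f_def] r[of n], folded f_def], goal_cases)
    case (1 a P \<phi>)
    have "Q n a P \<phi>"
      unfolding Q_def
    proof (intro conjI)
      show "norm a = 1" by (rule 1)
      show "norm P = 1" by (rule 1)
      show "\<forall>z\<in>ball 0 1. \<phi> z \<in> ball 0 1 \<and> norm (\<phi> z - z) \<le> 4 * (1 - r n) / (1 - norm z)"
        using 1(3) by (rule ballI)
      show "\<forall>s z. 0 < s \<longrightarrow> s < (1::real) \<longrightarrow> z \<in> ball 0 1 \<longrightarrow>
         Re (a * f (\<phi> (P * z))) \<le> Re (a * f (\<phi> (P * ((z + s) / (1 + s * z)))))"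
        unfolding f_def by (intro allI impI) (rule 1(4))
    qed
    then show ?case by blast
  qed
  then obtain a P \<phi> where "\<And>n. Q n (a n) (P n) (\<phi> n)" by metis
  note q = this[unfolded Q_def]
  note a = conjunct1[OF q] and P = conjunct1[OF conjunct2[OF q]]
    and \<phi> = bspec[OF conjunct1[OF conjunct2[OF conjunct2[OF q]]]]
    and flow = conjunct2[OF conjunct2[OF conjunct2[OF q]], rule_format]
  have "seq_compact (sphere (0::complex) 1 \<times> sphere (0::complex) 1)"
    by (intro compact_imp_seq_compact compact_Times) auto
  moreover have "\<forall>n. (\<lambda>n. (a n, P n)) n \<in> sphere 0 1 \<times> sphere 0 1" using a P by auto
  ultimately obtain q \<nu> where q: "q \<in> sphere 0 1 \<times> sphere 0 1" "strict_mono (\<nu> :: nat \<Rightarrow> nat)"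
      "((\<lambda>n. (a n, P n)) \<circ> \<nu>) \<longlonglongrightarrow> q"
    by (rule seq_compactE)
  have la: "(\<lambda>n. a (\<nu> n)) \<longlonglongrightarrow> fst q" and lP: "(\<lambda>n. P (\<nu> n)) \<longlonglongrightarrow> snd q"
    using tendsto_fst[OF q(3)] tendsto_snd[OF q(3)] by (simp_all add: o_def)
  have lr: "(\<lambda>n. 1 - r (\<nu> n)) \<longlonglongrightarrow> 0"
  proof -
    have "(\<lambda>n. 1 / (real n + 2)) \<longlonglongrightarrow> 0" by real_asymp
    from LIMSEQ_subseq_LIMSEQ[OF this q(2)] show ?thesis by (simp add: r_def o_def)
  qed
  have contf: "continuous_on (ball 0 1) f"
    unfolding f_def using hol by (intro continuous_intros holomorphic_on_imp_continuous_on)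
  have nq: "norm (fst q) = 1" "norm (snd q) = 1" using q(1) by auto
  have lf: "(\<lambda>n. f (\<phi> (\<nu> n) (P (\<nu> n) * z))) \<longlonglongrightarrow> f (snd q * z)" if z: "z \<in> ball 0 1" for z
  proof (rule continuous_on_tendsto_compose[OF contf])
    have b: "P n * z \<in> ball 0 1" for n using z P by (simp add: norm_mult)
    show "snd q * z \<in> ball 0 1" using z nq by (simp add: norm_mult)
    show "\<forall>\<^sub>F n in sequentially. \<phi> (\<nu> n) (P (\<nu> n) * z) \<in> ball 0 1" using \<phi>[OF b] by simp
    have "(\<lambda>n. \<phi> (\<nu> n) (P (\<nu> n) * z) - P (\<nu> n) * z) \<longlonglongrightarrow> 0"
    proof (rule Lim_null_comparison)
      show "\<forall>\<^sub>F n in sequentially. norm (\<phi> (\<nu> n) (P (\<nu> n) * z) - P (\<nu> n) * z) \<le> 4 * (1 - r (\<nu> n)) / (1 - norm z)"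
        using \<phi>[OF b] P by (simp add: norm_mult)
      show "(\<lambda>n. 4 * (1 - r (\<nu> n)) / (1 - norm z)) \<longlonglongrightarrow> 0"
        using tendsto_divide[OF tendsto_mult_left[OF lr, of 4] tendsto_const, of "1 - norm z"] z by simp
    qed
    moreover have "(\<lambda>n. P (\<nu> n) * z) \<longlonglongrightarrow> snd q * z" by (intro tendsto_intros lP)
    ultimately show "(\<lambda>n. \<phi> (\<nu> n) (P (\<nu> n) * z)) \<longlonglongrightarrow> snd q * z"
      using tendsto_add by fastforce
  qed
  show ?thesis
  proof (rule that[of "fst q" "snd q"])
    fix s :: real and z :: complex assume s: "0 < s" "s < 1" and z: "z \<in> ball 0 1"
    have Tz: "(z + s) / (1 + s * z) \<in> ball 0 1" using flow_norm(2)[OF s, of z] z by simp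
    show "Re (fst q * f (snd q * z)) \<le> Re (fst q * f (snd q * ((z + s) / (1 + s * z))))"
    proof (rule LIMSEQ_le)
      show "(\<lambda>n. Re (a (\<nu> n) * f (\<phi> (\<nu> n) (P (\<nu> n) * z)))) \<longlonglongrightarrow> Re (fst q * f (snd q * z))"
        by (intro tendsto_intros la lf z)
      show "(\<lambda>n. Re (a (\<nu> n) * f (\<phi> (\<nu> n) (P (\<nu> n) * ((z + s) / (1 + s * z)))))) \<longlonglongrightarrow>
          Re (fst q * f (snd q * ((z + s) / (1 + s * z))))"
        by (intro tendsto_Re tendsto_mult la lf Tz)
      show "\<exists>N. \<forall>n\<ge>N. Re (a (\<nu> n) * f (\<phi> (\<nu> n) (P (\<nu> n) * z))) \<le>
          Re (a (\<nu> n) * f (\<phi> (\<nu> n) (P (\<nu> n) * ((z + s) / (1 + s * z)))))"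
        using flow[OF s z] by blast
    qed
  qed (use nq in auto)
qed

section \<open>Coefficient bounds\<close>

lemma fps_expansion_eqI: "f has_fps_expansion F \<Longrightarrow> f has_fps_expansion (G :: complex fps) \<Longrightarrow> F = G"
  by (rule fps_ext) (simp add: fps_nth_fps_expansion)

lemma circle_coeff_integral:
  fixes p :: "complex \<Rightarrow> complex"
  assumes hol: "p holomorphic_on ball 0 1" and r: "0 < r" "r < 1"
  defines "u \<equiv> \<lambda>x. of_real r * exp (2 * of_real pi * \<i> * of_real x)"
  shows "((\<lambda>x. p (u x) / u x ^ n) has_integral (deriv ^^ n) p 0 / fact n) {0..1}"
proof -
  have "cball 0 r \<subseteq> ball (0::complex) 1" "ball 0 r \<subseteq> ball (0::complex) 1" using r by auto
  then have "continuous_on (cball 0 r) p" "p holomorphic_on ball 0 r"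
    using hol holomorphic_on_imp_continuous_on[OF hol]
    by (auto intro: continuous_on_subset holomorphic_on_subset)
  from Cauchy_has_contour_integral_higher_derivative_circlepath[OF this, of 0 n]
  have "((\<lambda>x. p (circlepath 0 r x) / circlepath 0 r x ^ Suc n * vector_derivative (circlepath 0 r) (at x within {0..1}))
      has_integral 2 * pi * \<i> / fact n * (deriv ^^ n) p 0) {0..1}"
    using r by (simp add: has_contour_integral_def)
  moreover have "p (circlepath 0 r x) / circlepath 0 r x ^ Suc n * vector_derivative (circlepath 0 r) (at x within {0..1})
      = p (u x) / u x ^ n * (2 * of_real pi * \<i>)" if "x \<in> {0..1}" for x
  proof -
    have c: "circlepath 0 r x = u x" by (simp add: circlepath u_def)
    have v: "vector_derivative (circlepath 0 r) (at x within {0..1}) = 2 * of_real pi * \<i> * u x"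
      using that by (subst vector_derivative_circlepath01) (auto simp: u_def)
    have "u x \<noteq> 0" using r by (simp add: u_def)
    then show ?thesis unfolding c v by (simp add: field_simps)
  qed
  ultimately have "((\<lambda>x. p (u x) / u x ^ n * (2 * of_real pi * \<i>)) has_integral 2 * pi * \<i> / fact n * (deriv ^^ n) p 0) {0..1}"
    by (rule has_integral_eq[rotated]) simp
  from has_integral_mult_left[OF this, of "inverse (2 * of_real pi * \<i>)"] show ?thesis
    by (simp add: field_simps)
qed

text \<open>The conjugate of \<open>z ^ n * p z\<close> has mean value 0 on each circle, so adding
  it replaces \<open>p\<close> by \<open>2 Re p\<close> in the coefficient integral. Positivity
  bounds the modulus by the mean of \<open>2 Re p\<close>, and finally \<open>r\<close> tends to
  1.\<close>

lemma Caratheodory_coeff_bound: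
  fixes p :: "complex \<Rightarrow> complex"
  assumes hol: "p holomorphic_on ball 0 1" and pos: "\<And>z. z \<in> ball 0 1 \<Longrightarrow> Re (p z) \<ge> 0" and "n \<ge> 1"
  shows "norm ((deriv ^^ n) p 0 / fact n) \<le> 2 * Re (p 0)"
proof -
  define c where "c = norm ((deriv ^^ n) p 0 / fact n)"
  have bound: "c * r ^ n \<le> 2 * Re (p 0)" if r: "0 < r" "r < 1" for r :: real
  proof -
    define u where "u = (\<lambda>x. of_real r * exp (2 * of_real pi * \<i> * of_real x))"
    have nu: "norm (u x) = r" for x using r by (simp add: u_def norm_mult)
    have u0: "u x \<noteq> 0" for x using nu[of x] r by auto
    have uD: "u x \<in> ball 0 1" for x using nu[of x] r by simp
    have i1: "((\<lambda>x. p (u x) / u x ^ n) has_integral (deriv ^^ n) p 0 / fact n) {0..1}"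
      unfolding u_def by (rule circle_coeff_integral[OF hol r])
    have "(\<lambda>z. z ^ n * p z) holomorphic_on ball 0 1" by (intro holomorphic_intros hol)
    from circle_coeff_integral[OF this r, of 0]
    have "((\<lambda>x. u x ^ n * p (u x)) has_integral 0) {0..1}"
      using \<open>n \<ge> 1\<close> by (simp add: u_def power_0_left)
    from has_integral_linear[OF this bounded_linear_cnj]
    have "((\<lambda>x. cnj (u x ^ n * p (u x))) has_integral 0) {0..1}" by (simp only: o_def complex_cnj_zero)
    from has_integral_mult_left[OF this, of "inverse (of_real (r ^ (2 * n)))"]
    have "((\<lambda>x. cnj (u x ^ n * p (u x)) * inverse (of_real (r ^ (2 * n)))) has_integral 0) {0..1}" by (simp only: mult_zero_left)
    \<comment> \<open>On the circle \<open>cnj (u x) = r\<^sup>2 / u x\<close>, which turns the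
      conjugate power into the denominator \<open>u x ^ n\<close>.\<close>
    moreover have "cnj (u x ^ n * p (u x)) * inverse (of_real (r ^ (2 * n))) = cnj (p (u x)) / u x ^ n" for x
    proof -
      have "u x * cnj (u x) = of_real (r\<^sup>2)" using complex_norm_square[of "u x"] nu[of x] by simp
      then have "u x ^ n * cnj (u x) ^ n = of_real (r ^ (2 * n))"
        by (simp add: power_mult_distrib[symmetric] power_mult)
      then show ?thesis using u0[of x] r by (simp add: field_simps)
    qed
    ultimately have i2: "((\<lambda>x. cnj (p (u x)) / u x ^ n) has_integral 0) {0..1}" by (simp only:)
    have "((\<lambda>x. p (u x) / u x ^ n + cnj (p (u x)) / u x ^ n) has_integral (deriv ^^ n) p 0 / fact n) {0..1}"
      using has_integral_add[OF i1 i2] by simp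
    then have i3: "((\<lambda>x. of_real (2 * Re (p (u x))) / u x ^ n) has_integral (deriv ^^ n) p 0 / fact n) {0..1}"
      by (simp add: add_divide_distrib[symmetric] complex_add_cnj)
    have "((\<lambda>x. p (u x)) has_integral p 0) {0..1}"
      using circle_coeff_integral[OF hol r, of 0] by (simp add: u_def)
    from has_integral_linear[OF this bounded_linear_Re]
    have "((\<lambda>x. Re (p (u x))) has_integral Re (p 0)) {0..1}" by (simp add: o_def)
    from has_integral_mult_left[OF this, of "2 / r ^ n"]
    have i4: "((\<lambda>x. Re (p (u x)) * (2 / r ^ n)) has_integral Re (p 0) * (2 / r ^ n)) {0..1}" .
    have "norm (integral {0..1} (\<lambda>x. of_real (2 * Re (p (u x))) / u x ^ n)) \<le> integral {0..1} (\<lambda>x. Re (p (u x)) * (2 / r ^ n))"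
    proof (rule integral_norm_bound_integral)
      show "(\<lambda>x. of_real (2 * Re (p (u x))) / u x ^ n) integrable_on {0..1}" using i3 by blast
      show "(\<lambda>x. Re (p (u x)) * (2 / r ^ n)) integrable_on {0..1}" using i4 by blast
      show "norm (of_real (2 * Re (p (u x))) / u x ^ n) \<le> Re (p (u x)) * (2 / r ^ n)" for x
        using pos[OF uD[of x]] by (simp add: norm_divide norm_mult norm_power nu mult.commute)
    qed
    then have "c \<le> Re (p 0) * (2 / r ^ n)"
      by (simp only: c_def integral_unique[OF i3] integral_unique[OF i4])
    then show ?thesis using r by (simp add: field_simps)
  qed
  have "((\<lambda>r. c * r ^ n) \<longlongrightarrow> c * 1 ^ n) (at_left 1)" by (intro tendsto_intros)
  then have "c * 1 ^ n \<le> 2 * Re (p 0)"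
  proof (rule tendsto_upperbound)
    have "\<forall>\<^sub>F r in at_left 1. r \<in> {0<..<1::real}" by (rule eventually_at_left_real) simp
    then show "\<forall>\<^sub>F r in at_left 1. c * r ^ n \<le> 2 * Re (p 0)"
      by eventually_elim (use bound in auto)
  qed simp
  then show ?thesis by (simp add: c_def)
qed

text \<open>The factor \<open>1 - z\<^sup>2\<close> is the velocity of the flow at
  \<open>s = 0\<close>, so the expression is the derivative of \<open>Re N\<close> along it.\<close>

lemma flow_derivative:
  fixes N :: "complex \<Rightarrow> complex"
  assumes hol: "N holomorphic_on ball 0 1" and z: "z \<in> ball 0 1"
    and flow: "\<And>s. 0 < s \<Longrightarrow> s < (1::real) \<Longrightarrow> Re (N z) \<le> Re (N ((z + s) / (1 + s * z)))"
  shows "Re (deriv N z * (1 - z\<^sup>2)) \<ge> 0"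
proof (rule ccontr)
  assume "\<not> ?thesis"
  then have neg: "Re (deriv N z * (1 - z\<^sup>2)) < 0" by simp
  define T where "T = (\<lambda>s::real. (z + of_real s) / (1 + of_real s * z))"
  have "((\<lambda>w. (z + w) / (1 + w * z)) has_field_derivative (1 - z\<^sup>2)) (at (of_real 0))"
    by (auto intro!: derivative_eq_intros simp: power2_eq_square)
  from has_vector_derivative_real_field[OF this]
  have T: "(T has_vector_derivative (1 - z\<^sup>2)) (at 0)" by (simp add: T_def)
  have "(N has_field_derivative deriv N z) (at (T 0))"
    using hol z by (auto simp: T_def intro: holomorphic_derivI)
  from field_vector_diff_chain_at[OF T this]
  have "((\<lambda>s. N (T s)) has_vector_derivative deriv N z * (1 - z\<^sup>2)) (at 0)"
    by (simp add: o_def mult.commute)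
  then have "((\<lambda>s. Re (N (T s))) has_real_derivative Re (deriv N z * (1 - z\<^sup>2))) (at 0)"
    by (rule has_field_derivative_Re)
  from DERIV_neg_dec_right[OF this neg] obtain d where
    d: "d > 0" "\<And>h. 0 < h \<Longrightarrow> h < d \<Longrightarrow> Re (N (T h)) < Re (N (T 0))" by auto
  define s where "s = min d 1 / 2"
  have "0 < s" "s < d" "s < 1" using d(1) by (auto simp: s_def min_def)
  then show False using d(2)[of s] flow[of s] by (simp add: T_def)
qed

text \<open>With \<open>\<kappa> = 1 / (1 + \<omega>)\<close> both derivatives are products with
  \<open>deriv N\<close>: \<open>a h1'\<close> is \<open>deriv N\<close> times \<kappa>, and
  \<open>cnj a g1'\<close> is \<open>deriv N\<close> times \<open>1 - \<kappa>\<close>. The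
  coefficients of \<open>deriv N\<close> are at most those of \<open>1 / (1 - z)^2\<close> in
  modulus, those of \<kappa> at most 1. As \<open>\<kappa> 0 = 1\<close>, the second product loses
  one term, which explains the difference between the two bounds.\<close>

lemma convex_harmonic_coeff_bounds:
  fixes h g :: "complex \<Rightarrow> complex"
  defines "f \<equiv> \<lambda>z. h z + cnj (g z)"
  assumes hol: "h holomorphic_on ball 0 1" "g holomorphic_on ball 0 1"
    and inj: "inj_on f (ball 0 1)" and conv: "convex (f ` ball 0 1)"
    and jac: "\<And>z. z \<in> ball 0 1 \<Longrightarrow> norm (deriv g z) < norm (deriv h z)"
    and h0: "deriv h 0 = 1" and g0: "deriv g 0 = 0"
  shows "norm (fps_nth (fps_expansion h 0) (Suc n)) \<le> (real n + 2) / 2"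
    and "norm (fps_nth (fps_expansion g 0) (Suc n)) \<le> real n / 2"
proof -
  obtain a P :: complex where a: "norm a = 1" and P: "norm P = 1" and flow: "\<And>s z. 0 < s \<Longrightarrow> s < (1::real) \<Longrightarrow> z \<in> ball 0 1 \<Longrightarrow>
       Re (a * f (P * z)) \<le> Re (a * f (P * ((z + s) / (1 + s * z))))"
    using convex_harmonic_flow[OF hol inj[unfolded f_def] conv[unfolded f_def]] unfolding f_def by metis
  have PD: "P * z \<in> ball 0 1" if "z \<in> ball 0 1" for z using that P by (simp add: norm_mult)
  define h1 g1 where "h1 = (\<lambda>z. h (P * z))" and "g1 = (\<lambda>z. g (P * z))"
  have hol1: "h1 holomorphic_on ball 0 1" "g1 holomorphic_on ball 0 1"
    unfolding h1_def g1_def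
    by (intro holomorphic_on_compose_gen[OF _ hol(1), unfolded o_def] holomorphic_on_compose_gen[OF _ hol(2), unfolded o_def]
        holomorphic_intros; use PD in auto)+
  have dk: "(deriv ^^ k) h1 z = P ^ k * (deriv ^^ k) h (P * z)" "(deriv ^^ k) g1 z = P ^ k * (deriv ^^ k) g (P * z)"
    if "z \<in> ball 0 1" for k z
    unfolding h1_def g1_def using that PD hol by (intro higher_deriv_compose_linear[of _ "ball 0 1" "ball 0 1"]; simp)+
  have d1: "deriv h1 z = P * deriv h (P * z)" "deriv g1 z = P * deriv g (P * z)" if "z \<in> ball 0 1" for z
    using dk[OF that, of 1] by simp_all
  define N where "N = (\<lambda>z. a * h1 z + cnj a * g1 z)"
  have holN: "N holomorphic_on ball 0 1" unfolding N_def by (intro holomorphic_intros hol1)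
  have ReN: "Re (N z) = Re (a * f (P * z))" for z by (simp add: N_def h1_def g1_def f_def algebra_simps)
  have dN: "deriv N z = a * deriv h1 z + cnj a * deriv g1 z" if "z \<in> ball 0 1" for z
    unfolding N_def by (rule DERIV_imp_deriv) (intro DERIV_add DERIV_cmult holomorphic_derivI[OF hol1(1)] holomorphic_derivI[OF hol1(2)] open_ball that)
  define p where "p = (\<lambda>z. deriv N z * (1 - z\<^sup>2))"
  have holp: "p holomorphic_on ball 0 1" unfolding p_def by (intro holomorphic_intros holN open_ball)
  have pos: "Re (p z) \<ge> 0" if "z \<in> ball 0 1" for z
    unfolding p_def by (rule flow_derivative[OF holN that]) (unfold ReN, rule flow[OF _ _ that])
  \<comment> \<open>The normalization at 0 makes \<open>p 0\<close> unimodular, so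
    \<open>Re (p 0) \<le> 1\<close> and the later coefficients of \<open>p\<close> are at most 2 in
    modulus.\<close>
  have p0: "p 0 = a * P" using dN[of 0] d1[of 0] h0 g0 by (simp add: p_def)
  define FN where "FN = fps_expansion (deriv N) 0"
  have FN: "deriv N has_fps_expansion FN"
    unfolding FN_def by (rule has_fps_expansion_fps_expansion[of "ball 0 1"]) (auto intro!: holomorphic_intros holN)
  have Fp: "p has_fps_expansion FN * (1 - fps_X\<^sup>2)"
    unfolding p_def by (intro fps_expansion_intros FN)
  have pn: "norm (fps_nth (FN * (1 - fps_X\<^sup>2)) k) \<le> (if k = 0 then 1 else 2)" for k
  proof (cases "k = 0")
    case True
    then show ?thesis using fps_nth_fps_expansion[OF Fp, of 0] p0 a P by (simp add: norm_mult)
  next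
    case False
    have "Re (p 0) \<le> 1" using complex_Re_le_cmod[of "p 0"] p0 a P by (simp add: norm_mult)
    then show ?thesis
      using Caratheodory_coeff_bound[OF holp pos, of k] False fps_nth_fps_expansion[OF Fp, of k] by simp
  qed
  \<comment> \<open>Division by \<open>1 - z\<^sup>2\<close> links coefficients two apart: starting
    from the bounds 1 and 2, each step adds at most 2.\<close>
  have rec: "fps_nth (FN * (1 - fps_X\<^sup>2)) k = fps_nth FN k - (if k < 2 then 0 else fps_nth FN (k - 2))" for k
    by (simp add: right_diff_distrib fps_X_power_mult_right_nth)
  have Nn: "norm (fps_nth FN k) \<le> real k + 1" for k
  proof (induction k rule: less_induct)
    case (less k)
    show ?case
    proof (cases "k < 2")
      case True
      then show ?thesis using pn[of k] rec[of k] by (auto split: if_splits)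
    next
      case False
      have "fps_nth FN k = fps_nth (FN * (1 - fps_X\<^sup>2)) k + fps_nth FN (k - 2)" using rec[of k] False by simp
      then have "norm (fps_nth FN k) \<le> norm (fps_nth (FN * (1 - fps_X\<^sup>2)) k) + norm (fps_nth FN (k - 2))"
        by (metis norm_triangle_ineq)
      also have "\<dots> \<le> 2 + (real (k - 2) + 1)" using pn[of k] less.IH[of "k - 2"] False by (intro add_mono) auto
      finally show ?thesis using False by (simp add: of_nat_diff)
    qed
  qed
  define \<omega> where "\<omega> = (\<lambda>z. cnj a * deriv g1 z / (a * deriv h1 z))"
  have dh1: "a * deriv h1 z \<noteq> 0" if "z \<in> ball 0 1" for z
    using jac[OF PD[OF that]] d1[OF that] a P by (auto simp: norm_mult)
  have \<omega>1: "norm (\<omega> z) < 1" if "z \<in> ball 0 1" for z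
    using jac[OF PD[OF that]] d1[OF that] a P by (simp add: \<omega>_def norm_divide norm_mult divide_less_eq)
  have ne: "1 + \<omega> z \<noteq> 0" if "z \<in> ball 0 1" for z
    using \<omega>1[OF that] by (metis add_eq_0_iff less_irrefl norm_minus_cancel norm_one)
  have hol\<omega>: "\<omega> holomorphic_on ball 0 1"
    unfolding \<omega>_def by (intro holomorphic_intros hol1 open_ball) (use dh1 in auto)
  have \<omega>0: "\<omega> 0 = 0" using d1[of 0] g0 by (simp add: \<omega>_def)
  define \<kappa> where "\<kappa> = (\<lambda>z. 1 / (1 + \<omega> z))"
  have hol\<kappa>: "\<kappa> holomorphic_on ball 0 1"
    unfolding \<kappa>_def by (intro holomorphic_intros hol\<omega>) (use ne in auto)
  define F\<kappa> where "F\<kappa> = fps_expansion \<kappa> 0"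
  have F\<kappa>: "\<kappa> has_fps_expansion F\<kappa>"
    unfolding F\<kappa>_def by (rule has_fps_expansion_fps_expansion[of "ball 0 1"]) (auto intro: hol\<kappa>)
  have \<kappa>0: "fps_nth F\<kappa> 0 = 1"
    using fps_nth_fps_expansion[OF F\<kappa>, of 0] \<omega>0 by (simp add: \<kappa>_def)
  have \<kappa>n: "norm (fps_nth F\<kappa> k) \<le> 1" for k
  proof (cases "k = 0")
    case False
    \<comment> \<open>\<open>q = (1 - \<omega>) / (1 + \<omega>)\<close> has positive real part and
      value 1 at 0, so its coefficients are at most 2 and those of \<kappa> at most 1 in
      modulus.\<close>
    define q where "q = (\<lambda>z. 2 * \<kappa> z - 1)"
    have "q holomorphic_on ball 0 1" unfolding q_def by (intro holomorphic_intros hol\<kappa>)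
    moreover have "Re (q z) \<ge> 0" if "z \<in> ball 0 1" for z
    proof -
      have "q z = (1 - \<omega> z) / (1 + \<omega> z)" using ne[OF that] by (simp add: q_def \<kappa>_def field_simps)
      also have "\<dots> = (1 - \<omega> z) * cnj (1 + \<omega> z) / of_real ((norm (1 + \<omega> z))\<^sup>2)" by (rule complex_div_cnj)
      finally have "Re (q z) = Re ((1 - \<omega> z) * cnj (1 + \<omega> z)) / (norm (1 + \<omega> z))\<^sup>2"
        by (simp only: Re_divide_of_real)
      also have "Re ((1 - \<omega> z) * cnj (1 + \<omega> z)) = 1 - (norm (\<omega> z))\<^sup>2"
        by (simp only: cmod_power2) (simp add: power2_eq_square algebra_simps)
      finally show ?thesis using \<omega>1[OF that] by (simp add: power_le_one)
    qed
    moreover have Fq: "q has_fps_expansion fps_const 2 * F\<kappa> - 1"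
      unfolding q_def by (intro fps_expansion_intros F\<kappa>)
    ultimately have "norm (fps_nth (fps_const 2 * F\<kappa> - 1) k) \<le> 2 * Re (q 0)"
      using Caratheodory_coeff_bound[of q k] False fps_nth_fps_expansion[OF Fq, of k] by simp
    then show ?thesis using False \<omega>0 by (simp add: q_def \<kappa>_def norm_mult)
  qed (use \<kappa>0 in simp)
  define Fh Fg where "Fh = fps_expansion h1 0" and "Fg = fps_expansion g1 0"
  have Fh: "h1 has_fps_expansion Fh" and Fg: "g1 has_fps_expansion Fg"
    unfolding Fh_def Fg_def by (rule has_fps_expansion_fps_expansion[of "ball 0 1"]; simp add: hol1)+
  have ev: "\<forall>\<^sub>F z in nhds 0. z \<in> ball (0::complex) 1" by (intro eventually_nhds_in_open) auto
  have evh: "\<forall>\<^sub>F z in nhds 0. deriv N z * \<kappa> z = a * deriv h1 z"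
    using ev
  proof eventually_elim
    case (elim z)
    have "deriv N z = a * deriv h1 z * (1 + \<omega> z)" using dN[OF elim] dh1[OF elim] by (simp add: \<omega>_def field_simps)
    then show ?case using ne[OF elim] by (simp add: \<kappa>_def)
  qed
  have "(\<lambda>z. deriv N z * \<kappa> z) has_fps_expansion FN * F\<kappa>" by (intro fps_expansion_intros FN F\<kappa>)
  moreover have "(\<lambda>z. a * deriv h1 z) has_fps_expansion fps_const a * fps_deriv Fh"
    by (intro fps_expansion_intros Fh)
  ultimately have eqh: "FN * F\<kappa> = fps_const a * fps_deriv Fh"
    unfolding has_fps_expansion_cong[OF evh refl] by (rule fps_expansion_eqI)
  have evg: "\<forall>\<^sub>F z in nhds 0. deriv N z * (1 - \<kappa> z) = cnj a * deriv g1 z"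
    using ev
  proof eventually_elim
    case (elim z)
    have "deriv N z = a * deriv h1 z * (1 + \<omega> z)" using dN[OF elim] dh1[OF elim] by (simp add: \<omega>_def field_simps)
    moreover have "1 - \<kappa> z = \<omega> z / (1 + \<omega> z)" using ne[OF elim] by (simp add: \<kappa>_def field_simps)
    ultimately have "deriv N z * (1 - \<kappa> z) = a * deriv h1 z * \<omega> z" using ne[OF elim] by simp
    also have "\<dots> = cnj a * deriv g1 z" using dh1[OF elim] by (simp add: \<omega>_def)
    finally show ?case .
  qed
  have "(\<lambda>z. deriv N z * (1 - \<kappa> z)) has_fps_expansion FN * (1 - F\<kappa>)" by (intro fps_expansion_intros FN F\<kappa>)
  moreover have "(\<lambda>z. cnj a * deriv g1 z) has_fps_expansion fps_const (cnj a) * fps_deriv Fg"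
    by (intro fps_expansion_intros Fg)
  ultimately have eqg: "FN * (1 - F\<kappa>) = fps_const (cnj a) * fps_deriv Fg"
    unfolding has_fps_expansion_cong[OF evg refl] by (rule fps_expansion_eqI)
  have sum1: "(\<Sum>i=0..n. real i + 1) = (real n + 1) * (real n + 2) / 2" for n
    by (induction n) (auto simp: field_simps)
  \<comment> \<open>The rotation by \<open>P\<close> multiplies the Taylor coefficients by
    unimodular factors.\<close>
  have ch: "norm (fps_nth Fh k) = norm (fps_nth (fps_expansion h 0) k)" "norm (fps_nth Fg k) = norm (fps_nth (fps_expansion g 0) k)" for k
    using dk[of 0 k] P by (simp_all add: Fh_def Fg_def fps_expansion_def norm_mult norm_power norm_divide)
  have "norm (fps_nth (FN * F\<kappa>) n) \<le> (\<Sum>i=0..n. norm (fps_nth FN i * fps_nth F\<kappa> (n - i)))"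
    unfolding fps_mult_nth by (rule norm_sum)
  also have "\<dots> \<le> (\<Sum>i=0..n. real i + 1)"
    using mult_mono[OF Nn \<kappa>n] by (intro sum_mono) (simp add: norm_mult)
  finally have "norm (fps_nth (FN * F\<kappa>) n) \<le> (real n + 1) * (real n + 2) / 2" unfolding sum1 .
  moreover have "norm (fps_nth (FN * F\<kappa>) n) = (real n + 1) * norm (fps_nth Fh (Suc n))"
    unfolding eqh using a by (simp add: norm_mult) (metis norm_of_nat of_nat_Suc add.commute)
  ultimately have "(real n + 1) * norm (fps_nth Fh (Suc n)) \<le> (real n + 1) * ((real n + 2) / 2)" by simp
  then show "norm (fps_nth (fps_expansion h 0) (Suc n)) \<le> (real n + 2) / 2"
    unfolding ch by (rule mult_left_le_imp_le) simp
  have "norm (fps_nth (FN * (1 - F\<kappa>)) n) \<le> (\<Sum>i=0..n. norm (fps_nth FN i * fps_nth (1 - F\<kappa>) (n - i)))"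
    unfolding fps_mult_nth by (rule norm_sum)
  \<comment> \<open>The term \<open>i = n\<close> contains the constant coefficient of
    \<open>1 - F\<kappa>\<close>, which is 0.\<close>
  also have "\<dots> = (\<Sum>i=0..<n. norm (fps_nth FN i * fps_nth (1 - F\<kappa>) (n - i)))"
    using \<kappa>0 by (simp add: atLeastLessThanSuc_atLeastAtMost[symmetric])
  also have "\<dots> \<le> (\<Sum>i=0..<n. real i + 1)"
  proof (rule sum_mono)
    fix i assume "i \<in> {0..<n}"
    then have "norm (fps_nth (1 - F\<kappa>) (n - i)) \<le> 1" using \<kappa>n[of "n - i"] by simp
    then show "norm (fps_nth FN i * fps_nth (1 - F\<kappa>) (n - i)) \<le> real i + 1"
      using mult_mono[OF Nn[of i]] by (fastforce simp: norm_mult)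
  qed
  also have "\<dots> = real n * (real n + 1) / 2" by (induction n) (auto simp: field_simps)
  finally have "norm (fps_nth (FN * (1 - F\<kappa>)) n) \<le> real n * (real n + 1) / 2" .
  moreover have "norm (fps_nth (FN * (1 - F\<kappa>)) n) = (real n + 1) * norm (fps_nth Fg (Suc n))"
    unfolding eqg using a by (simp add: norm_mult) (metis norm_of_nat of_nat_Suc add.commute)
  ultimately have "(real n + 1) * norm (fps_nth Fg (Suc n)) \<le> (real n + 1) * (real n / 2)" by (simp add: mult.commute)
  then show "norm (fps_nth (fps_expansion g 0) (Suc n)) \<le> real n / 2"
    unfolding ch by (rule mult_left_le_imp_le) simp
qed

section \<open>Harmonic convexity of order \<alpha>\<close>

lemma norm_le_of_sums:
  fixes f :: "nat \<Rightarrow> 'a::banach"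
  assumes "f sums F" "g sums G" "\<And>n. norm (f n) \<le> g n"
  shows "norm F \<le> G"
proof -
  have "summable (\<lambda>n. norm (f n))"
    by (rule summable_comparison_test[of _ g]) (use assms sums_summable in auto)
  then have "norm F \<le> (\<Sum>n. norm (f n))"
    using summable_norm[of f] sums_unique[OF assms(1)] by simp
  also have "\<dots> \<le> G"
    using suminf_le[OF assms(3) \<open>summable (\<lambda>n. norm (f n))\<close> sums_summable[OF assms(2)]] sums_unique[OF assms(2)] by simp
  finally show ?thesis .
qed

text \<open>The two series are the first and second iterate of \<open>z d/dz\<close> applied to
  \<open>C\<close>, with multipliers \<open>n\<close> and \<open>n^2\<close>; on a circle around 0
  this operator is the derivative in the angle up to the factor \<i>.\<close>

lemma power_series_disc:
  fixes c :: "nat \<Rightarrow> complex"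
  assumes "summable (\<lambda>n. norm (c n))" and z: "z \<in> ball 0 1"
  defines "C \<equiv> Abs_fps c"
  shows "(eval_fps C has_field_derivative eval_fps (fps_deriv C) z) (at z)"
    and "(eval_fps (fps_deriv C) has_field_derivative eval_fps (fps_deriv (fps_deriv C)) z) (at z)"
    and "(\<lambda>n. of_nat n * c n * z ^ n) sums (z * eval_fps (fps_deriv C) z)"
    and "(\<lambda>n. (of_nat n)\<^sup>2 * c n * z ^ n) sums (z * eval_fps (fps_deriv C) z + z\<^sup>2 * eval_fps (fps_deriv (fps_deriv C)) z)"
proof -
  have "conv_radius c \<ge> 1"
  proof (rule conv_radius_geI_ex)
    fix r :: real assume r: "0 < r" "ereal r < 1"
    have "summable (\<lambda>n. c n * of_real r ^ n)"
    proof (rule summable_comparison_test[OF _ assms(1)], intro exI allI impI)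
      fix n
      have "norm (c n * of_real r ^ n) = norm (c n) * r ^ n" using r by (simp add: norm_mult norm_power)
      also have "\<dots> \<le> norm (c n) * 1" using r by (intro mult_left_mono power_le_one) auto
      finally show "norm (c n * of_real r ^ n) \<le> norm (c n)" by simp
    qed
    then show "\<exists>z. norm z = r \<and> summable (\<lambda>n. c n * z ^ n)"
      using r by (intro exI[of _ "of_real r"]) auto
  qed
  then have "fps_conv_radius C \<ge> 1" by (simp add: fps_conv_radius_def C_def)
  then have R1: "fps_conv_radius C \<ge> 1" "fps_conv_radius (fps_deriv C) \<ge> 1" "fps_conv_radius (fps_deriv (fps_deriv C)) \<ge> 1"
    using fps_conv_radius_deriv[of C] fps_conv_radius_deriv[of "fps_deriv C"] by (auto intro: order_trans)
  have zl: "ereal (norm z) < 1" using z by simp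
  have R: "norm z < fps_conv_radius C" "norm z < fps_conv_radius (fps_deriv C)" "norm z < fps_conv_radius (fps_deriv (fps_deriv C))"
    by (intro less_le_trans[OF zl] R1)+
  show "(eval_fps C has_field_derivative eval_fps (fps_deriv C) z) (at z)"
    "(eval_fps (fps_deriv C) has_field_derivative eval_fps (fps_deriv (fps_deriv C)) z) (at z)"
    by (rule has_field_derivative_eval_fps; fact R)+
  have s1: "(\<lambda>n. of_nat (Suc n) * c (Suc n) * z ^ Suc n) sums (z * eval_fps (fps_deriv C) z)"
    using sums_mult[OF sums_eval_fps[OF R(2)], of z] by (simp add: C_def mult_ac)
  then show s1': "(\<lambda>n. of_nat n * c n * z ^ n) sums (z * eval_fps (fps_deriv C) z)"
    using sums_Suc_iff[of "\<lambda>n. of_nat n * c n * z ^ n"] by simp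
  have "(\<lambda>n. of_nat (Suc (Suc n)) * of_nat (Suc n) * c (Suc (Suc n)) * z ^ Suc (Suc n)) sums (z\<^sup>2 * eval_fps (fps_deriv (fps_deriv C)) z)"
    using sums_mult[OF sums_eval_fps[OF R(3)], of "z\<^sup>2"] by (simp add: C_def mult_ac power2_eq_square)
  then have "(\<lambda>n. of_nat (Suc n) * of_nat n * c (Suc n) * z ^ Suc n) sums (z\<^sup>2 * eval_fps (fps_deriv (fps_deriv C)) z)"
    using sums_Suc_iff[of "\<lambda>n. of_nat (Suc n) * of_nat n * c (Suc n) * z ^ Suc n"] by simp
  from sums_add[OF s1 this]
  have "(\<lambda>n. (of_nat (Suc n))\<^sup>2 * c (Suc n) * z ^ Suc n) sums (z * eval_fps (fps_deriv C) z + z\<^sup>2 * eval_fps (fps_deriv (fps_deriv C)) z)"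
    by (simp add: algebra_simps power2_eq_square)
  then show "(\<lambda>n. (of_nat n)\<^sup>2 * c n * z ^ n) sums (z * eval_fps (fps_deriv C) z + z\<^sup>2 * eval_fps (fps_deriv (fps_deriv C)) z)"
    using sums_Suc_iff[of "\<lambda>n. (of_nat n)\<^sup>2 * c n * z ^ n"] by simp
qed

lemma sums_shift2:
  fixes f :: "nat \<Rightarrow> 'a::real_normed_vector"
  assumes "f sums s" shows "(\<lambda>n. f (n + 2)) sums (s - f 0 - f 1)"
  using sums_iff_shift[of f 2 "s - f 0 - f 1"] assms by (simp add: numeral_2_eq_2)

text \<open>For \<open>n \<ge> 2\<close> and \<open>\<kappa> > -1\<close> one has
  \<open>n \<le> 2 (n + \<kappa>)\<close>, so the weight \<open>n (n + \<kappa>)\<close> dominates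
  \<open>n^2 / 2\<close>. Later \<kappa> is \<open>- \<alpha>\<close> for the analytic part and
  \<alpha> for the other.\<close>

lemma weighted_summable:
  fixes v :: "nat \<Rightarrow> complex"
  assumes "- 1 < \<kappa>" and S: "summable (\<lambda>n. (real n + 2) * (real n + 2 + \<kappa>) * norm (v (n + 2)))"
  shows "summable (\<lambda>n. (real n + 2)\<^sup>2 * norm (v (n + 2)))" and "summable (\<lambda>n. norm (v n))"
proof -
  show base: "summable (\<lambda>n. (real n + 2)\<^sup>2 * norm (v (n + 2)))"
  proof (rule summable_comparison_test[OF _ summable_mult[OF S, of 2]], intro exI allI impI)
    fix n
    have "(real n + 2) * (real n + 2) \<le> (real n + 2) * (2 * (real n + 2 + \<kappa>))"
      using \<open>- 1 < \<kappa>\<close> by (intro mult_left_mono) auto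
    then have "(real n + 2)\<^sup>2 \<le> 2 * ((real n + 2) * (real n + 2 + \<kappa>))"
      unfolding power2_eq_square by (subst (asm) mult.left_commute)
    from mult_right_mono[OF this norm_ge_zero[of "v (n + 2)"]]
    have "(real n + 2)\<^sup>2 * norm (v (n + 2)) \<le> 2 * ((real n + 2) * (real n + 2 + \<kappa>) * norm (v (n + 2)))"
      by (simp only: mult.assoc)
    moreover have "0 \<le> (real n + 2)\<^sup>2 * norm (v (n + 2))" by simp
    ultimately show "norm ((real n + 2)\<^sup>2 * norm (v (n + 2))) \<le> 2 * ((real n + 2) * (real n + 2 + \<kappa>) * norm (v (n + 2)))"
      by (simp only: real_norm_def abs_of_nonneg)
  qed
  have "summable (\<lambda>n. norm (v (n + 2)))"
  proof (rule summable_comparison_test[OF _ base], intro exI allI impI)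
    fix n
    have "1 \<le> (real n + 2)\<^sup>2" by (simp add: one_le_power)
    from mult_right_mono[OF this norm_ge_zero[of "v (n + 2)"]]
    show "norm (norm (v (n + 2))) \<le> (real n + 2)\<^sup>2 * norm (v (n + 2))" by simp
  qed
  then show "summable (\<lambda>n. norm (v n))" by (subst (asm) summable_iff_shift)
qed

text \<open>From \<open>n = 2\<close> on, \<open>r ^ n \<le> r\<^sup>2\<close>. The gain of
  \<open>r\<^sup>2\<close> over \<open>r\<close> later turns the weak coefficient condition into a
  strict inequality.\<close>

lemma weighted_sums:
  fixes v :: "nat \<Rightarrow> complex"
  assumes "- 1 < \<kappa>" and S: "summable (\<lambda>n. (real n + 2) * (real n + 2 + \<kappa>) * norm (v (n + 2)))"
    and r: "0 < r" "r < 1"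
  obtains X1 X2 where "(\<lambda>n. (real n + 2) * (norm (v (n + 2)) * r ^ (n + 2))) sums X1"
    "(\<lambda>n. (real n + 2)\<^sup>2 * (norm (v (n + 2)) * r ^ (n + 2))) sums X2" "0 \<le> X1" "X1 \<le> X2"
    "X2 + \<kappa> * X1 \<le> r\<^sup>2 * (\<Sum>n. (real n + 2) * (real n + 2 + \<kappa>) * norm (v (n + 2)))"
proof -
  let ?N = "\<lambda>n::nat. real n + 2" and ?x = "\<lambda>n. norm (v (n + 2)) * r ^ (n + 2)"
  have rn: "0 \<le> r ^ (n + 2)" "r ^ (n + 2) \<le> r\<^sup>2" "r ^ (n + 2) \<le> 1" for n
    using r power_decreasing[of 2 "n + 2" r] power_le_one[of r "n + 2"] by auto
  have x0: "0 \<le> ?x n" for n using rn(1)[of n] by (intro mult_nonneg_nonneg) auto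
  have N2: "?N n \<le> (?N n)\<^sup>2" for n by (simp add: power2_eq_square)
  have sm: "summable (\<lambda>n. q n * ?x n)" if q: "\<And>n. 0 \<le> q n \<and> q n \<le> (?N n)\<^sup>2" for q
  proof (rule summable_comparison_test[OF _ weighted_summable(1)[OF assms(1,2)]], intro exI allI impI)
    fix n
    have "q n * ?x n \<le> (?N n)\<^sup>2 * (norm (v (n + 2)) * 1)"
      using q[of n] rn[of n] by (intro mult_mono) auto
    moreover have "0 \<le> q n * ?x n" by (rule mult_nonneg_nonneg[OF _ x0]) (use q in auto)
    ultimately show "norm (q n * ?x n) \<le> (?N n)\<^sup>2 * norm (v (n + 2))"
      by (simp only: real_norm_def abs_of_nonneg mult_1_right)
  qed
  have s1: "(\<lambda>n. ?N n * ?x n) sums (\<Sum>n. ?N n * ?x n)" by (rule summable_sums, rule sm) (use N2 in simp)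
  have s2: "(\<lambda>n. (?N n)\<^sup>2 * ?x n) sums (\<Sum>n. (?N n)\<^sup>2 * ?x n)" by (rule summable_sums, rule sm) simp
  show ?thesis
  proof (rule that[OF s1 s2])
    show "0 \<le> (\<Sum>n. ?N n * ?x n)"
      by (rule sums_le[OF _ sums_zero s1]) (intro mult_nonneg_nonneg x0, simp)
    show "(\<Sum>n. ?N n * ?x n) \<le> (\<Sum>n. (?N n)\<^sup>2 * ?x n)"
      by (rule sums_le[OF _ s1 s2]) (intro mult_right_mono N2 x0)
    show "(\<Sum>n. (?N n)\<^sup>2 * ?x n) + \<kappa> * (\<Sum>n. ?N n * ?x n) \<le> r\<^sup>2 * (\<Sum>n. ?N n * (?N n + \<kappa>) * norm (v (n + 2)))"
    proof (rule sums_le[OF _ sums_add[OF s2 sums_mult[OF s1]] sums_mult[OF summable_sums[OF S]]])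
      fix n
      have "(?N n)\<^sup>2 * ?x n + \<kappa> * (?N n * ?x n) = ?N n * (?N n + \<kappa>) * norm (v (n + 2)) * r ^ (n + 2)"
        by (simp add: power2_eq_square algebra_simps)
      also have "\<dots> \<le> ?N n * (?N n + \<kappa>) * norm (v (n + 2)) * r\<^sup>2"
        using \<open>- 1 < \<kappa>\<close> by (intro mult_left_mono rn mult_nonneg_nonneg) auto
      finally show "(?N n)\<^sup>2 * ?x n + \<kappa> * (?N n * ?x n) \<le> r\<^sup>2 * (?N n * (?N n + \<kappa>) * norm (v (n + 2)))"
        by (simp only: mult.commute)
    qed
  qed
qed

text \<open>On a circle the angular derivative of \<open>F\<close> is \<open>\<i> * B\<close> and
  that of \<open>B\<close> is \<open>\<i> * A\<close>, so the argument turns with speed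
  \<open>Re (A / B)\<close>. This exceeds \<alpha> exactly if \<open>A\<close> is closer to
  \<open>(1 + \<alpha>) B\<close> than to \<open>- (1 - \<alpha>) B\<close>; both distances are
  estimated by separating off the leading term \<open>z\<close>.\<close>

lemma HK_coeff_sufficient:
  fixes c e :: "nat \<Rightarrow> complex" and F :: "complex \<Rightarrow> complex"
  assumes \<alpha>: "0 \<le> \<alpha>" "\<alpha> < 1"
    and c01: "c 0 = 0" "c 1 = 1" and e01: "e 0 = 0" "e 1 = 0"
    and Sc: "summable (\<lambda>n. (real n + 2) * (real n + 2 - \<alpha>) * norm (c (n + 2)))"
    and Se: "summable (\<lambda>n. (real n + 2) * (real n + 2 + \<alpha>) * norm (e (n + 2)))"
    and le: "(\<Sum>n. (real n + 2) * (real n + 2 - \<alpha>) * norm (c (n + 2)))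
        + (\<Sum>n. (real n + 2) * (real n + 2 + \<alpha>) * norm (e (n + 2))) \<le> 1 - \<alpha>"
    and F: "\<And>z. z \<in> ball 0 1 \<Longrightarrow> F z = eval_fps (Abs_fps c) z + cnj (eval_fps (Abs_fps e) z)"
  shows "F \<in> HK \<alpha>"
proof -
  let ?N = "\<lambda>n::nat. real n + 2"
  let ?C = "\<lambda>n. ?N n * (?N n - \<alpha>) * norm (c (n + 2))" and ?E = "\<lambda>n. ?N n * (?N n + \<alpha>) * norm (e (n + 2))"
  have Sc': "summable (\<lambda>n. ?N n * (?N n + - \<alpha>) * norm (c (n + 2)))" using Sc by simp
  have \<alpha>': "- 1 < - \<alpha>" "- 1 < \<alpha>" using \<alpha> by auto
  note sc = weighted_summable(2)[OF \<alpha>'(1) Sc'] and se = weighted_summable(2)[OF \<alpha>'(2) Se]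
  define H H1 H2 where "H = eval_fps (Abs_fps c)" and "H1 = eval_fps (fps_deriv (Abs_fps c))"
    and "H2 = eval_fps (fps_deriv (fps_deriv (Abs_fps c)))"
  define G G1 G2 where "G = eval_fps (Abs_fps e)" and "G1 = eval_fps (fps_deriv (Abs_fps e))"
    and "G2 = eval_fps (fps_deriv (fps_deriv (Abs_fps e)))"
  note Hs = power_series_disc[OF sc, folded H_def H1_def H2_def]
  note Gs = power_series_disc[OF se, folded G_def G1_def G2_def]
  have FHG: "F z = H z + cnj (G z)" if "z \<in> ball 0 1" for z using F[OF that] by (simp add: H_def G_def)
  have "harmonic_rep F H G"
    unfolding harmonic_rep_def
  proof (intro conjI ballI)
    show "H holomorphic_on ball 0 1" "G holomorphic_on ball 0 1"
      unfolding holomorphic_on_open[OF open_ball] using Hs(1) Gs(1) by blast+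
    show "H 0 = 0" "G 0 = 0" using c01 e01 by (simp_all add: H_def G_def eval_fps_at_0)
    show "deriv H 0 = 1" using DERIV_imp_deriv[OF Hs(1)[of 0]] c01 by (simp add: H1_def eval_fps_at_0)
    show "norm (deriv G 0) < 1" using DERIV_imp_deriv[OF Gs(1)[of 0]] e01 by (simp add: G1_def eval_fps_at_0)
  qed (use FHG in auto)
  then have "F \<in> H_hat" by (auto simp: H_hat_def)
  moreover have "\<exists>\<phi>. arg_branch (theta_deriv F r) \<phi> \<and>
        (\<forall>t\<in>{0..2 * pi}. \<exists>m. (\<phi> has_real_derivative m) (at t) \<and> m > \<alpha>)" if r: "0 < r" "r < 1" for r
  proof -
    let ?x = "\<lambda>v n. norm (v (n + 2) :: complex) * r ^ (n + 2)"
    define Z where "Z = rcis r"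
    have nZ: "norm (Z t) = r" and ZD: "Z t \<in> ball 0 1" for t using r by (simp_all add: Z_def)
    have dZ: "(Z has_vector_derivative \<i> * Z t) (at t)" for t
    proof -
      have "((\<lambda>w. of_real r * exp (\<i> * w)) has_field_derivative \<i> * (of_real r * exp (\<i> * of_real t))) (at (of_real t))"
        by (auto intro!: derivative_eq_intros)
      from has_vector_derivative_real_field[OF this]
      have "((\<lambda>x. of_real r * exp (\<i> * of_real x)) has_vector_derivative \<i> * (of_real r * exp (\<i> * of_real t))) (at t)" .
      moreover have "Z = (\<lambda>x. of_real r * exp (\<i> * of_real x))" by (simp add: fun_eq_iff Z_def rcis_def cis_conv_exp)
      ultimately show ?thesis by (simp only:)
    qed
    define A B where "A = (\<lambda>t. Z t * H1 (Z t) + (Z t)\<^sup>2 * H2 (Z t) + cnj (Z t * G1 (Z t) + (Z t)\<^sup>2 * G2 (Z t)))"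
      and "B = (\<lambda>t. Z t * H1 (Z t) - cnj (Z t * G1 (Z t)))"
    have theta: "theta_deriv F r t = \<i> * B t" for t
    proof -
      have "((\<lambda>s. H (Z s)) has_vector_derivative \<i> * Z t * H1 (Z t)) (at t)"
        using field_vector_diff_chain_at[OF dZ Hs(1)[OF ZD]] by (simp add: o_def)
      moreover have "((\<lambda>s. cnj (G (Z s))) has_vector_derivative cnj (\<i> * Z t * G1 (Z t))) (at t)"
        using field_vector_diff_chain_at[OF dZ Gs(1)[OF ZD]]
        by (intro has_vector_derivative_cnj) (simp add: o_def)
      ultimately have "((\<lambda>s. H (Z s) + cnj (G (Z s))) has_vector_derivative \<i> * Z t * H1 (Z t) + cnj (\<i> * Z t * G1 (Z t))) (at t)"
        by (rule has_vector_derivative_add)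
      moreover have "(\<lambda>s. H (Z s) + cnj (G (Z s))) = (\<lambda>s. F (rcis r s))"
        using FHG[OF ZD] by (simp add: Z_def)
      ultimately show ?thesis
        unfolding theta_deriv_def B_def by (simp add: vector_derivative_at algebra_simps)
    qed
    obtain X1 X2 where sX: "(\<lambda>n. ?N n * ?x c n) sums X1" "(\<lambda>n. (?N n)\<^sup>2 * ?x c n) sums X2" and X12: "X1 \<le> X2"
      and "X2 + - \<alpha> * X1 \<le> r\<^sup>2 * (\<Sum>n. ?N n * (?N n + - \<alpha>) * norm (c (n + 2)))"
      by (rule weighted_sums[OF \<alpha>'(1) Sc' r])
    then have X: "X2 - \<alpha> * X1 \<le> r\<^sup>2 * (\<Sum>n. ?C n)" by simp
    obtain Y1 Y2 where sY: "(\<lambda>n. ?N n * ?x e n) sums Y1" "(\<lambda>n. (?N n)\<^sup>2 * ?x e n) sums Y2" and Y12: "Y1 \<le> Y2" "0 \<le> Y1"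
      and Y: "Y2 + \<alpha> * Y1 \<le> r\<^sup>2 * (\<Sum>n. ?E n)"
      by (rule weighted_sums[OF \<alpha>'(2) Se r])
    have "X2 - \<alpha> * X1 + (Y2 + \<alpha> * Y1) \<le> r\<^sup>2 * (1 - \<alpha>)"
      using X Y mult_left_mono[OF le, of "r\<^sup>2"] by (simp add: distrib_left)
    moreover have "r\<^sup>2 * (1 - \<alpha>) < r * (1 - \<alpha>)" using r \<alpha> by (simp add: power2_eq_square)
    ultimately have key: "X2 - \<alpha> * X1 + Y2 + \<alpha> * Y1 < r * (1 - \<alpha>)" by linarith
    \<comment> \<open>The left side will dominate \<open>|B - z|\<close>, so \<open>B\<close> does
      not vanish and its argument stays within a quarter turn of that of \<open>z\<close>.\<close>
    have nearr: "X1 + Y1 < r"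
    proof -
      have "(1 - \<alpha>) * (X1 + Y1) \<le> X2 - \<alpha> * X1 + Y2 + \<alpha> * Y1"
        using X12 Y12 mult_nonneg_nonneg[OF \<alpha>(1) Y12(2)] by (simp add: algebra_simps)
      then have "(1 - \<alpha>) * (X1 + Y1) < (1 - \<alpha>) * r" using key by (simp add: mult.commute)
      then show ?thesis using \<alpha> by simp
    qed
    define U1 U2 V1 V2 where "U1 = (\<lambda>t. Z t * H1 (Z t) - Z t)" and "U2 = (\<lambda>t. Z t * H1 (Z t) + (Z t)\<^sup>2 * H2 (Z t) - Z t)"
      and "V1 = (\<lambda>t. cnj (Z t * G1 (Z t)))" and "V2 = (\<lambda>t. cnj (Z t * G1 (Z t) + (Z t)\<^sup>2 * G2 (Z t)))"
    define x y where "x = (\<lambda>t n. c (n + 2) * Z t ^ (n + 2))" and "y = (\<lambda>t n. cnj (e (n + 2) * Z t ^ (n + 2)))"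
    have nx: "norm (x t n) = ?x c n" and ny: "norm (y t n) = ?x e n" for t n
      by (simp_all only: x_def y_def norm_mult norm_power nZ complex_mod_cnj)
    have sU1: "(\<lambda>n. of_real (?N n) * x t n) sums U1 t" for t
      using sums_shift2[OF Hs(3)[OF ZD[of t]]] c01 by (simp add: U1_def x_def mult.assoc add.commute)
    have sU2: "(\<lambda>n. of_real ((?N n)\<^sup>2) * x t n) sums U2 t" for t
      using sums_shift2[OF Hs(4)[OF ZD[of t]]] c01 by (simp add: U2_def x_def mult.assoc add.commute)
    have sV1: "(\<lambda>n. of_real (?N n) * y t n) sums V1 t" for t
    proof -
      have "(\<lambda>n. cnj (of_real (?N n) * (e (n + 2) * Z t ^ (n + 2)))) sums V1 t"
        unfolding sums_cnj V1_def using sums_shift2[OF Gs(3)[OF ZD[of t]]] e01 by (simp add: mult.assoc add.commute)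
      then show ?thesis by (simp add: y_def)
    qed
    have sV2: "(\<lambda>n. of_real ((?N n)\<^sup>2) * y t n) sums V2 t" for t
    proof -
      have "(\<lambda>n. cnj (of_real ((?N n)\<^sup>2) * (e (n + 2) * Z t ^ (n + 2)))) sums V2 t"
        unfolding sums_cnj V2_def using sums_shift2[OF Gs(4)[OF ZD[of t]]] e01 by (simp add: mult.assoc add.commute)
      then show ?thesis by (simp add: y_def)
    qed
    \<comment> \<open>With \<open>k \<ge> -2\<close> every weight \<open>n (n + k)\<close>,
      \<open>n \<ge> 2\<close>, is nonnegative, so a negative \<open>k\<close> reduces the majorant
      too. Applying the triangle inequality to \<open>P2\<close> and \<open>P1\<close> separately
      would lose this.\<close>
    have comb: "norm (P2 + of_real k * P1) \<le> R2 + k * R1"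
      if p: "(\<lambda>n. of_real ((?N n)\<^sup>2) * p n) sums P2" "(\<lambda>n. of_real (?N n) * p n) sums P1"
        "(\<lambda>n. (?N n)\<^sup>2 * norm (p n)) sums R2" "(\<lambda>n. ?N n * norm (p n)) sums R1" "k \<ge> - 2"
      for P1 P2 :: complex and R1 R2 k :: real and p :: "nat \<Rightarrow> complex"
    proof (rule norm_le_of_sums)
      show "(\<lambda>n. of_real ((?N n)\<^sup>2) * p n + of_real k * (of_real (?N n) * p n)) sums (P2 + of_real k * P1)"
        by (intro sums_add sums_mult p)
      show "(\<lambda>n. (?N n)\<^sup>2 * norm (p n) + k * (?N n * norm (p n))) sums (R2 + k * R1)"
        by (intro sums_add sums_mult p)
      fix n
      have "0 \<le> ?N n * (?N n + k)" using p(5) by (intro mult_nonneg_nonneg) auto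
      then have pos: "0 \<le> (?N n)\<^sup>2 + k * ?N n" by (simp add: power2_eq_square algebra_simps)
      have "of_real ((?N n)\<^sup>2) * p n + of_real k * (of_real (?N n) * p n) = of_real ((?N n)\<^sup>2 + k * ?N n) * p n"
        by (simp add: algebra_simps)
      then have "norm (of_real ((?N n)\<^sup>2) * p n + of_real k * (of_real (?N n) * p n)) = ((?N n)\<^sup>2 + k * ?N n) * norm (p n)"
        by (simp only: norm_mult norm_of_real abs_of_nonneg[OF pos])
      then show "norm (of_real ((?N n)\<^sup>2) * p n + of_real k * (of_real (?N n) * p n)) \<le> (?N n)\<^sup>2 * norm (p n) + k * (?N n * norm (p n))"
        by (simp add: algebra_simps)
    qed
    have combU: "norm (U2 t + of_real k * U1 t) \<le> X2 + k * X1" if "k \<ge> - 2" for k t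
      by (rule comb[OF sU2 sU1 _ _ that]) (simp_all only: nx sX)
    have combV: "norm (V2 t + of_real k * V1 t) \<le> Y2 + k * Y1" if "k \<ge> - 2" for k t
      by (rule comb[OF sV2 sV1 _ _ that]) (simp_all only: ny sY)
    have B1: "norm (B t - Z t) < r" for t
    proof -
      have "norm (U1 t) \<le> X1"
        by (rule norm_le_of_sums[OF sU1 sX(1)]) (simp add: norm_mult nx del: of_real_add)
      moreover have "norm (V1 t) \<le> Y1"
        by (rule norm_le_of_sums[OF sV1 sY(1)]) (simp add: norm_mult ny del: of_real_add)
      moreover have "B t - Z t = U1 t - V1 t" by (simp add: B_def U1_def V1_def)
      ultimately show ?thesis using nearr norm_triangle_ineq4[of "U1 t" "V1 t"] by simp
    qed
    have B0: "B t \<noteq> 0" for t using B1[of t] nZ[of t] by auto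
    have main: "Re (A t / B t) > \<alpha>" for t
    proof -
      have e1: "A t + of_real (1 - \<alpha>) * B t = of_real (2 - \<alpha>) * Z t + (U2 t + of_real (1 - \<alpha>) * U1 t) + (V2 t + of_real (\<alpha> - 1) * V1 t)"
        by (simp add: A_def B_def U1_def U2_def V1_def V2_def algebra_simps)
      have e2: "A t - of_real (1 + \<alpha>) * B t = of_real (- \<alpha>) * Z t + (U2 t + of_real (- 1 - \<alpha>) * U1 t) + (V2 t + of_real (1 + \<alpha>) * V1 t)"
        by (simp add: A_def B_def U1_def U2_def V1_def V2_def algebra_simps)
      have b1: "(2 - \<alpha>) * r - (X2 + (1 - \<alpha>) * X1) - (Y2 + (\<alpha> - 1) * Y1) \<le> norm (A t + of_real (1 - \<alpha>) * B t)"
      proof -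
        have "norm (of_real (2 - \<alpha>) * Z t) = \<bar>2 - \<alpha>\<bar> * r" by (simp only: norm_mult norm_of_real nZ)
        moreover have "\<bar>2 - \<alpha>\<bar> = 2 - \<alpha>" using \<alpha> by simp
        ultimately have "norm (of_real (2 - \<alpha>) * Z t) = (2 - \<alpha>) * r" by (simp only:)
        then show ?thesis
          unfolding e1
          using combU[of "1 - \<alpha>" t] combV[of "\<alpha> - 1" t] \<alpha>
            norm_diff_ineq[of "of_real (2 - \<alpha>) * Z t" "(U2 t + of_real (1 - \<alpha>) * U1 t)"]
            norm_diff_ineq[of "of_real (2 - \<alpha>) * Z t + (U2 t + of_real (1 - \<alpha>) * U1 t)" "(V2 t + of_real (\<alpha> - 1) * V1 t)"]
          by linarith
      qed
      have b2: "norm (A t - of_real (1 + \<alpha>) * B t) \<le> \<alpha> * r + (X2 + (- 1 - \<alpha>) * X1) + (Y2 + (1 + \<alpha>) * Y1)"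
      proof -
        have "norm (of_real (- \<alpha>) * Z t) = \<bar>- \<alpha>\<bar> * r" by (simp only: norm_mult norm_of_real nZ)
        moreover have "\<bar>- \<alpha>\<bar> = \<alpha>" using \<alpha> by simp
        ultimately have "norm (of_real (- \<alpha>) * Z t) = \<alpha> * r" by (simp only:)
        then show ?thesis
          unfolding e2
          using combU[of "- 1 - \<alpha>" t] combV[of "1 + \<alpha>" t] \<alpha>
            norm_triangle_ineq[of "of_real (- \<alpha>) * Z t" "(U2 t + of_real (- 1 - \<alpha>) * U1 t)"]
            norm_triangle_ineq[of "of_real (- \<alpha>) * Z t + (U2 t + of_real (- 1 - \<alpha>) * U1 t)" "(V2 t + of_real (1 + \<alpha>) * V1 t)"]
          by linarith
      qed
      have lt: "norm (A t - of_real (1 + \<alpha>) * B t) < norm (A t + of_real (1 - \<alpha>) * B t)"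
        using b1 b2 key by (simp add: algebra_simps)
      have "(norm (A t + of_real (1 - \<alpha>) * B t))\<^sup>2 - (norm (A t - of_real (1 + \<alpha>) * B t))\<^sup>2
          = 4 * (Re (A t * cnj (B t)) - \<alpha> * (norm (B t))\<^sup>2)"
        by (simp only: cmod_power2) (simp add: power2_eq_square algebra_simps)
      moreover have "(norm (A t - of_real (1 + \<alpha>) * B t))\<^sup>2 < (norm (A t + of_real (1 - \<alpha>) * B t))\<^sup>2"
        using lt by (intro power_strict_mono) auto
      ultimately have "0 < 4 * (Re (A t * cnj (B t)) - \<alpha> * (norm (B t))\<^sup>2)" by (metis diff_gt_0_iff_gt)
      then have "0 < Re (A t * cnj (B t)) - \<alpha> * (norm (B t))\<^sup>2" by (rule zero_less_mult_pos) simp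
      then have "\<alpha> * (norm (B t))\<^sup>2 < Re (A t * cnj (B t))" by (simp only: diff_gt_0_iff_gt)
      moreover have "Re (A t / B t) = Re (A t * cnj (B t)) / (norm (B t))\<^sup>2"
        by (subst complex_div_cnj) (simp only: Re_divide_of_real)
      ultimately show ?thesis using B0[of t] by (simp add: less_divide_eq)
    qed
    \<comment> \<open>Removing the rotation \<open>cis t\<close> leaves a curve in the right
      half-plane, where the principal logarithm is continuous.\<close>
    define X where "X = (\<lambda>t. cis (- t) * B t)"
    have X0: "Re (X t) > 0" for t
    proof -
      have "X t - of_real r = cis (- t) * (B t - Z t)" by (simp add: X_def Z_def rcis_def right_diff_distrib cis_mult mult.left_commute)
      then have "norm (X t - of_real r) < r" using B1[of t] by (simp add: norm_mult)
      then show ?thesis using abs_Re_le_cmod[of "X t - of_real r"] by (simp add: abs_le_iff)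
    qed
    have Xpos: "X t \<notin> \<real>\<^sub>\<le>\<^sub>0" "X t \<noteq> 0" for t using X0[of t] by (auto simp: complex_nonpos_Reals_iff)
    have dX: "(X has_vector_derivative \<i> * cis (- t) * (A t - B t)) (at t)" for t
    proof -
      have h1: "((\<lambda>s. H1 (Z s)) has_vector_derivative \<i> * Z t * H2 (Z t)) (at t)"
        using field_vector_diff_chain_at[OF dZ Hs(2)[OF ZD]] by (simp add: o_def)
      have g1: "((\<lambda>s. G1 (Z s)) has_vector_derivative \<i> * Z t * G2 (Z t)) (at t)"
        using field_vector_diff_chain_at[OF dZ Gs(2)[OF ZD]] by (simp add: o_def)
      have dc: "((\<lambda>s. cis (- s)) has_vector_derivative - \<i> * cis (- t)) (at t)"
      proof -
        have "((\<lambda>w. exp (- (\<i> * w))) has_field_derivative - \<i> * exp (- (\<i> * of_real t))) (at (of_real t))"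
          by (auto intro!: derivative_eq_intros)
        from has_vector_derivative_real_field[OF this] show ?thesis by (simp add: cis_conv_exp)
      qed
      have "(X has_vector_derivative cis (- t) * ((Z t * (\<i> * Z t * H2 (Z t)) + \<i> * Z t * H1 (Z t)) - cnj (Z t * (\<i> * Z t * G2 (Z t)) + \<i> * Z t * G1 (Z t)))
           + - \<i> * cis (- t) * B t) (at t)"
        unfolding X_def B_def
        by (intro has_vector_derivative_mult dc has_vector_derivative_diff has_vector_derivative_cnj dZ h1 g1)
      moreover have "cis (- t) * ((Z t * (\<i> * Z t * H2 (Z t)) + \<i> * Z t * H1 (Z t)) - cnj (Z t * (\<i> * Z t * G2 (Z t)) + \<i> * Z t * G1 (Z t)))
           + - \<i> * cis (- t) * B t = \<i> * cis (- t) * (A t - B t)"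
        by (simp add: A_def B_def power2_eq_square algebra_simps)
      ultimately show ?thesis by simp
    qed
    \<comment> \<open>The summand \<open>t\<close> restores the rotation, and \<open>pi / 2\<close>
      accounts for the factor \<i> in the angular derivative of \<open>F\<close>.\<close>
    define \<phi> where "\<phi> = (\<lambda>t. t + pi / 2 + Im (Ln (X t)))"
    have d\<phi>: "(\<phi> has_real_derivative Re (A t / B t)) (at t)" for t
    proof -
      have "((\<lambda>s. Ln (X s)) has_vector_derivative \<i> * cis (- t) * (A t - B t) * inverse (X t)) (at t)"
        using field_vector_diff_chain_at[OF dX has_field_derivative_Ln[OF Xpos(1)]] by (simp add: o_def)
      moreover have "\<i> * cis (- t) * (A t - B t) * inverse (X t) = \<i> * (A t / B t - 1)"
        using B0[of t] by (simp add: X_def field_simps)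
      ultimately have "((\<lambda>s. Im (Ln (X s))) has_real_derivative Im (\<i> * (A t / B t - 1))) (at t)"
        using has_field_derivative_Im by force
      then have "(\<phi> has_real_derivative 1 + 0 + Im (\<i> * (A t / B t - 1))) (at t)"
        unfolding \<phi>_def by (intro DERIV_add DERIV_ident DERIV_const)
      then show ?thesis by simp
    qed
    have "arg_branch (theta_deriv F r) \<phi>"
      unfolding arg_branch_def
    proof (intro conjI allI)
      show "continuous_on UNIV \<phi>"
        using d\<phi> DERIV_isCont by (force simp: continuous_on_eq_continuous_at)
      fix t
      show "theta_deriv F r t \<noteq> 0" using B0 by (simp add: theta)
      have "X t = of_real (norm (X t)) * exp (\<i> * of_real (Im (Ln (X t))))"
        using is_Arg_Arg[OF Xpos(2)[of t]] Arg_eq_Im_Ln[OF Xpos(2)[of t]] by (simp add: is_Arg_def)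
      then have "\<i> * B t = \<i> * cis t * (of_real (norm (X t)) * exp (\<i> * of_real (Im (Ln (X t)))))"
        by (metis X_def cis_mult cis_zero mult.assoc mult_1 add.right_inverse)
      also have "\<dots> = of_real (norm (\<i> * B t)) * exp (\<i> * of_real (\<phi> t))"
      proof -
        have "norm (X t) = norm (\<i> * B t)" by (simp add: X_def norm_mult)
        moreover have "exp (\<i> * of_real (\<phi> t)) = cis t * \<i> * exp (\<i> * of_real (Im (Ln (X t))))"
        proof -
          have "exp (\<i> * of_real (\<phi> t)) = cis t * cis (pi / 2) * cis (Im (Ln (X t)))"
            by (simp only: cis_conv_exp[symmetric] \<phi>_def cis_mult)
          then show ?thesis by (simp only: cis_pi_half cis_conv_exp[of "Im (Ln (X t))"])
        qed
        ultimately show ?thesis by (simp add: mult_ac)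
      qed
      finally show "is_Arg (theta_deriv F r t) (\<phi> t)" by (simp add: theta is_Arg_def)
    qed
    then show ?thesis using d\<phi> main by blast
  qed
  ultimately show ?thesis by (auto simp: HK_def)
qed

section \<open>Wright coefficients and the final comparison\<close>

lemma wright_coeff_nonneg:
  assumes "a > 0" "c > 0" "b \<ge> 0" "d \<ge> 0"
  shows "wright_coeff a b c d n \<ge> 0"
proof (cases "n = 0")
  case False
  then have "a + (real n - 1) * b > 0" "c + (real n - 1) * d > 0"
    using assms by (auto intro!: add_pos_nonneg mult_nonneg_nonneg)
  then show ?thesis using False assms by (simp add: wright_coeff_def Gamma_real_pos less_imp_le)
qed (simp add: wright_coeff_def)

lemma wright_coeff_1: "a > 0 \<Longrightarrow> c > 0 \<Longrightarrow> wright_coeff a b c d 1 = 1"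
proof -
  assume "a > 0" "c > 0"
  then have "Gamma a \<noteq> 0" "Gamma c \<noteq> 0"
    using Gamma_real_pos less_irrefl by metis+
  then show ?thesis by (simp add: wright_coeff_def)
qed

text \<open>A common index \<open>n + 2\<close> lets the series be combined termwise; the third
  derivative thereby gains a vanishing term at \<open>n = 0\<close>.\<close>

lemma wright_second_third_deriv_sums:
  assumes "wright_deriv_finite 2 a b c d" "wright_deriv_finite 3 a b c d"
  shows "(\<lambda>n. (real n + 1) * (real n + 2) * wright_coeff a b c d (n + 2)) sums wright_deriv_at_1 2 a b c d"
    and "(\<lambda>n. real n * (real n + 1) * (real n + 2) * wright_coeff a b c d (n + 2)) sums wright_deriv_at_1 3 a b c d"
proof -
  define w where "w = wright_coeff a b c d"
  have "(diffs ^^ 2) w sums wright_deriv_at_1 2 a b c d" "(diffs ^^ 3) w sums wright_deriv_at_1 3 a b c d"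
    using assms by (auto simp: wright_deriv_finite_def wright_deriv_at_1_def w_def summable_sums)
  moreover have "(diffs ^^ 2) w = (\<lambda>n. (real n + 1) * (real n + 2) * w (n + 2))"
    by (rule ext) (simp add: numeral_2_eq_2 diffs_def add.commute)
  moreover have "(diffs ^^ 3) w = (\<lambda>n. real (Suc n) * (real (Suc n) + 1) * (real (Suc n) + 2) * w (Suc n + 2))"
    by (rule ext) (simp add: numeral_3_eq_3 diffs_def)
  ultimately have "(\<lambda>n. (real n + 1) * (real n + 2) * w (n + 2)) sums wright_deriv_at_1 2 a b c d"
    "(\<lambda>n. real (Suc n) * (real (Suc n) + 1) * (real (Suc n) + 2) * w (Suc n + 2)) sums wright_deriv_at_1 3 a b c d"
    by (simp_all only:)
  then show "(\<lambda>n. (real n + 1) * (real n + 2) * wright_coeff a b c d (n + 2)) sums wright_deriv_at_1 2 a b c d"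
    "(\<lambda>n. real n * (real n + 1) * (real n + 2) * wright_coeff a b c d (n + 2)) sums wright_deriv_at_1 3 a b c d"
    using sums_Suc_iff[of "\<lambda>n. real n * (real n + 1) * (real n + 2) * w (n + 2)" "wright_deriv_at_1 3 a b c d"] by (simp_all add: w_def)
qed

lemma wright_first_deriv_sums:
  assumes "wright_deriv_finite 1 a b c d" "a > 0" "c > 0"
  shows "(\<lambda>n. (real n + 2) * wright_coeff a b c d (n + 2)) sums (wright_deriv_at_1 1 a b c d - 1)"
proof -
  define w where "w = wright_coeff a b c d"
  have "diffs w sums wright_deriv_at_1 1 a b c d"
    using assms by (auto simp: wright_deriv_finite_def wright_deriv_at_1_def w_def summable_sums)
  then have "(\<lambda>n. real (Suc n) * w (Suc n)) sums wright_deriv_at_1 1 a b c d" by (simp add: diffs_def)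
  then have "(\<lambda>n. real (Suc (Suc n)) * w (Suc (Suc n))) sums (wright_deriv_at_1 1 a b c d - 1)"
    using sums_Suc_iff[of "\<lambda>n. real (Suc n) * w (Suc n)" "wright_deriv_at_1 1 a b c d - 1"]
      wright_coeff_1[OF assms(2,3)] by (simp add: w_def)
  then show ?thesis by (simp add: w_def add.commute)
qed

text \<open>Membership in \<open>S_H_hat_o\<close> only provides some representation with
  \<open>deriv g 0 = 0\<close>. The derivative of \<open>f\<close> at 0 in direction 1 is
  \<open>1 + cnj (deriv g 0)\<close>, which transfers this to any given pair.\<close>

lemma harmonic_rep_deriv_0_unique:
  assumes "harmonic_rep f h g" "harmonic_rep f h' g'"
  shows "deriv g 0 = deriv g' 0"
proof -
  have fr: "frechet_derivative f (at 0) 1 = 1 + cnj (deriv g 0)" if rep: "harmonic_rep f h g" for h g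
  proof -
    have "h holomorphic_on unit_disc" "g holomorphic_on unit_disc" using rep by (auto simp: harmonic_rep_def)
    then have "(h has_derivative (\<lambda>w. deriv h 0 * w)) (at 0)" "(g has_derivative (\<lambda>w. deriv g 0 * w)) (at 0)"
      unfolding has_field_derivative_def[symmetric] by (auto intro: holomorphic_derivI)
    then have "((\<lambda>w. h w + cnj (g w)) has_derivative (\<lambda>w. deriv h 0 * w + cnj (deriv g 0 * w))) (at 0)"
      by (intro derivative_intros)
    then have "(f has_derivative (\<lambda>w. deriv h 0 * w + cnj (deriv g 0 * w))) (at 0)"
      by (rule has_derivative_transform_within_open[OF _ open_ball[of 0 1]]) (use rep in \<open>auto simp: harmonic_rep_def\<close>)
    then have "frechet_derivative f (at 0) = (\<lambda>w. deriv h 0 * w + cnj (deriv g 0 * w))"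
      by (metis frechet_derivative_at)
    then show ?thesis using rep by (simp add: harmonic_rep_def)
  qed
  show ?thesis using fr[OF assms(1)] fr[OF assms(2)] by simp
qed

theorem theorem5:
  fixes \<alpha> \<alpha>1 \<beta>1 \<gamma>1 \<delta>1 \<alpha>2 \<beta>2 \<gamma>2 \<delta>2 :: real
    and \<sigma> :: complex
    and f h g :: "complex \<Rightarrow> complex"
  assumes "0 \<le> \<alpha>" "\<alpha> < 1"
    and "\<beta>1 \<ge> 0" "\<beta>2 \<ge> 0" "\<delta>1 \<ge> 0" "\<delta>2 \<ge> 0"
    and "\<alpha>1 > 0" "\<alpha>2 > 0" "\<gamma>1 > 0" "\<gamma>2 > 0"
    and "norm \<sigma> < 1"
    and "harmonic_rep f h g" and "f \<in> K_H_hat_o"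
    and "\<And>k. k \<in> {1, 2, 3} \<Longrightarrow> wright_deriv_finite k \<alpha>1 \<beta>1 \<gamma>1 \<delta>1"
    and "\<And>k. k \<in> {2, 3} \<Longrightarrow> wright_deriv_finite k \<alpha>2 \<beta>2 \<gamma>2 \<delta>2"
    and "wright_deriv_at_1 3 \<alpha>1 \<beta>1 \<gamma>1 \<delta>1
           + (4 - \<alpha>) * wright_deriv_at_1 2 \<alpha>1 \<beta>1 \<gamma>1 \<delta>1
           + 2 * (1 - \<alpha>) * (wright_deriv_at_1 1 \<alpha>1 \<beta>1 \<gamma>1 \<delta>1 - 1)
           + norm \<sigma> * (wright_deriv_at_1 3 \<alpha>2 \<beta>2 \<gamma>2 \<delta>2
                         + (2 + \<alpha>) * wright_deriv_at_1 2 \<alpha>2 \<beta>2 \<gamma>2 \<delta>2)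
         \<le> 2 * (1 - \<alpha>)"
  shows "L_op \<alpha>1 \<beta>1 \<gamma>1 \<delta>1 \<alpha>2 \<beta>2 \<gamma>2 \<delta>2 \<sigma> h g \<in> HK \<alpha>"
proof -
  define w v where "w = wright_coeff \<alpha>1 \<beta>1 \<gamma>1 \<delta>1" and "v = wright_coeff \<alpha>2 \<beta>2 \<gamma>2 \<delta>2"
  let ?W1 = "\<lambda>n. (real n + 2) * w (n + 2)" and ?W2 = "\<lambda>n. (real n + 1) * (real n + 2) * w (n + 2)" and ?W3 = "\<lambda>n. real n * (real n + 1) * (real n + 2) * w (n + 2)"
    and ?V2 = "\<lambda>n. (real n + 1) * (real n + 2) * v (n + 2)" and ?V3 = "\<lambda>n. real n * (real n + 1) * (real n + 2) * v (n + 2)"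
  \<comment> \<open>Majorants for the weighted coefficients at index \<open>n + 2\<close>:
    \<open>(n + 3) / 2\<close> and \<open>(n + 1) / 2\<close> are the bounds for the coefficients of
    \<open>h\<close> and \<open>g\<close>.\<close>
  let ?P = "\<lambda>n. (real n + 2) * (real n + 2 - \<alpha>) * ((real n + 3) / 2 * w (n + 2))"
    and ?Q = "\<lambda>n. (real n + 2) * (real n + 2 + \<alpha>) * (norm \<sigma> * ((real n + 1) / 2 * v (n + 2)))"
  define A B where "A = fps_nth (fps_expansion h 0)" and "B = fps_nth (fps_expansion g 0)"
  have rep: "harmonic_rep f h g" by fact
  have hol: "h holomorphic_on unit_disc" "g holomorphic_on unit_disc" and h0: "h 0 = 0" "deriv h 0 = 1" and g0: "g 0 = 0"
    and feq: "\<And>z. z \<in> unit_disc \<Longrightarrow> f z = h z + cnj (g z)"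
    using rep by (auto simp: harmonic_rep_def)
  have K: "f \<in> S_H_hat_o" "convex (f ` unit_disc)" using \<open>f \<in> K_H_hat_o\<close> by (auto simp: K_H_hat_o_def)
  then have S: "inj_on f unit_disc" "sense_preserving f" by (auto simp: S_H_hat_o_def S_H_hat_def)
  have dg0: "deriv g 0 = 0"
    using K(1) harmonic_rep_deriv_0_unique[OF rep] by (auto simp: S_H_hat_o_def)
  have jac: "norm (deriv g z) < norm (deriv h z)" if "z \<in> unit_disc" for z
  proof -
    have "(norm (deriv g z))\<^sup>2 < (norm (deriv h z))\<^sup>2"
      using S(2) jacobian_harmonic_rep[OF rep that] that by (force simp: sense_preserving_def)
    then show ?thesis by (rule power2_less_imp_less) simp
  qed
  have inj': "inj_on (\<lambda>z. h z + cnj (g z)) unit_disc" using S(1) feq by (auto simp: inj_on_def)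
  have "(\<lambda>z. h z + cnj (g z)) ` unit_disc = f ` unit_disc" using feq by (intro image_cong) auto
  then have conv': "convex ((\<lambda>z. h z + cnj (g z)) ` unit_disc)" using K(2) by simp
  have Ab: "norm (A (Suc n)) \<le> (real n + 2) / 2" and Bb: "norm (B (Suc n)) \<le> real n / 2" for n
    unfolding A_def B_def by (rule convex_harmonic_coeff_bounds[OF hol inj' conv' jac h0(2) dg0]; assumption)+
  have w0: "w n \<ge> 0" and v0: "v n \<ge> 0" for n
    using assms by (auto simp: w_def v_def intro: wright_coeff_nonneg)
  define c e where "c = (\<lambda>n. A n * of_real (w n))" and "e = (\<lambda>n. \<sigma> * (B n * of_real (v n)))"
  define D1 D2 D3 E2 E3 where "D1 = wright_deriv_at_1 1 \<alpha>1 \<beta>1 \<gamma>1 \<delta>1" and "D2 = wright_deriv_at_1 2 \<alpha>1 \<beta>1 \<gamma>1 \<delta>1"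
    and "D3 = wright_deriv_at_1 3 \<alpha>1 \<beta>1 \<gamma>1 \<delta>1" and "E2 = wright_deriv_at_1 2 \<alpha>2 \<beta>2 \<gamma>2 \<delta>2" and "E3 = wright_deriv_at_1 3 \<alpha>2 \<beta>2 \<gamma>2 \<delta>2"
  note sD = wright_first_deriv_sums[OF assms(14)[of 1] \<open>\<alpha>1 > 0\<close> \<open>\<gamma>1 > 0\<close>, folded w_def D1_def]
    wright_second_third_deriv_sums[OF assms(14)[of 2] assms(14)[of 3], folded w_def D2_def D3_def]
  note sE = wright_second_third_deriv_sums[OF assms(15)[of 2] assms(15)[of 3], folded v_def E2_def E3_def]
  have "(\<lambda>n. ?W3 n + (4 - \<alpha>) * (?W2 n)
      + 2 * (1 - \<alpha>) * (?W1 n)) sums (D3 + (4 - \<alpha>) * D2 + 2 * (1 - \<alpha>) * (D1 - 1))"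
    by (intro sums_add sums_mult sD) simp_all
  moreover have "?W3 n + (4 - \<alpha>) * (?W2 n)
      + 2 * (1 - \<alpha>) * (?W1 n) = 2 * (?P n)" for n
    by (simp add: field_simps)
  ultimately have sums1: "(\<lambda>n. 2 * (?P n)) sums (D3 + (4 - \<alpha>) * D2 + 2 * (1 - \<alpha>) * (D1 - 1))"
    by (simp only:)
  have "(\<lambda>n. norm \<sigma> * (?V3 n + (2 + \<alpha>) * (?V2 n)))
      sums (norm \<sigma> * (E3 + (2 + \<alpha>) * E2))"
    by (intro sums_add sums_mult sE) simp_all
  moreover have "norm \<sigma> * (?V3 n + (2 + \<alpha>) * (?V2 n))
      = 2 * (?Q n)" for n
    by (simp add: field_simps)
  ultimately have sums2: "(\<lambda>n. 2 * (?Q n)) sums (norm \<sigma> * (E3 + (2 + \<alpha>) * E2))"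
    by (simp only:)
  define p q where "p = (\<lambda>n. (real n + 2) * (real n + 2 - \<alpha>) * norm (c (n + 2)))" and "q = (\<lambda>n. (real n + 2) * (real n + 2 + \<alpha>) * norm (e (n + 2)))"
  have p0: "p n \<ge> 0" and q0: "q n \<ge> 0" for n
    using \<open>0 \<le> \<alpha>\<close> \<open>\<alpha> < 1\<close> by (auto simp: p_def q_def)
  have p1: "2 * p n \<le> 2 * (?P n)" for n
  proof -
    have "norm (c (n + 2)) \<le> (real n + 3) / 2 * w (n + 2)"
      using mult_right_mono[OF Ab[of "Suc n"] w0[of "n + 2"]] w0[of "n + 2"] by (simp add: c_def norm_mult add.commute)
    then show ?thesis using \<open>\<alpha> < 1\<close> unfolding p_def by (intro mult_left_mono mult_nonneg_nonneg) auto
  qed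
  have q1: "2 * q n \<le> 2 * (?Q n)" for n
  proof -
    have "norm (B (n + 2)) * v (n + 2) \<le> (real n + 1) / 2 * v (n + 2)"
      using mult_right_mono[OF Bb[of "Suc n"] v0[of "n + 2"]] by (simp add: add.commute)
    then have "norm \<sigma> * (norm (B (n + 2)) * v (n + 2)) \<le> norm \<sigma> * ((real n + 1) / 2 * v (n + 2))"
      by (rule mult_left_mono) simp
    then have "norm (e (n + 2)) \<le> norm \<sigma> * ((real n + 1) / 2 * v (n + 2))"
      using v0[of "n + 2"] by (simp add: e_def norm_mult)
    then show ?thesis using \<open>0 \<le> \<alpha>\<close> unfolding q_def by (intro mult_left_mono mult_nonneg_nonneg) auto
  qed
  have sp: "summable (\<lambda>n. 2 * p n)"
    by (rule summable_comparison_test[OF _ sums_summable[OF sums1]]) (use p0 p1 in auto)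
  have sq: "summable (\<lambda>n. 2 * q n)"
    by (rule summable_comparison_test[OF _ sums_summable[OF sums2]]) (use q0 q1 in auto)
  have sp': "summable p" and sq': "summable q" using sp sq by simp_all
  have s1: "2 * suminf p \<le> D3 + (4 - \<alpha>) * D2 + 2 * (1 - \<alpha>) * (D1 - 1)"
    using sums_le[OF p1 sums_mult[OF summable_sums[OF sp']] sums1] .
  have s2: "2 * suminf q \<le> norm \<sigma> * (E3 + (2 + \<alpha>) * E2)"
    using sums_le[OF q1 sums_mult[OF summable_sums[OF sq']] sums2] .
  have "D3 + (4 - \<alpha>) * D2 + 2 * (1 - \<alpha>) * (D1 - 1) + norm \<sigma> * (E3 + (2 + \<alpha>) * E2) \<le> 2 * (1 - \<alpha>)"
    using assms(16) unfolding D1_def D2_def D3_def E2_def E3_def .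
  then have "2 * suminf p + 2 * suminf q \<le> 2 * (1 - \<alpha>)" by (rule order_trans[OF add_mono[OF s1 s2]])
  then have le: "suminf p + suminf q \<le> 1 - \<alpha>" by simp
  show ?thesis
  proof (rule HK_coeff_sufficient[of \<alpha> c e, folded p_def q_def, OF \<open>0 \<le> \<alpha>\<close> \<open>\<alpha> < 1\<close> _ _ _ _ sp' sq' le])
    have w1: "w 1 = 1" unfolding w_def by (rule wright_coeff_1[OF \<open>\<alpha>1 > 0\<close> \<open>\<gamma>1 > 0\<close>])
    show "c 0 = 0" "e 0 = 0" by (simp_all add: c_def e_def w_def v_def wright_coeff_def)
    show "c 1 = 1" using w1 h0 by (simp add: c_def A_def fps_expansion_def)
    show "e 1 = 0" using dg0 by (simp add: e_def B_def fps_expansion_def)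
    fix z :: complex assume z: "z \<in> unit_disc"
    have "norm (B n * of_real (v n) * z ^ n) \<le> norm (B n * of_real (v n))" for n
    proof -
      have "norm (B n * of_real (v n) * z ^ n) \<le> norm (B n * of_real (v n)) * 1"
        unfolding norm_mult[of _ "z ^ n"] norm_power using z by (intro mult_left_mono power_le_one) auto
      then show ?thesis by simp
    qed
    \<comment> \<open>Needed to move \<sigma> into the series. The summability found for
      \<open>e\<close> is no substitute, since \<sigma> may be 0; the second derivative series of
      the Wright function dominates instead.\<close>
    moreover have "summable (\<lambda>n. norm (B n * of_real (v n)))"
    proof -
      have "summable (\<lambda>n. norm (B (n + 2) * of_real (v (n + 2))))"
      proof (rule summable_comparison_test[OF _ sums_summable[OF sE(1)]], intro exI allI impI)
        fix n
        have "norm (B (n + 2)) * v (n + 2) \<le> ((real n + 1) * (real n + 2)) * v (n + 2)"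
        proof (rule mult_right_mono[OF _ v0])
          have "norm (B (n + 2)) \<le> (real n + 1) / 2" using Bb[of "Suc n"] by (simp add: add.commute)
          also have "\<dots> \<le> (real n + 1) * (real n + 2)" by (simp add: algebra_simps)
          finally show "norm (B (n + 2)) \<le> (real n + 1) * (real n + 2)" .
        qed
        then show "norm (norm (B (n + 2) * of_real (v (n + 2)))) \<le> ?V2 n"
          using v0[of "n + 2"] by (simp add: norm_mult)
      qed simp_all
      then show ?thesis by (subst (asm) summable_iff_shift)
    qed
    ultimately have "summable (\<lambda>n. B n * of_real (v n) * z ^ n)"
      by (intro summable_comparison_test[of "\<lambda>n. B n * of_real (v n) * z ^ n" "\<lambda>n. norm (B n * of_real (v n))"]) auto
    from suminf_mult[OF this, of \<sigma>]
    have "\<sigma> * wright_conv \<alpha>2 \<beta>2 \<gamma>2 \<delta>2 g z = eval_fps (Abs_fps e) z"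
      by (simp add: wright_conv_def eval_fps_def hadamard_def wright_fps_def e_def B_def v_def mult.assoc)
    moreover have "wright_conv \<alpha>1 \<beta>1 \<gamma>1 \<delta>1 h z = eval_fps (Abs_fps c) z"
      by (simp add: wright_conv_def eval_fps_def hadamard_def wright_fps_def c_def A_def w_def)
    ultimately show "L_op \<alpha>1 \<beta>1 \<gamma>1 \<delta>1 \<alpha>2 \<beta>2 \<gamma>2 \<delta>2 \<sigma> h g z = eval_fps (Abs_fps c) z + cnj (eval_fps (Abs_fps e) z)"
      by (simp add: L_op_def)
  qed
qed

end
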